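(* Let $\mathcal{K}$ be a finite connected simplicial complex of dimension at most $2$ (a $2$-complex) with $n$ simplices in total, and let $g=\dim \mathsf{H}_1(\mathcal{K})$ (homology with $\mathbb{Z}_2$ coefficients). Then the Edge Annotation Algorithm (described in the context) computes an annotation $\mathrm{a}\colon E\to(\mathbb{Z}_2)^g$ of length $g=\dim \mathsf{H}_1(\mathcal{K})$ for the edges of $\mathcal{K}$, and it can be carried out in $O(n^{\omega})$ time.
   Context: All homology is simplicial with $\mathbb{Z}_2$ coefficients; $\mathsf{C}_p,\mathsf{Z}_p,\mathsf{B}_p,\mathsf{H}_p=\mathsf{Z}_p/\mathsf{B}_p$ are the spaces of $p$-chains, $p$-cycles, $p$-boundaries and the $p$-th homology group of $\mathcal{K}$. A $p$-chain is identified with the set of $p$-simplices having coefficient $1$ (and with its incidence column vector), so $\sigma\in z$ means that $\sigma$ has coefficient $1$ in $z$. The boundary matrix of $\partial_p$ has as columns the boundaries of the $p$-simplices. $n_p$ is the number of $p$-simplices, and $V$, $E$ are the sets of vertices and edges of $\mathcal{K}$. Annotation: with $g=\dim\mathsf{H}_p(\mathcal{K})$, an annotation for $p$-simplices is a function $\mathrm{a}$ from the set of $p$-simplices of $\mathcal{K}$ to $(\mathbb{Z}_2)^g$ such that any two $p$-cycles $z,z'$ are homologous if and only if $\sum_{\sigma\in z}\mathrm{a}(\sigma)=\sum_{\sigma\in z'}\mathrm{a}(\sigma)$. Edges are the case $p=1$. $\omega>2$ denotes a real number such that two $n\times n$ matrices (over $\mathbb{Z}_2$) can be multiplied in $O(n^{\omega})$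 time. Time is counted in unit-cost elementary operations. Earliest basis: for a matrix $A$ of rank $r$, the earliest basis of $A$ is the set of columns of $A$ indexed by the lexicographically smallest index set $\{i_1<\dots<i_r\}$ such that the corresponding columns are linearly independent; equivalently, a column is in the earliest basis iff it is not in the span of the columns to its left. Edge Annotation Algorithm. Step 1: fix a spanning tree $T$ of the $1$-skeleton of $\mathcal{K}$. Let $k=n_1-n_0+1$ and let $e_1,\dots,e_k$ be the edges not in $T$ (sentinel edges). For each sentinel edge $e$, let $\gamma(T,e)$ be the cycle consisting of $e$ and the edges of the unique simple path in $T$ connecting the endpoints of $e$. Let $Z=[\gamma(T,e_1)\,\cdots\,\gamma(T,e_k)]$ be the matrix whose columns are the chain vectors of these cycles. Step 2: compute the earliest basis $\widetilde{Z}=[B\mid H]$ of the matrix $[\partial_2\mid Z]$, where $B$ consists of the first $\operatorname{rank}(\partial_2)$ columns of $\widetilde Z$. ($H$ then has $g$ columns.) Step 3: solve $\widetilde{Z}X=Z$ for $X$; the annotation of the sentinel edge $e_i$ is the vector formed by the last $g$ entries of the $i$-th column of $X$. The annotation of every edge of $T$ is the zero vector. *)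

theory Defs
  imports
    Complex_Main
    "HOL-Library.Landau_Symbols"
    "HOL-Library.Z2"
    "Jordan_Normal_Form.DL_Rank"
begin

section \<open>Simplicial complexes and homology over the field with two elements\<close>

definition simplicial_complex :: "'v set set \<Rightarrow> bool" where
  "simplicial_complex K \<longleftrightarrow> finite K \<and> (\<forall>\<sigma>\<in>K. finite \<sigma> \<and> \<sigma> \<noteq> {}) \<and>
     (\<forall>\<sigma>\<in>K. \<forall>\<tau>. \<tau> \<subseteq> \<sigma> \<and> \<tau> \<noteq> {} \<longrightarrow> \<tau> \<in> K)"

definition simplices :: "'v set set \<Rightarrow> nat \<Rightarrow> 'v set set" where
  "simplices K p = {\<sigma> \<in> K. card \<sigma> = p + 1}"

abbreviation vertices :: "'v set set \<Rightarrow> 'v set" where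
  "vertices K \<equiv> \<Union>K"

abbreviation edges :: "'v set set \<Rightarrow> 'v set set" where
  "edges K \<equiv> simplices K 1"

text \<open>A \<open>p\<close>-chain is the set of the \<open>p\<close>-simplices that have coefficient 1 in it, so addition of
  chains is symmetric difference.  The boundary of a chain consists of the codimension-1 faces
  that occur in an odd number of its simplices.  The empty set is not a simplex, so 0-chains
  have zero boundary (unreduced homology).\<close>

definition chains :: "'v set set \<Rightarrow> nat \<Rightarrow> 'v set set set" where
  "chains K p = Pow (simplices K p)"

definition boundary :: "'v set set \<Rightarrow> 'v set set \<Rightarrow> 'v set set" where
  "boundary K c = {\<tau> \<in> K. odd (card {\<sigma> \<in> c. \<tau> \<subseteq> \<sigma> \<and> card \<sigma> = card \<tau> + 1})}"

definition cycles :: "'v set set \<Rightarrow> nat \<Rightarrow> 'v set set set" where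
  "cycles K p = {z \<in> chains K p. boundary K z = {}}"

definition boundaries :: "'v set set \<Rightarrow> nat \<Rightarrow> 'v set set set" where
  "boundaries K p = boundary K ` chains K (p + 1)"

definition homologous :: "'v set set \<Rightarrow> nat \<Rightarrow> 'v set set \<Rightarrow> 'v set set \<Rightarrow> bool" where
  "homologous K p z z' \<longleftrightarrow> sym_diff z z' \<in> boundaries K p"

definition homology :: "'v set set \<Rightarrow> nat \<Rightarrow> (bit, 'v set set set) module" where
  "homology K p =
     \<lparr> carrier = cycles K p // {(z, z'). z \<in> cycles K p \<and> z' \<in> cycles K p \<and> homologous K p z z'},
       mult = undefined, one = undefined,
       zero = boundaries K p,
       add = (\<lambda>C D. {sym_diff c d |c d. c \<in> C \<and> d \<in> D}),
       smult = (\<lambda>a C. if a = 0 then boundaries K p else C) \<rparr>"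

definition homology_dim :: "'v set set \<Rightarrow> nat \<Rightarrow> nat" where
  "homology_dim K p = vectorspace.dim (class_ring :: bit ring) (homology K p)"

definition chain_annotation :: "nat \<Rightarrow> ('v set \<Rightarrow> bit vec) \<Rightarrow> 'v set set \<Rightarrow> bit vec" where
  "chain_annotation g a z = vec g (\<lambda>j. \<Sum>\<sigma>\<in>z. a \<sigma> $ j)"

definition is_annotation :: "'v set set \<Rightarrow> nat \<Rightarrow> ('v set \<Rightarrow> bit vec) \<Rightarrow> bool" where
  "is_annotation K p a \<longleftrightarrow>
     (let g = homology_dim K p in
       (\<forall>\<sigma> \<in> simplices K p. a \<sigma> \<in> carrier_vec g) \<and>
       (\<forall>z \<in> cycles K p. \<forall>z' \<in> cycles K p.
          homologous K p z z' \<longleftrightarrow> chain_annotation g a z = chain_annotation g a z'))"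


section \<open>Paths and spanning trees\<close>

text \<open>Graphs are given by a vertex set \<open>V\<close> and a set \<open>F\<close> of two-element vertex sets; paths are
  nonempty vertex lists.\<close>

definition path_edges :: "'v list \<Rightarrow> 'v set set" where
  "path_edges p = {{p ! i, p ! Suc i} |i. Suc i < length p}"

definition walk :: "'v set \<Rightarrow> 'v set set \<Rightarrow> 'v \<Rightarrow> 'v \<Rightarrow> 'v list \<Rightarrow> bool" where
  "walk V F u v p \<longleftrightarrow>
     p \<noteq> [] \<and> hd p = u \<and> last p = v \<and> set p \<subseteq> V \<and> path_edges p \<subseteq> F"

definition simple_path :: "'v set \<Rightarrow> 'v set set \<Rightarrow> 'v \<Rightarrow> 'v \<Rightarrow> 'v list \<Rightarrow> bool" where
  "simple_path V F u v p \<longleftrightarrow> walk V F u v p \<and> distinct p"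

definition connected_graph :: "'v set \<Rightarrow> 'v set set \<Rightarrow> bool" where
  "connected_graph V F \<longleftrightarrow> V \<noteq> {} \<and> (\<forall>u\<in>V. \<forall>v\<in>V. \<exists>p. walk V F u v p)"

definition acyclic_graph :: "'v set set \<Rightarrow> bool" where
  "acyclic_graph F \<longleftrightarrow>
     \<not> (\<exists>p. 3 \<le> length p \<and> distinct p \<and> path_edges p \<subseteq> F \<and> {last p, hd p} \<in> F)"

definition spanning_tree :: "'v set \<Rightarrow> 'v set set \<Rightarrow> 'v set set \<Rightarrow> bool" where
  "spanning_tree V F T \<longleftrightarrow> T \<subseteq> F \<and> connected_graph V T \<and> acyclic_graph T"

definition connected_2_complex :: "'v set set \<Rightarrow> bool" where
  "connected_2_complex K \<longleftrightarrow>
     simplicial_complex K \<and> (\<forall>\<sigma>\<in>K. card \<sigma> \<le> 3) \<and> connected_graph (vertices K) (edges K)"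


section \<open>Earliest bases\<close>

definition cols_independent :: "bit mat \<Rightarrow> nat list \<Rightarrow> bool" where
  "cols_independent A js \<longleftrightarrow> distinct (map (col A) js) \<and>
     \<not> LinearCombinations.module.lin_dep class_ring (module_vec TYPE(bit) (dim_row A))
         (set (map (col A) js))"

text \<open>Column index sets of size \<open>rank A\<close>, as increasing lists, whose columns are linearly
  independent.\<close>

definition col_basis :: "bit mat \<Rightarrow> nat list \<Rightarrow> bool" where
  "col_basis A js \<longleftrightarrow> sorted_wrt (<) js \<and> set js \<subseteq> {..<dim_col A} \<and>
     length js = vec_space.rank (dim_row A) A \<and> cols_independent A js"

definition earliest_basis_indices :: "bit mat \<Rightarrow> nat list" where
  "earliest_basis_indices A =
     (THE js. col_basis A js \<and>
        (\<forall>js'. col_basis A js' \<longrightarrow> js = js' \<or> (js, js') \<in> lexord {(i, j). i < j}))"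

definition earliest_basis :: "bit mat \<Rightarrow> bit mat" where
  "earliest_basis A = mat_of_cols (dim_row A) (map (col A) (earliest_basis_indices A))"


section \<open>The edge annotation algorithm\<close>

definition enumerates :: "'b list \<Rightarrow> 'b set \<Rightarrow> bool" where
  "enumerates xs A \<longleftrightarrow> distinct xs \<and> set xs = A"

definition chain_vec :: "'v set list \<Rightarrow> 'v set set \<Rightarrow> bit vec" where
  "chain_vec es z = vec (length es) (\<lambda>i. of_bool (es ! i \<in> z))"

definition boundary_matrix :: "'v set set \<Rightarrow> 'v set list \<Rightarrow> 'v set list \<Rightarrow> bit mat" where
  "boundary_matrix K es ts =
     mat_of_cols (length es) (map (\<lambda>t. chain_vec es (boundary K {t})) ts)"

text \<open>The cycle formed by \<open>e\<close> and the simple path in the spanning tree \<open>T\<close> between the endpoints of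
  \<open>e\<close>; that path is unique up to reversal, so its edge set does not depend on the choice.\<close>

definition tree_cycle :: "'v set \<Rightarrow> 'v set set \<Rightarrow> 'v set \<Rightarrow> 'v set set" where
  "tree_cycle V T e =
     insert e (\<Union>{path_edges p |p. \<exists>u v. e = {u, v} \<and> u \<noteq> v \<and> simple_path V T u v p})"

definition cycle_matrix ::
    "'v set set \<Rightarrow> 'v set list \<Rightarrow> 'v set set \<Rightarrow> 'v set list \<Rightarrow> bit mat" where
  "cycle_matrix K es T ss =
     mat_of_cols (length es) (map (\<lambda>e. chain_vec es (tree_cycle (vertices K) T e)) ss)"

text \<open>\<open>es\<close> and \<open>ts\<close> enumerate the edges and the triangles, \<open>T\<close> is the spanning tree and \<open>ss\<close>
  enumerates the sentinel edges.  The number \<open>h\<close> of columns of \<open>H\<close> in \<open>[B | H]\<close> is what the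
  algorithm obtains from its own data; that it equals the dimension of the first homology group
  is part of its correctness.\<close>

definition edge_annotation_output ::
    "'v set set \<Rightarrow> 'v set list \<Rightarrow> 'v set list \<Rightarrow> 'v set set \<Rightarrow> 'v set list \<Rightarrow>
     ('v set \<Rightarrow> bit vec) \<Rightarrow> bool" where
  "edge_annotation_output K es ts T ss a \<longleftrightarrow>
     (let D = boundary_matrix K es ts;
          Z = cycle_matrix K es T ss;
          Z' = earliest_basis (mat_of_cols (length es) (cols D @ cols Z));
          h = dim_col Z' - vec_space.rank (length es) D
      in \<exists>X \<in> carrier_mat (dim_col Z') (dim_col Z).
           Z' * X = Z \<and>
           (\<forall>i < length ss. a (ss ! i) = vec_last (col X i) h) \<and>
           (\<forall>e \<in> T. a e = 0\<^sub>v h))"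


section \<open>Random access machine programs with unit-cost operations\<close>

text \<open>A program works on finitely many arrays of natural numbers, named by the constants in the
  program text and addressed by computed indices.  Every operation costs one unit.  To make the
  unit-cost measure meaningful, all numbers have to stay below a word bound \<open>w\<close>: a program
  gets stuck (there is no execution) when a computed value exceeds \<open>w\<close>.\<close>

type_synonym memory = "nat \<Rightarrow> nat \<Rightarrow> nat"

datatype binop = Plus | Minus | Times | Divide | Modulo | Less | Equal

datatype expr = Const nat | Get nat expr | Op binop expr expr

datatype prog = Skip | Put nat expr expr | Seq prog prog | Cond expr prog prog | Loop expr prog

fun op_val :: "binop \<Rightarrow> nat \<Rightarrow> nat \<Rightarrow> nat" where
  "op_val Plus x y = x + y"
| "op_val Minus x y = x - y"
| "op_val Times x y = x * y"
| "op_val Divide x y = x div y"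
| "op_val Modulo x y = x mod y"
| "op_val Less x y = of_bool (x < y)"
| "op_val Equal x y = of_bool (x = y)"

fun expr_val :: "expr \<Rightarrow> memory \<Rightarrow> nat" where
  "expr_val (Const k) s = k"
| "expr_val (Get a e) s = s a (expr_val e s)"
| "expr_val (Op b e f) s = op_val b (expr_val e s) (expr_val f s)"

fun expr_cost :: "expr \<Rightarrow> nat" where
  "expr_cost (Const k) = 1"
| "expr_cost (Get a e) = expr_cost e + 1"
| "expr_cost (Op b e f) = expr_cost e + expr_cost f + 1"

fun fits :: "nat \<Rightarrow> expr \<Rightarrow> memory \<Rightarrow> bool" where
  "fits w (Const k) s \<longleftrightarrow> k \<le> w"
| "fits w (Get a e) s \<longleftrightarrow> fits w e s \<and> expr_val (Get a e) s \<le> w"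
| "fits w (Op b e f) s \<longleftrightarrow> fits w e s \<and> fits w f s \<and> expr_val (Op b e f) s \<le> w"

text \<open>\<open>exec w P s t s'\<close>: with word bound \<open>w\<close>, program \<open>P\<close> started in memory \<open>s\<close> terminates after
  exactly \<open>t\<close> unit-cost operations in memory \<open>s'\<close>.\<close>

inductive exec :: "nat \<Rightarrow> prog \<Rightarrow> memory \<Rightarrow> nat \<Rightarrow> memory \<Rightarrow> bool" for w :: nat where
  Skip: "exec w Skip s 1 s"
| Put: "fits w i s \<Longrightarrow> fits w e s \<Longrightarrow>
    exec w (Put a i e) s (expr_cost i + expr_cost e + 1)
      (s(a := (s a)(expr_val i s := expr_val e s)))"
| Seq: "exec w P s t s' \<Longrightarrow> exec w Q s' u s'' \<Longrightarrow> exec w (Seq P Q) s (t + u) s''"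
| CondTrue: "fits w b s \<Longrightarrow> expr_val b s \<noteq> 0 \<Longrightarrow> exec w P s t s' \<Longrightarrow>
    exec w (Cond b P Q) s (expr_cost b + 1 + t) s'"
| CondFalse: "fits w b s \<Longrightarrow> expr_val b s = 0 \<Longrightarrow> exec w Q s t s' \<Longrightarrow>
    exec w (Cond b P Q) s (expr_cost b + 1 + t) s'"
| LoopFalse: "fits w b s \<Longrightarrow> expr_val b s = 0 \<Longrightarrow> exec w (Loop b P) s (expr_cost b + 1) s"
| LoopTrue: "fits w b s \<Longrightarrow> expr_val b s \<noteq> 0 \<Longrightarrow> exec w P s t s' \<Longrightarrow>
    exec w (Loop b P) s' u s'' \<Longrightarrow> exec w (Loop b P) s (expr_cost b + 1 + t + u) s''"

text \<open>Array number \<open>k\<close> initially holds the \<open>k\<close>-th input list; all other cells are zero.\<close>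

definition load :: "nat list list \<Rightarrow> memory" where
  "load xss = (\<lambda>a i. if a < length xss \<and> i < length (xss ! a) then xss ! a ! i else 0)"

definition halts_within :: "nat \<Rightarrow> prog \<Rightarrow> nat list list \<Rightarrow> nat \<Rightarrow> (memory \<Rightarrow> bool) \<Rightarrow> bool" where
  "halts_within w P xss b Q \<longleftrightarrow> (\<exists>t s. exec w P (load xss) t s \<and> t \<le> b \<and> Q s)"

definition bit_nat :: "bit \<Rightarrow> nat" where
  "bit_nat x = of_bool (x = 1)"

definition row_major :: "bit mat \<Rightarrow> nat list" where
  "row_major A = concat (map (\<lambda>i. map (\<lambda>j. bit_nat (A $$ (i, j))) [0..<dim_col A]) [0..<dim_row A])"

text \<open>Two \<open>m \<times> m\<close> matrices over the two-element field can be multiplied in \<open>O(m\<^sup>\<omega>)\<close> time.  The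
  machine words have \<open>O(log m)\<close> bits, that is, numbers are bounded by a polynomial in \<open>m\<close>.\<close>

definition matrix_mult_exponent :: "real \<Rightarrow> bool" where
  "matrix_mult_exponent \<omega> \<longleftrightarrow>
     (\<exists>P c (time :: nat \<Rightarrow> nat). (\<lambda>m. real (time m)) \<in> O(\<lambda>m. real m powr \<omega>) \<and>
        (\<forall>m. \<forall>A \<in> carrier_mat m m. \<forall>B \<in> carrier_mat m m.
           halts_within ((m + 2) ^ c) P [[m], row_major A, row_major B] (time m)
             (\<lambda>s. \<forall>i < m. \<forall>j < m. s 3 (i * m + j) = bit_nat ((A * B) $$ (i, j)))))"

text \<open>Machine representation of a 2-complex: the vertices are \<open>0, \<dots>, n0 - 1\<close>, and the edges and
  triangles are listed, in any order, by their vertices, in any order.\<close>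

definition pair_edges :: "(nat \<times> nat) list \<Rightarrow> nat set list" where
  "pair_edges E = map (\<lambda>(u, v). {u, v}) E"

definition triple_triangles :: "(nat \<times> nat \<times> nat) list \<Rightarrow> nat set list" where
  "triple_triangles F = map (\<lambda>(u, v, x). {u, v, x}) F"

definition represents ::
    "nat \<Rightarrow> (nat \<times> nat) list \<Rightarrow> (nat \<times> nat \<times> nat) list \<Rightarrow> nat set set \<Rightarrow> bool" where
  "represents n0 E F K \<longleftrightarrow> vertices K = {..<n0} \<and>
     enumerates (pair_edges E) (simplices K 1) \<and> enumerates (triple_triangles F) (simplices K 2)"

definition complex_input ::
    "nat \<Rightarrow> (nat \<times> nat) list \<Rightarrow> (nat \<times> nat \<times> nat) list \<Rightarrow> nat list list" where
  "complex_input n0 E F =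
     [[n0, length E, length F],
      map fst E, map snd E,
      map fst F, map (fst \<circ> snd) F, map (snd \<circ> snd) F]"

text \<open>Output of an annotation of length \<open>g\<close>: array 6 starts with \<open>g\<close>, and array 7 lists the
  annotations of the edges one after the other.\<close>

definition holds_annotation ::
    "nat \<Rightarrow> nat set list \<Rightarrow> (nat set \<Rightarrow> bit vec) \<Rightarrow> memory \<Rightarrow> bool" where
  "holds_annotation g es a s \<longleftrightarrow> s 6 0 = g \<and>
     (\<forall>i < length es. \<forall>j < g. s 7 (i * g + j) = bit_nat (a (es ! i) $ j))"

end

theory Submission
  imports Defs
begin

text \<open>A forest contains no nonempty set of edges with all degrees even.  Hence a cycle is determined
  by its sentinel edges, the columns of \<open>Z\<close> form a basis of the cycles, and the columns of \<open>H\<close>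
  complete a basis of the boundaries to one of the cycles.  The last coordinates in this basis are
  therefore linear on cycles and vanish exactly on the boundaries.

  For the running time, all solutions are read off from one Gaussian elimination.  In the
  coordinates given by the sentinel edges, \<open>Z\<close> is the identity matrix and the boundary matrix is
  its restriction to the sentinel rows.  If the sentinel edges whose rows receive no pivot come first,
  their cycles are the columns of \<open>H\<close>, and the accumulated row transformation contains the
  annotations.  Eliminating blocks of columns, a block of \<open>b\<close> columns of an \<open>N \<times> N\<close> matrix is
  updated with \<open>N / b\<close> products of \<open>b \<times> b\<close> matrices, and there are \<open>O(N / b)\<close> such updates.
  Summing \<open>(N / b)\<^sup>2 * b powr \<omega>\<close> over the powers \<open>b\<close> of 2 up to \<open>N\<close> gives \<open>O(N powr \<omega>)\<close> as
  \<open>\<omega> > 2\<close>.\<close>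

section \<open>Gaussian elimination in place\<close>

text \<open>The program never computes an earliest basis. A row that receives no pivot ends up zero,
  so its row of the accumulated transformation is a set of sentinel edges that meets every triangle
  boundary evenly: a cocycle vanishing on the tree. These cocycles are dual to the cycles of the
  rows without pivot, and \<open>output_if_functionals\<close> concludes from this duality and a
  rank count that they are the output for a suitable order of the sentinel edges. That order depends
  on the pivots, so it is fixed only after the elimination.

  Block elimination is lazy: at any moment different columns have undergone different numbers of
  pivot steps. \<open>At u\<close> is the matrix after \<open>u\<close> steps, and one block update
  moves a block of columns from one such version to a later one.

  The given multiplication program may assume zeroed memory. Clearing all cells that it can address
  would take a power of the block size unrelated to \<omega>, so each call gets a new address range.
  There are at most \<open>2 * N * N\<close> calls, hence addresses stay polynomial and fit the word
  bound.\<close>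

declare add_bit_eq_xor [simp del] mult_bit_eq_and [simp del]

lemma bit_add_self [simp]: "x + x = (0 :: bit)"
  by (cases x) auto

definition pick :: "nat \<Rightarrow> (nat \<Rightarrow> nat \<Rightarrow> bit) \<Rightarrow> nat set \<Rightarrow> nat \<Rightarrow> nat option" where
  "pick N A U t = (if \<exists>i<N. i \<notin> U \<and> A i t = 1
     then Some (Max {i. i < N \<and> i \<notin> U \<and> A i t = 1}) else None)"

lemma pick_Some: "pick N A U t = Some r \<Longrightarrow> r < N \<and> r \<notin> U \<and> A r t = 1"
proof -
  assume a: "pick N A U t = Some r"
  let ?S = "{i. i < N \<and> i \<notin> U \<and> A i t = 1}"
  have "?S \<noteq> {}" "r = Max ?S" using a by (auto simp: pick_def split: if_splits)
  then have "r \<in> ?S" using Max_in[of ?S] by simp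
  then show ?thesis by simp
qed

lemma pick_None: "pick N A U t = None \<Longrightarrow> i < N \<Longrightarrow> i \<notin> U \<Longrightarrow> A i t = 0"
  by (auto simp: pick_def split: if_splits)

text \<open>A pivot column is overwritten by the column of the accumulated row transformation that
  belongs to its pivot row; over the field with two elements both columns agree at the time of
  the pivot step, so the column simply stays.\<close>

locale elimination =
  fixes N :: nat and M :: "nat \<Rightarrow> nat \<Rightarrow> bit" and U0 :: "nat set"
begin

text \<open>The summand \<open>of_bool (i = r)\<close> cancels the pivot entry, so the pivot row
  stays as it is, while every other row is cleared, used rows included. Columns left of
  \<open>t\<close> are changed too, since they carry the transformation.\<close>

primrec state :: "nat \<Rightarrow> (nat \<Rightarrow> nat \<Rightarrow> bit) \<times> nat set" where
  "state 0 = (M, U0)"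
| "state (Suc t) = (let A = fst (state t); U = snd (state t) in
     case pick N A U t of None \<Rightarrow> (A, U)
     | Some r \<Rightarrow> (\<lambda>i x. if x = t then A i x else A i x + (A i t + of_bool (i = r)) * A r x, insert r U))"

definition "At t = fst (state t)"
definition "Ut t = snd (state t)"
definition "pv t = pick N (At t) (Ut t) t"

lemma At_0: "At 0 = M" and Ut_0: "Ut 0 = U0" by (simp_all add: At_def Ut_def)

lemma Ut_Suc: "Ut (Suc t) = set_option (pv t) \<union> Ut t"
  by (auto simp: At_def pv_def Ut_def Let_def split: option.split)

lemmas pv_Some = pick_Some[of N "At t" "Ut t" t for t, folded pv_def]
lemmas pv_None = pick_None[of N "At t" "Ut t" t for t, folded pv_def]

lemma Ut_eq: "Ut t = U0 \<union> {r. \<exists>c<t. pv c = Some r}"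
  by (induction t) (auto simp: Ut_0 Ut_Suc less_Suc_eq)

lemma pv_inj: "pv c = Some r \<Longrightarrow> pv c' = Some r \<Longrightarrow> c = c'"
proof (induction c c' rule: linorder_wlog)
  case (le a b)
  show ?case
  proof (rule ccontr)
    assume "a \<noteq> b"
    then have "r \<in> Ut b" using le by (auto simp: Ut_eq)
    then show False using pv_Some[OF le(3)] by simp
  qed
qed simp

text \<open>The row of the pivot in column \<open>t\<close>, and the coefficients with which that row is added to the
  others; they vanish if there is no pivot.\<close>

definition "prow t = the (pv t)"

definition coef :: "nat \<Rightarrow> nat \<Rightarrow> nat \<Rightarrow> bit" where
  "coef t i c = of_bool (pv c \<noteq> None) * (At t i c + of_bool (i = prow c))"

lemma At_Suc: "At (Suc t) i x = At t i x + of_bool (x \<noteq> t) * (coef t i t * At t (prow t) x)"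
  by (auto simp: At_def pv_def Ut_def Let_def prow_def coef_def split: option.split)

text \<open>Abstracts from the stored columns outside a block and from the columns
  \<open>virt\<close>, so that \<open>block_update\<close> serves both the block program and the
  analysis of the final matrix.\<close>

definition evolves :: "(nat \<Rightarrow> nat \<Rightarrow> bit) \<Rightarrow> nat \<Rightarrow> nat \<Rightarrow> bool" where
  "evolves y a b \<longleftrightarrow> (\<forall>t\<in>{a..<b}. \<forall>i. y (Suc t) i = y t i + coef t i t * y t (prow t))"

text \<open>Different columns have different pivot rows, so the unit vector added in
  \<open>coef\<close> vanishes in row \<open>prow t\<close>. Hence the corrected pivot columns obey
  the recurrence of an ordinary row operation.\<close>

lemma coef_Suc: "c < t \<Longrightarrow> coef (Suc t) i c = coef t i c + coef t i t * coef t (prow t) c"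
proof -
  assume c: "c < t"
  have "prow t \<noteq> prow c" if "pv c \<noteq> None" "pv t \<noteq> None"
    using that c pv_inj[of c _ t] by (force simp: prow_def)
  then show ?thesis using c unfolding coef_def At_Suc
    by (cases "pv c = None"; cases "pv t = None") (auto simp: algebra_simps)
qed

text \<open>The coefficients are those after the block, the pivot rows those before it. This is what
  turns a whole block of pivot steps into a single matrix product.\<close>

lemma block_update:
  assumes "a \<le> b" "evolves y a b"
  shows "y b i = y a i + (\<Sum>c\<in>{a..<b}. coef b i c * y a (prow c))"
  using assms
proof (induction b arbitrary: i rule: dec_induct)
  case (step n)
  have IH: "y n i = y a i + (\<Sum>c\<in>{a..<n}. coef n i c * y a (prow c))" for i
    using step by (auto simp: evolves_def)
  have y: "y (Suc n) i = y n i + coef n i n * y n (prow n)"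
    using step by (auto simp: evolves_def)
  have "coef (Suc n) i n = coef n i n" by (simp add: coef_def At_Suc)
  then have "(\<Sum>c\<in>{a..<Suc n}. coef (Suc n) i c * y a (prow c))
     = coef n i n * y a (prow n) + (\<Sum>c\<in>{a..<n}. coef n i c * y a (prow c)
        + coef n i n * (coef n (prow n) c * y a (prow c)))"
    using step.hyps by (simp add: coef_Suc algebra_simps)
  then show ?case
    by (simp only: y IH[of i] IH[of "prow n"] sum.distrib sum_distrib_left[symmetric])
      (simp only: distrib_left add_ac)
qed simp

lemma column_evolves: "x \<notin> {a..<b} \<Longrightarrow> evolves (\<lambda>t i. At t i x) a b"
  by (auto simp: evolves_def At_Suc)

text \<open>The column that would be obtained without overwriting.\<close>

primrec virt :: "nat \<Rightarrow> nat \<Rightarrow> nat \<Rightarrow> bit" where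
  "virt x 0 = (\<lambda>i. M i x)"
| "virt x (Suc t) = (\<lambda>i. virt x t i + coef t i t * virt x t (prow t))"

lemma virt_At: "t \<le> x \<Longrightarrow> virt x t i = At t i x"
  by (induction t arbitrary: i) (auto simp: At_0 At_Suc)

text \<open>The pivot step turns the column into a unit vector. Later steps add rows other than
  \<open>r\<close>, in which this column is already zero.\<close>

lemma virt_pivot: "pv x = Some r \<Longrightarrow> x < t \<Longrightarrow> virt x t i = of_bool (i = r)"
proof (induction t arbitrary: i)
  case (Suc t)
  show ?case
  proof (cases "x = t")
    case True
    then show ?thesis using Suc pv_Some[of t r]
      by (simp add: virt_At coef_def prow_def add.assoc[symmetric])
  next
    case False
    then have V: "virt x t i = of_bool (i = r)" for i using Suc by simp
    moreover have "pv t \<noteq> Some r" using pv_inj[of t r x] Suc.prems False by auto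
    ultimately show ?thesis by (cases "pv t") (auto simp: coef_def prow_def)
  qed
qed simp

lemma virt_unused: "x < t \<Longrightarrow> i < N \<Longrightarrow> i \<notin> Ut t \<Longrightarrow> virt x t i = 0"
proof (induction t arbitrary: i)
  case (Suc t)
  show ?case
  proof (cases "x = t")
    case True
    show ?thesis
    proof (cases "pv t")
      case None
      then show ?thesis using True Suc.prems pv_None[OF None, of i] by (auto simp: virt_At Ut_Suc coef_def)
    next
      case (Some r)
      then show ?thesis using True Suc.prems virt_pivot[of x r "Suc t" i] by (auto simp: Ut_Suc)
    qed
  next
    case False
    then show ?thesis using Suc pv_Some[of t]
      by (cases "pv t") (auto simp: Ut_Suc coef_def prow_def)
  qed
qed simp

text \<open>The final row \<open>h\<close> is zero by \<open>virt_unused\<close>. Expanding it with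
  \<open>block_update\<close> over all steps expresses the original row through the original pivot
  rows; this relation becomes the cocycle condition.\<close>

lemma unused_row:
  assumes h: "h < N" "h \<notin> Ut N" and x: "x < N"
  shows "M h x = (\<Sum>c | c < N \<and> pv c \<noteq> None. At N h c * M (prow c) x)"
proof -
  have "virt x N h = virt x 0 h + (\<Sum>c\<in>{0..<N}. coef N h c * virt x 0 (prow c))"
    by (rule block_update) (auto simp: evolves_def)
  also have "(\<Sum>c\<in>{0..<N}. coef N h c * virt x 0 (prow c))
     = (\<Sum>c | c < N \<and> pv c \<noteq> None. At N h c * M (prow c) x)"
    \<comment> \<open>Row \<open>h\<close> is no pivot row, so the unit vector part of
      \<open>coef N h c\<close> is zero and the stored entry remains.\<close>
    using h by (intro sum.mono_neutral_cong_right) (auto simp: Ut_eq coef_def prow_def)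
  finally show ?thesis using virt_unused[OF x h]
    by (simp add: add_eq_0_iff)
qed

text \<open>Row operations preserve a linear relation between columns, and at the end the pivot
  columns are distinct unit vectors.\<close>

lemma pivots_independent:
  assumes S: "S \<subseteq> {c. c < N \<and> pv c \<noteq> None}" and 0: "\<And>i. i < N \<Longrightarrow> (\<Sum>x\<in>S. M i x) = 0"
  shows "S = {}"
proof (rule ccontr)
  assume "S \<noteq> {}"
  have fin: "finite S" using S finite_subset by fastforce
  have V: "i < N \<Longrightarrow> (\<Sum>x\<in>S. virt x t i) = 0" for i t
  proof (induction t arbitrary: i)
    case (Suc t)
    show ?case
    proof (cases "pv t")
      case (Some r)
      then show ?thesis using Suc pv_Some[OF Some]
        by (simp add: sum.distrib sum_distrib_left[symmetric] prow_def)
    qed (use Suc in \<open>simp add: coef_def\<close>)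
  qed (use 0 in simp)
  obtain x r where x: "x \<in> S" "pv x = Some r" using S \<open>S \<noteq> {}\<close> by blast
  have "virt y N r = of_bool (y = x)" if y: "y \<in> S" for y
  proof -
    obtain q where "pv y = Some q" "y < N" using y S by force
    then show ?thesis using x virt_pivot[of y q N r] pv_inj[of y q x] by auto
  qed
  then have "(\<Sum>y\<in>S. virt y N r) = (\<Sum>y\<in>S. of_bool (y = x))" by (intro sum.cong) auto
  also have "\<dots> = 1" using fin x(1) by (simp add: of_bool_def)
  finally show False using V[of r N] pv_Some[OF x(2)] by simp
qed

end

section \<open>Column relations over the field with two elements\<close>

text \<open>Over the field with two elements a linear combination is a subset. Spans and
  independence are therefore stated with index sets, which also keeps equal columns apart.\<close>

definition colsum :: "bit mat \<Rightarrow> nat set \<Rightarrow> nat \<Rightarrow> bit" where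
  "colsum A S i = (\<Sum>s\<in>S. A $$ (i, s))"

definition indep :: "bit mat \<Rightarrow> nat set \<Rightarrow> bool" where
  "indep A J \<longleftrightarrow> (\<forall>S\<subseteq>J. (\<forall>i<dim_row A. colsum A S i = 0) \<longrightarrow> S = {})"

definition in_cspan :: "bit mat \<Rightarrow> nat set \<Rightarrow> nat \<Rightarrow> bool" where
  "in_cspan A J j \<longleftrightarrow> (\<exists>S\<subseteq>J. \<forall>i<dim_row A. A $$ (i, j) = colsum A S i)"

lemma sum_sym_diff:
  fixes f :: "'b \<Rightarrow> bit"
  assumes "finite S" "finite T"
  shows "(\<Sum>x\<in>sym_diff S T. f x) = (\<Sum>x\<in>S. f x) + (\<Sum>x\<in>T. f x)"
proof -
  have S: "(\<Sum>x\<in>S. f x) = (\<Sum>x\<in>S \<inter> T. f x) + (\<Sum>x\<in>S - T. f x)"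
    by (rule sum.Int_Diff[OF assms(1)])
  have T: "(\<Sum>x\<in>T. f x) = (\<Sum>x\<in>S \<inter> T. f x) + (\<Sum>x\<in>T - S. f x)"
    using sum.Int_Diff[OF assms(2), of f S] by (simp only: Int_commute)
  have "(\<Sum>x\<in>sym_diff S T. f x) = (\<Sum>x\<in>S - T. f x) + (\<Sum>x\<in>T - S. f x)"
    using assms by (intro sum.union_disjoint) auto
  moreover have "a + b + (a + c) = b + c" for a b c :: bit
    by (cases a; cases b; cases c) auto
  ultimately show ?thesis unfolding S T by simp
qed

lemma colsum_sym_diff:
  "finite S \<Longrightarrow> finite T \<Longrightarrow> colsum A (sym_diff S T) i = colsum A S i + colsum A T i"
  unfolding colsum_def by (rule sum_sym_diff)

lemma bit_add_eq_0: "x + y = (0 :: bit) \<longleftrightarrow> x = y"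
  by (cases x; cases y) auto

lemma indep_unique:
  assumes "indep A J" "finite J" "S \<subseteq> J" "T \<subseteq> J" "\<And>i. i < dim_row A \<Longrightarrow> colsum A S i = colsum A T i"
  shows "S = T"
proof -
  have "finite S" "finite T" using finite_subset[OF assms(3,2)] finite_subset[OF assms(4,2)] .
  then have "\<forall>i<dim_row A. colsum A (sym_diff S T) i = 0"
    using assms(5) by (simp add: colsum_sym_diff)
  then have "sym_diff S T = {}" using assms unfolding indep_def by (metis Diff_subset Un_subset_iff subset_trans)
  then show ?thesis by blast
qed

lemma in_cspan_iff:
  assumes J: "indep A J" "finite J" "j \<notin> J"
  shows "in_cspan A J j \<longleftrightarrow> \<not> indep A (insert j J)"
proof
  assume "in_cspan A J j"
  then obtain S where S: "S \<subseteq> J" "\<forall>i<dim_row A. A $$ (i, j) = colsum A S i" unfolding in_cspan_def by blast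
  then have "finite S" "j \<notin> S" using J finite_subset by auto
  then have "\<forall>i<dim_row A. colsum A (insert j S) i = 0" using S by (simp add: colsum_def)
  moreover have "insert j S \<subseteq> insert j J" using S by blast
  ultimately show "\<not> indep A (insert j J)" unfolding indep_def by blast
next
  assume "\<not> indep A (insert j J)"
  then obtain S where S: "S \<subseteq> insert j J" "\<forall>i<dim_row A. colsum A S i = 0" "S \<noteq> {}" unfolding indep_def by blast
  have fin: "finite S" using S J finite_subset by blast
  have "j \<in> S"
  proof (rule ccontr)
    assume "j \<notin> S"
    then have "S \<subseteq> J" using S by blast
    then show False using J(1) S unfolding indep_def by blast
  qed
  then have "\<forall>i<dim_row A. A $$ (i, j) = colsum A (S - {j}) i"
    using S(2) fin by (simp add: colsum_def sum.remove bit_add_eq_0)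
  moreover have "S - {j} \<subseteq> J" using S by blast
  ultimately show "in_cspan A J j" unfolding in_cspan_def by blast
qed

lemma colsum_cspan:
  assumes "finite S" "finite J" "\<And>s. s \<in> S \<Longrightarrow> in_cspan A J s"
  shows "\<exists>T\<subseteq>J. \<forall>i<dim_row A. colsum A S i = colsum A T i"
  using assms(1,3)
proof (induction S)
  case empty
  then show ?case by (intro exI[of _ "{}"]) (simp add: colsum_def)
next
  case (insert s S)
  then obtain T where T: "T \<subseteq> J" "\<forall>i<dim_row A. colsum A S i = colsum A T i" by auto
  obtain T' where T': "T' \<subseteq> J" "\<forall>i<dim_row A. A $$ (i, s) = colsum A T' i"
    using insert.prems[of s] unfolding in_cspan_def by auto
  have "finite T" "finite T'" using finite_subset[OF T(1) assms(2)] finite_subset[OF T'(1) assms(2)] .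
  then show ?case using insert.hyps T T'
    by (intro exI[of _ "sym_diff T' T"]) (auto simp: colsum_sym_diff, simp add: colsum_def)
qed

subsection \<open>Comparison with the library notions\<close>

lemma lincomb_colsum:
  assumes A: "A \<in> carrier_mat n m" and S: "S \<subseteq> {..<m}" and inj: "inj_on (col A) S" and i: "i < n"
  shows "LinearCombinations.module.lincomb (module_vec TYPE(bit) n) (\<lambda>_. 1) (col A ` S) $ i = colsum A S i"
proof -
  interpret vec_space "TYPE(bit)" n .
  have "col A ` S \<subseteq> carrier_vec n" using A col_dim[of A] by auto
  then have "lincomb (\<lambda>_. 1) (col A ` S) $ i = (\<Sum>x\<in>col A ` S. 1 * x $ i)"
    using i by (intro lincomb_index) auto
  also have "\<dots> = (\<Sum>s\<in>S. col A s $ i)" by (simp add: sum.reindex[OF inj])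
  also have "\<dots> = colsum A S i" unfolding colsum_def using A S i by (intro sum.cong) auto
  finally show ?thesis .
qed

text \<open>The library notion concerns sets of vectors, not indexed families. Two equal columns
  form a vanishing pair, so independence of indices yields injectivity of \<open>col A\<close> as
  well.\<close>

lemma indep_imp_lin_indpt:
  assumes A: "A \<in> carrier_mat n m" and J: "J \<subseteq> {..<m}" and ind: "indep A J"
  shows "inj_on (col A) J" "\<not> LinearCombinations.module.lin_dep class_ring (module_vec TYPE(bit) n) (col A ` J)"
proof -
  interpret vec_space "TYPE(bit)" n .
  have fin: "finite J" using J finite_subset by blast
  show inj: "inj_on (col A) J"
  proof (rule inj_onI, rule ccontr)
    fix x y assume xy: "x \<in> J" "y \<in> J" "col A x = col A y" "x \<noteq> y"
    have "A $$ (i, x) = A $$ (i, y)" if "i < n" for i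
    proof -
      have "col A x $ i = A $$ (i, x)" "col A y $ i = A $$ (i, y)" using A that xy(1,2) J by auto
      then show ?thesis using xy(3) by simp
    qed
    then have "\<forall>i<dim_row A. colsum A {x, y} i = 0" using A xy by (simp add: colsum_def)
    then show False using ind xy unfolding indep_def by (metis insert_not_empty empty_subsetI insert_subset)
  qed
  show "lin_indpt (col A ` J)"
  proof
    assume "lin_dep (col A ` J)"
    then obtain B a v where B: "finite B" "B \<subseteq> col A ` J" "lincomb a B = 0\<^sub>v n" "v \<in> B" "a v \<noteq> 0"
      unfolding lin_dep_def by auto
    define S where "S = {j \<in> J. col A j \<in> B \<and> a (col A j) = 1}"
    have Bc: "B \<subseteq> carrier_vec n" using B(2) A col_dim[of A] by auto
    have "colsum A S i = 0" if i: "i < n" for i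
    proof -
      have "0 = lincomb a B $ i" using B i by simp
      also have "\<dots> = (\<Sum>x\<in>B. a x * x $ i)" using i Bc by (rule lincomb_index)
      also have "\<dots> = (\<Sum>x\<in>col A ` S. x $ i)"
      proof (rule sum.mono_neutral_cong_right)
        show "\<forall>x\<in>B - col A ` S. a x * x $ i = 0" using B(2) by (fastforce simp: S_def)
      qed (use B in \<open>auto simp: S_def\<close>)
      also have "\<dots> = (\<Sum>s\<in>S. col A s $ i)"
        by (subst sum.reindex) (auto intro: inj_on_subset[OF inj] simp: S_def)
      also have "\<dots> = colsum A S i" unfolding colsum_def using A J i by (intro sum.cong) (auto simp: S_def)
      finally show ?thesis by simp
    qed
    moreover have "S \<subseteq> J" by (auto simp: S_def)
    ultimately have "S = {}" using ind A unfolding indep_def by (metis carrier_matD(1))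
    moreover obtain j where "j \<in> J" "v = col A j" using B by blast
    ultimately show False using B by (auto simp: S_def)
  qed
qed

lemma lin_indpt_imp_indep:
  assumes A: "A \<in> carrier_mat n m" and J: "J \<subseteq> {..<m}" and inj: "inj_on (col A) J"
    and ind: "\<not> LinearCombinations.module.lin_dep class_ring (module_vec TYPE(bit) n) (col A ` J)"
  shows "indep A J"
  unfolding indep_def
proof (intro allI impI, rule ccontr)
  interpret vec_space "TYPE(bit)" n .
  fix S assume S: "S \<subseteq> J" "\<forall>i<dim_row A. colsum A S i = 0" "S \<noteq> {}"
  have fin: "finite S" using finite_subset[OF subset_trans[OF S(1) J]] by simp
  have cs: "col A ` S \<subseteq> carrier_vec n" using A col_dim[of A] by auto
  have "lincomb (\<lambda>_. 1) (col A ` S) = 0\<^sub>v n"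
  proof (rule eq_vecI)
    fix i assume "i < dim_vec (0\<^sub>v n :: bit vec)"
    then have i: "i < n" by simp
    have "lincomb (\<lambda>_. 1) (col A ` S) $ i = colsum A S i"
      by (rule lincomb_colsum[OF A _ inj_on_subset[OF inj S(1)] i]) (use S(1) J in blast)
    also have "\<dots> = 0" using S(2) A i by simp
    finally show "lincomb (\<lambda>_. 1) (col A ` S) $ i = 0\<^sub>v n $ i" using i by simp
  qed (use fin cs in \<open>simp add: lincomb_dim\<close>)
  note zero = this
  obtain j where j: "j \<in> S" using S(3) by blast
  have sub: "col A ` S \<subseteq> col A ` J" using S(1) by (rule image_mono)
  have "lin_dep (col A ` S)" unfolding lin_dep_def
  proof (intro exI conjI)
    show "finite (col A ` S)" using fin by (rule finite_imageI)
    show "lincomb (\<lambda>_. 1) (col A ` S) = 0\<^sub>v n" by (rule zero)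
    show "col A j \<in> col A ` S" using j by (rule imageI)
    show "(1 :: bit) \<noteq> 0" by (rule one_neq_zero)
  qed auto
  from supset_ld_is_ld[OF this sub] ind show False by contradiction
qed

lemma cols_independent_iff:
  assumes A: "A \<in> carrier_mat n m" and js: "set js \<subseteq> {..<m}"
  shows "cols_independent A js \<longleftrightarrow> distinct js \<and> indep A (set js)"
  using indep_imp_lin_indpt[OF A js] lin_indpt_imp_indep[OF A js] A
  by (auto simp: cols_independent_def distinct_map)

text \<open>Since all other columns are spanned, the columns of \<open>J\<close> form a maximal
  independent set of columns.\<close>

lemma rank_eq_card:
  assumes A: "A \<in> carrier_mat n m" and J: "J \<subseteq> {..<m}" "indep A J"
    and max: "\<And>j. j < m \<Longrightarrow> j \<notin> J \<Longrightarrow> in_cspan A J j"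
  shows "vec_space.rank n A = card J"
proof -
  interpret vec_space "TYPE(bit)" n .
  have fin: "finite J" using J finite_subset by blast
  have cols: "set (cols A) = col A ` {..<m}" using A by (auto simp: cols_def)
  note li = indep_imp_lin_indpt[OF A J]
  have "maximal (col A ` J) (\<lambda>T. T \<subseteq> set (cols A) \<and> lin_indpt T)"
    unfolding maximal_def
  proof (intro conjI allI impI)
    fix T assume T: "col A ` J \<subseteq> T \<and> T \<subseteq> set (cols A) \<and> lin_indpt T"
    show "T = col A ` J"
    proof (rule ccontr)
      assume "T \<noteq> col A ` J"
      then obtain t where t: "t \<in> T" "t \<notin> col A ` J" using T by blast
      then obtain j where j: "j < m" "t = col A j" using T cols by blast
      then have "j \<notin> J" using t by blast
      have sub: "col A ` insert j J \<subseteq> T" using T t(1) j(2) by blast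
      have "lin_indpt T" using T by blast
      then have "lin_indpt (col A ` insert j J)" using supset_ld_is_ld[OF _ sub] by (rule contrapos_nn)
      moreover have "inj_on (col A) (insert j J)" unfolding inj_on_insert using li(1) t(2) j(2) by blast
      ultimately have "indep A (insert j J)" using lin_indpt_imp_indep[OF A, of "insert j J"] j(1) J(1) by simp
      then show False using in_cspan_iff[OF J(2) fin \<open>j \<notin> J\<close>] max[OF j(1) \<open>j \<notin> J\<close>] by blast
    qed
  next
    show "col A ` J \<subseteq> set (cols A)" using J(1) cols by blast
    show "lin_indpt (col A ` J)" by (rule li(2))
  qed
  then have "rank A = card (col A ` J)" by (rule rank_card_indpt[OF A])
  then show ?thesis using card_image[OF li(1)] by simp
qed

lemma rank_ge_card:
  assumes A: "A \<in> carrier_mat n m" and J: "J \<subseteq> {..<m}" "indep A J"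
  shows "card J \<le> vec_space.rank n A"
proof -
  interpret vec_space "TYPE(bit)" n .
  note li = indep_imp_lin_indpt[OF A J]
  have "col A ` J \<subseteq> set (cols A)" using A J by (auto simp: cols_def)
  then have "card (col A ` J) \<le> rank A" using li by (intro rank_ge_card_indpt[OF A]) auto
  then show ?thesis using card_image[OF li(1)] by simp
qed

subsection \<open>The earliest basis\<close>

text \<open>The greedy description of the earliest basis. It avoids the definite description in
  \<open>earliest_basis_indices\<close>, with which \<open>earliest_basis_indices_eq\<close>
  identifies it.\<close>

definition early :: "bit mat \<Rightarrow> nat set" where
  "early A = {j. j < dim_col A \<and> \<not> in_cspan A {..<j} j}"

lemma finite_early [simp]: "finite (early A)" and early_subset: "early A \<subseteq> {..<dim_col A}"
  by (auto simp: early_def)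

text \<open>A column outside \<open>early A\<close> is a sum of columns to its left, to which
  induction applies. The bound \<open>k\<close> is kept apart from \<open>j\<close> so that with
  \<open>k = d\<close> all boundary columns are spanned by early boundary columns.\<close>

lemma early_spans:
  assumes "j < k" "j < dim_col A"
  shows "in_cspan A (early A \<inter> {..<k}) j"
  using assms
proof (induction j rule: less_induct)
  case (less j)
  show ?case
  proof (cases "j \<in> early A")
    case True
    then show ?thesis using less unfolding in_cspan_def
      by (intro exI[of _ "{j}"]) (auto simp: colsum_def)
  next
    case False
    then obtain S where S: "S \<subseteq> {..<j}" "\<forall>i<dim_row A. A $$ (i, j) = colsum A S i"
      using less unfolding early_def in_cspan_def by blast
    have "\<exists>T\<subseteq>early A \<inter> {..<k}. \<forall>i<dim_row A. colsum A S i = colsum A T i"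
    proof (rule colsum_cspan)
      show "finite S" using finite_subset[OF S(1)] by simp
      show "in_cspan A (early A \<inter> {..<k}) s" if "s \<in> S" for s
        using less that S(1) by (intro less.IH) auto
    qed simp
    then show ?thesis using S(2) unfolding in_cspan_def by auto
  qed
qed

text \<open>In a vanishing sum the column of largest index would be spanned by columns to its
  left.\<close>

lemma early_indep: "indep A (early A)"
  unfolding indep_def
proof (intro allI impI, rule ccontr)
  fix S assume S: "S \<subseteq> early A" "\<forall>i<dim_row A. colsum A S i = 0" "S \<noteq> {}"
  have fin: "finite S" using S finite_subset[OF _ finite_early] by blast
  define j where "j = Max S"
  have j: "j \<in> S" using fin S by (simp add: j_def)
  have "S - {j} \<subseteq> {..<j}" using fin by (auto simp: j_def less_le)
  moreover have "\<forall>i<dim_row A. A $$ (i, j) = colsum A (S - {j}) i"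
    using S(2) fin j by (simp add: colsum_def sum.remove bit_add_eq_0)
  ultimately have "in_cspan A {..<j} j" unfolding in_cspan_def by blast
  then show False using S j unfolding early_def by auto
qed

lemma rank_early: "A \<in> carrier_mat n m \<Longrightarrow> vec_space.rank n A = card (early A)"
  using early_spans[of _ "dim_col A" A] early_subset[of A]
  by (intro rank_eq_card[of A n m]) (auto simp: early_indep Int_absorb2)

definition early_list :: "bit mat \<Rightarrow> nat list" where
  "early_list A = sorted_list_of_set (early A)"

lemma early_list: "set (early_list A) = early A" "sorted_wrt (<) (early_list A)" "distinct (early_list A)"
  "length (early_list A) = card (early A)"
  by (auto simp: early_list_def)

lemma col_basis_early: "A \<in> carrier_mat n m \<Longrightarrow> col_basis A (early_list A)"
  unfolding col_basis_def using early_list[of A] early_subset[of A] rank_early[of A n m] early_indep[of A]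
    cols_independent_iff[of A n m "early_list A"] by auto

text \<open>At the first disagreement a smaller entry of \<open>js\<close> would be spanned by the
  early indices before it, which all lie in the common prefix; this contradicts the independence of
  \<open>js\<close>. A larger entry would make \<open>early_list A\<close> lexicographically
  smaller.\<close>

lemma early_list_least:
  assumes A: "A \<in> carrier_mat n m" and js: "col_basis A js"
  shows "early_list A = js \<or> (early_list A, js) \<in> lexord {(i, j). i < j}"
proof (rule disjCI)
  let ?g = "early_list A"
  assume nlex: "(?g, js) \<notin> lexord {(i, j). i < j}"
  have len: "length ?g = length js" using js col_basis_early[OF A] by (simp add: col_basis_def)
  have sub: "set js \<subseteq> {..<m}" using js A by (simp add: col_basis_def)
  have ind: "indep A (set js)" using js cols_independent_iff[OF A sub] by (simp add: col_basis_def)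
  have sd: "sorted_wrt (<) js" using js by (simp add: col_basis_def)
  have "take p ?g = take p js" if "p \<le> length js" for p
    using that
  proof (induction p)
    case (Suc p)
    then have eq: "take p ?g = take p js" and p: "p < length js" by auto
    have "?g ! p = js ! p"
    proof (rule ccontr)
      assume ne: "?g ! p \<noteq> js ! p"
      have "\<not> ?g ! p < js ! p" using nlex eq p len by (auto simp: lexord_take_index_conv)
      then have lt: "js ! p < ?g ! p" using ne by simp
      let ?j = "js ! p"
      have set_take: "set (take p xs) = {xs ! q |q. q < p}" if "p \<le> length xs" for xs :: "nat list"
        unfolding nth_image[OF that, symmetric] by auto
      \<comment> \<open>The list is increasing, so the early indices below its entry
        \<open>p\<close> are its first \<open>p\<close> entries.\<close>
      have G: "early A \<inter> {..<?g ! p} = set (take p ?g)"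
      proof -
        have "x \<in> early A \<and> x < ?g ! p \<longleftrightarrow> (\<exists>q<p. x = ?g ! q)" for x
        proof
          assume x: "x \<in> early A \<and> x < ?g ! p"
          then obtain q where q: "q < length ?g" "x = ?g ! q" using early_list(1) by (metis in_set_conv_nth)
          have "q < p"
          proof (rule ccontr)
            assume "\<not> q < p"
            then have "?g ! p \<le> ?g ! q" using early_list(2)[of A] q by (cases "p = q") (auto simp: sorted_wrt_iff_nth_less intro: less_imp_le)
            then show False using x q by simp
          qed
          then show "\<exists>q<p. x = ?g ! q" using q by blast
        next
          assume "\<exists>q<p. x = ?g ! q"
          then obtain q where q: "q < p" "x = ?g ! q" by blast
          then have "x \<in> set ?g" using p len by simp
          then show "x \<in> early A \<and> x < ?g ! p" using q p len early_list[of A] by (auto simp: sorted_wrt_iff_nth_less)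
        qed
        then show ?thesis using set_take[of ?g] p len by auto
      qed
      have "?j \<in> {..<m}" by (rule subsetD[OF sub nth_mem[OF p]])
      then have jm: "?j < dim_col A" using A by simp
      have "in_cspan A (early A \<inter> {..<?g ! p}) ?j" by (rule early_spans[OF lt jm])
      then have sp: "in_cspan A (set (take p js)) ?j" unfolding G eq .
      have nin: "?j \<notin> set (take p js)"
      proof
        assume "?j \<in> set (take p js)"
        then obtain q where "q < p" "?j = js ! q" using set_take[of js] p by auto
        moreover have "js ! q < ?j" if "q < p" for q using p sd that by (auto simp: sorted_wrt_iff_nth_less)
        ultimately show False by fastforce
      qed
      have "insert ?j (set (take p js)) \<subseteq> set js" using p by (auto dest: in_set_takeD)
      then have "indep A (insert ?j (set (take p js)))" "indep A (set (take p js))"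
        using ind unfolding indep_def by (meson subset_trans subset_insertI)+
      then show False using in_cspan_iff[of A "set (take p js)" ?j] sp nin by auto
    qed
    then show ?case using eq p len by (simp add: take_Suc_conv_app_nth)
  qed simp
  from this[of "length js"] show "?g = js" using len by simp
qed

lemma earliest_basis_indices_eq:
  assumes A: "A \<in> carrier_mat n m"
  shows "earliest_basis_indices A = early_list A"
  unfolding earliest_basis_indices_def
proof (rule the_equality)
  show "col_basis A (early_list A) \<and>
    (\<forall>js'. col_basis A js' \<longrightarrow> early_list A = js' \<or> (early_list A, js') \<in> lexord {(i, j). i < j})"
    using col_basis_early[OF A] early_list_least[OF A] by blast
  fix js assume js: "col_basis A js \<and> (\<forall>js'. col_basis A js' \<longrightarrow> js = js' \<or> (js, js') \<in> lexord {(i, j). i < j})"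
  then have "js = early_list A \<or> (js, early_list A) \<in> lexord {(i, j). i < j}" using col_basis_early[OF A] by blast
  moreover have "early_list A = js \<or> (early_list A, js) \<in> lexord {(i, j). i < j}" using js early_list_least[OF A] by blast
  moreover have "asym {(i, j). i < (j::nat)}" by (auto intro: asymI)
  ultimately show "js = early_list A" using lexord_asymmetric by blast
qed

section \<open>Forests, paths and cycles\<close>

lemma even_card_sym_diff:
  assumes "finite A" "finite B"
  shows "even (card (sym_diff A B)) \<longleftrightarrow> (even (card A) \<longleftrightarrow> even (card B))"
proof -
  have "card A = card (A \<inter> B) + card (A - B)" "card B = card (A \<inter> B) + card (B - A)"
    using assms card_Diff_subset_Int[of A B] card_Diff_subset_Int[of B A]
      card_mono[of A "A \<inter> B"] card_mono[of B "A \<inter> B"] by (auto simp: Int_commute)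
  moreover have "card (sym_diff A B) = card (A - B) + card (B - A)"
    using assms by (intro card_Un_disjoint) auto
  ultimately show ?thesis by simp blast
qed

text \<open>The cycle space of a graph modulo 2, stated for any set of edges without a surrounding
  complex; \<open>cycles_iff\<close> makes the connection.\<close>

definition even_set :: "'v set set \<Rightarrow> bool" where
  "even_set c \<longleftrightarrow> (\<forall>v. even (card {e \<in> c. v \<in> e}))"

lemma even_set_sym_diff:
  assumes "finite a" "finite b"
    "\<And>v. even (card {e \<in> a. v \<in> e}) \<longleftrightarrow> even (card {e \<in> b. v \<in> e})"
  shows "even_set (sym_diff a b)"
proof -
  have "{e \<in> sym_diff a b. v \<in> e} = sym_diff {e \<in> a. v \<in> e} {e \<in> b. v \<in> e}" for v by auto
  then show ?thesis using assms even_card_sym_diff[of "{e \<in> a. v \<in> e}" "{e \<in> b. v \<in> e}" for v]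
    unfolding even_set_def by simp
qed

lemma path_edges_Nil [simp]: "path_edges [] = {}" and path_edges_single [simp]: "path_edges [x] = {}"
  by (auto simp: path_edges_def)

lemma path_edges_Cons: "p \<noteq> [] \<Longrightarrow> path_edges (x # p) = insert {x, hd p} (path_edges p)"
proof -
  assume p: "p \<noteq> []"
  have "{i. Suc i < length (x # p)} = insert 0 (Suc ` {i. Suc i < length p})"
  proof (rule Set.set_eqI)
    fix i show "i \<in> {i. Suc i < length (x # p)} \<longleftrightarrow> i \<in> insert 0 (Suc ` {i. Suc i < length p})"
      using p by (cases i) auto
  qed
  moreover have "path_edges q = (\<lambda>i. {q ! i, q ! Suc i}) ` {i. Suc i < length q}" for q :: "'a list"
    by (auto simp: path_edges_def)
  ultimately show ?thesis using p by (simp add: image_image hd_conv_nth)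
qed

lemma path_edges_snoc: "p \<noteq> [] \<Longrightarrow> path_edges (p @ [w]) = insert {last p, w} (path_edges p)"
proof (induction p)
  case (Cons x p)
  then show ?case by (cases "p = []") (auto simp: path_edges_Cons)
qed simp

lemma path_edges_drop: "path_edges (drop i p) \<subseteq> path_edges p"
proof
  fix e assume "e \<in> path_edges (drop i p)"
  then obtain j where "e = {drop i p ! j, drop i p ! Suc j}" "Suc j < length (drop i p)"
    unfolding path_edges_def by blast
  then have "e = {p ! (i + j), p ! Suc (i + j)}" "Suc (i + j) < length p" by auto
  then show "e \<in> path_edges p" unfolding path_edges_def by blast
qed

lemma path_edges_subset: "e \<in> path_edges p \<Longrightarrow> e \<subseteq> set p"
  by (auto simp: path_edges_def)

lemma finite_path_edges [simp]: "finite (path_edges p)"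
proof -
  have "path_edges p = (\<lambda>i. {p ! i, p ! Suc i}) ` {i. Suc i < length p}" by (auto simp: path_edges_def)
  moreover have "finite {i. Suc i < length p}" by (rule finite_subset[of _ "{..<length p}"]) auto
  ultimately show ?thesis by simp
qed

lemma card_insert_filter:
  "finite c \<Longrightarrow> e \<notin> c \<Longrightarrow> card {f. (f = e \<or> f \<in> c) \<and> v \<in> f} = of_bool (v \<in> e) + card {f \<in> c. v \<in> f}"
proof -
  assume a: "finite c" "e \<notin> c"
  have "{f. (f = e \<or> f \<in> c) \<and> v \<in> f} = (if v \<in> e then insert e {f \<in> c. v \<in> f} else {f \<in> c. v \<in> f})" by auto
  then show ?thesis using a by simp
qed

text \<open>Inner vertices of a simple path have degree two and its ends degree one. A path with a
  single vertex has no edges, and both sides are false.\<close>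

lemma path_parity:
  "distinct p \<Longrightarrow> p \<noteq> [] \<Longrightarrow> odd (card {e \<in> path_edges p. v \<in> e}) \<longleftrightarrow> (v = hd p) \<noteq> (v = last p)"
proof (induction p)
  case (Cons x p)
  show ?case
  proof (cases "p = []")
    case False
    have "{x, hd p} \<notin> path_edges p" using Cons.prems path_edges_subset[of "{x, hd p}" p] by auto
    moreover have "x \<noteq> hd p" "x \<noteq> last p" using Cons.prems False by auto
    ultimately show ?thesis using Cons False
      by (auto simp: path_edges_Cons card_insert_filter)
  qed simp
qed simp

text \<open>Consider a longest simple path in \<open>c\<close>. Its last vertex has even positive
  degree, hence a further edge, which either prolongs the path or closes a cycle.\<close>

lemma acyclic_no_even_set:
  assumes F: "acyclic_graph F" and c: "c \<subseteq> F" "finite c" "\<And>e. e \<in> c \<Longrightarrow> card e = 2" "even_set c"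
  shows "c = {}"
proof (rule ccontr)
  assume "c \<noteq> {}"
  let ?P = "\<lambda>p. distinct p \<and> path_edges p \<subseteq> c \<and> 2 \<le> length p"
  obtain a b where ab: "{a, b} \<in> c" "a \<noteq> b" using \<open>c \<noteq> {}\<close> c(3) by (metis card_2_iff all_not_in_conv)
  have "?P [a, b]" using ab by (simp add: path_edges_Cons)
  moreover have "length p \<le> card (\<Union>c)" if "?P p" for p
  proof -
    have "x \<in> \<Union>c" if x: "x \<in> set p" for x
    proof -
      obtain i where i: "i < length p" "x = p ! i" using x by (auto simp: in_set_conv_nth)
      \<comment> \<open>The last vertex has no successor and is covered by the edge before it, which
        exists because the path has at least two vertices.\<close>
      define j where "j = (if Suc i < length p then i else i - 1)"
      have "{p ! j, p ! Suc j} \<in> path_edges p" "x \<in> {p ! j, p ! Suc j}"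
        using i \<open>?P p\<close> by (auto simp: path_edges_def j_def)
      then show ?thesis using \<open>?P p\<close> by blast
    qed
    moreover have "finite (\<Union>c)" using c by (metis card.infinite finite_Union zero_neq_numeral)
    ultimately show ?thesis using that card_mono[of "\<Union>c" "set p"] distinct_card[of p] by auto
  qed
  ultimately obtain p where p: "?P p" "\<And>q. ?P q \<Longrightarrow> length q \<le> length p"
    using ex_has_greatest_nat[of ?P "[a, b]" length "Suc (card (\<Union>c))"] by (metis le_imp_less_Suc)
  define n where "n = length p"
  define u v where "u = p ! (n - 2)" and "v = p ! (n - 1)"
  have n: "2 \<le> n" using p by (simp add: n_def)
  have pne: "p \<noteq> []" using p(1) by auto
  have vl: "v = last p" using last_conv_nth[OF pne] by (simp add: v_def n_def)
  have "Suc (n - 2) = n - 1" using n by simp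
  then have uv: "{u, v} \<in> path_edges p" using n unfolding path_edges_def u_def v_def
    by (intro CollectI exI[of _ "n - 2"]) (auto simp: n_def)
  let ?E = "{e \<in> c. v \<in> e}"
  have fin: "finite ?E" using c by simp
  have mem: "{u, v} \<in> ?E" using uv p by blast
  \<comment> \<open>A single edge at \<open>v\<close> would be an odd degree.\<close>
  have "?E \<noteq> {{u, v}}" using c(4) unfolding even_set_def by (metis card.empty card_insert_if finite.emptyI empty_iff odd_one One_nat_def)
  then obtain f where f: "f \<in> c" "v \<in> f" "f \<noteq> {u, v}" using mem by blast
  then obtain w where w: "f = {v, w}" "w \<noteq> v" using c(3)[of f] by (metis card_2_iff doubleton_eq_iff insertE singletonD)
  have wu: "w \<noteq> u" using f w by auto
  show False
  proof (cases "w \<in> set p")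
    case False
    have "?P (p @ [w])" using p(1) False f w n vl pne by (auto simp: path_edges_snoc n_def)
    then show False using p(2)[of "p @ [w]"] by simp
  next
    case True
    then obtain i where i: "i < n" "w = p ! i" by (auto simp: in_set_conv_nth n_def)
    have "i \<noteq> n - 1" "i \<noteq> n - 2" using i w wu by (auto simp: u_def v_def)
    \<comment> \<open>As \<open>w\<close> is neither \<open>v\<close> nor \<open>u\<close>, the tail
      of the path from \<open>w\<close> on has the three vertices that a cycle needs.\<close>
    then have i3: "i + 3 \<le> n" using i by simp
    have "3 \<le> length (drop i p)" "distinct (drop i p)" "path_edges (drop i p) \<subseteq> F"
      using i3 p(1) path_edges_drop[of i p] c(1) by (auto simp: n_def)
    moreover have "{last (drop i p), hd (drop i p)} \<in> F"
      using i i3 vl f w c(1) by (auto simp: n_def hd_drop_conv_nth)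
    ultimately show False using F unfolding acyclic_graph_def by blast
  qed
qed

text \<open>The edges of a cycle form an even set: only the ends of the path have odd degree in it,
  and the closing edge corrects both.\<close>

lemma no_even_set_acyclic:
  assumes "\<And>c. c \<subseteq> F \<Longrightarrow> finite c \<Longrightarrow> even_set c \<Longrightarrow> c = {}"
  shows "acyclic_graph F"
  unfolding acyclic_graph_def
proof
  assume "\<exists>p. 3 \<le> length p \<and> distinct p \<and> path_edges p \<subseteq> F \<and> {last p, hd p} \<in> F"
  then obtain p where p: "3 \<le> length p" "distinct p" "path_edges p \<subseteq> F" "{last p, hd p} \<in> F" by blast
  then have ne: "p \<noteq> []" by auto
  have hl: "hd p = p ! 0" "last p = p ! (length p - 1)" using ne by (auto simp: hd_conv_nth last_conv_nth)
  have neq: "hd p \<noteq> last p" unfolding hl using p by (subst nth_eq_iff_index_eq) auto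
  \<comment> \<open>The closing edge has to be new for its insertion to change parities; with at
    least three vertices it cannot join neighbours on the path.\<close>
  have nin: "{last p, hd p} \<notin> path_edges p"
  proof
    assume "{last p, hd p} \<in> path_edges p"
    then obtain i where i: "{p ! (length p - 1), p ! 0} = {p ! i, p ! Suc i}" "Suc i < length p"
      unfolding hl path_edges_def by blast
    then have "p ! 0 = p ! i \<and> p ! (length p - 1) = p ! Suc i \<or> p ! 0 = p ! Suc i"
      by (auto simp: doubleton_eq_iff)
    then have "0 = i \<and> length p - 1 = Suc i \<or> 0 = Suc i"
      using i(2) p(1,2) ne by (auto simp: nth_eq_iff_index_eq)
    then show False using p(1) by auto
  qed
  let ?c = "insert {last p, hd p} (path_edges p)"
  have "even_set ?c" unfolding even_set_def
  proof
    fix v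
    show "even (card {e \<in> ?c. v \<in> e})"
      using path_parity[OF p(2) ne, of v] neq by (auto simp: card_insert_filter[OF finite_path_edges nin])
  qed
  then have "?c = {}" using assms[of ?c] p by simp
  then show False by simp
qed

lemma walk_imp_simple_path: "walk V F u v p \<Longrightarrow> \<exists>q. simple_path V F u v q"
proof (induction p arbitrary: u)
  case (Cons x p)
  have x: "x = u" using Cons.prems by (simp add: walk_def)
  show ?case
  proof (cases "p = []")
    case True
    then show ?thesis using Cons.prems by (intro exI[of _ "[u]"]) (auto simp: simple_path_def walk_def)
  next
    case False
    then have e: "{u, hd p} \<in> F" and "walk V F (hd p) v p"
      using Cons.prems x by (auto simp: walk_def path_edges_Cons)
    then obtain q where q: "simple_path V F (hd p) v q" using Cons.IH by blast
    show ?thesis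
    proof (cases "u \<in> set q")
      case True
      then obtain i where i: "i < length q" "q ! i = u" by (auto simp: in_set_conv_nth)
      then have "simple_path V F u v (drop i q)"
        using q path_edges_drop[of i q] by (auto simp: simple_path_def walk_def hd_drop_conv_nth dest: in_set_dropD)
      then show ?thesis by blast
    next
      case False
      then have "simple_path V F u v (u # q)"
        using q e Cons.prems by (auto simp: simple_path_def walk_def path_edges_Cons)
      then show ?thesis by blast
    qed
  qed
qed (simp add: walk_def)

text \<open>The definition takes a union over all simple paths between the ends of \<open>e\<close>.
  Two such paths have the same degree parities, so their symmetric difference is an even subset of
  \<open>T\<close>, hence empty, and the union consists of one path.\<close>

lemma tree_cycle_props:
  assumes T: "acyclic_graph T" "finite T" "\<And>f. f \<in> T \<Longrightarrow> card f = 2" "connected_graph V T"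
    and e: "card e = 2" "e \<subseteq> V" "e \<notin> T"
  shows "even_set (tree_cycle V T e)" "e \<in> tree_cycle V T e" "tree_cycle V T e \<subseteq> insert e T"
proof -
  obtain u v where uv: "e = {u, v}" "u \<noteq> v" using e(1) by (auto simp: card_2_iff)
  obtain p where p: "simple_path V T u v p"
    using T(4) e(2) uv walk_imp_simple_path unfolding connected_graph_def by (metis insert_subset)
  have uniq: "path_edges q = path_edges p" if "simple_path V T u' v' q" "e = {u', v'}" for q u' v'
  proof -
    have par: "odd (card {f \<in> path_edges r. x \<in> f}) \<longleftrightarrow> x \<in> e" if "simple_path V T a b r" "e = {a, b}" for r a b x
    proof -
      have "distinct r" "r \<noteq> []" "hd r = a" "last r = b" using that by (auto simp: simple_path_def walk_def)
      moreover have "a \<noteq> b" using that uv by auto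
      ultimately show ?thesis using path_parity[of r x] that(2) by auto
    qed
    have "even_set (sym_diff (path_edges q) (path_edges p))"
      using par[OF that] par[OF p uv(1)] by (intro even_set_sym_diff) auto
    moreover have "sym_diff (path_edges q) (path_edges p) \<subseteq> T"
      using p that by (auto simp: simple_path_def walk_def)
    ultimately have "sym_diff (path_edges q) (path_edges p) = {}"
      using acyclic_no_even_set[OF T(1)] T(2,3) by (metis finite_subset subsetD)
    then show ?thesis by blast
  qed
  have tc: "tree_cycle V T e = insert e (path_edges p)"
    unfolding tree_cycle_def using uniq p uv by blast
  have pT: "path_edges p \<subseteq> T" "distinct p" "p \<noteq> []" "hd p = u" "last p = v"
    using p by (auto simp: simple_path_def walk_def)
  then have "e \<notin> path_edges p" using e(3) by blast
  then show "even_set (tree_cycle V T e)"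
    unfolding tc even_set_def using path_parity[OF pT(2,3)] pT uv by (auto simp: card_insert_filter)
  show "e \<in> tree_cycle V T e" "tree_cycle V T e \<subseteq> insert e T" using tc pT by auto
qed

section \<open>The dimension of homology\<close>

text \<open>A linear functional on cycles that vanishes exactly on the boundaries identifies homology
  with its image: the homology classes are its fibres.\<close>

lemma homology_dim_eqI:
  fixes f :: "'v set set \<Rightarrow> bit vec"
  assumes Zadd: "\<And>a b. a \<in> cycles K p \<Longrightarrow> b \<in> cycles K p \<Longrightarrow> sym_diff a b \<in> cycles K p"
    and B: "boundaries K p = {z \<in> cycles K p. f z = 0\<^sub>v h}"
    and fadd: "\<And>a b. a \<in> cycles K p \<Longrightarrow> b \<in> cycles K p \<Longrightarrow> f (sym_diff a b) = f a + f b"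
    and im: "f ` cycles K p = carrier_vec h"
  shows "homology_dim K p = h"
proof -
  let ?Z = "cycles K p"
  have fc: "f z \<in> carrier_vec h" if "z \<in> ?Z" for z using im that by auto
  have vadd: "w + w = 0\<^sub>v h" if "w \<in> carrier_vec h" for w :: "bit vec"
    using that by (intro eq_vecI) auto
  have vadd2: "w + (w + w') = w'" if "w \<in> carrier_vec h" "w' \<in> carrier_vec h" for w w' :: "bit vec"
    using that by (intro eq_vecI) (auto simp: add.assoc[symmetric])
  have hom: "homologous K p z z' \<longleftrightarrow> f z = f z'" if "z \<in> ?Z" "z' \<in> ?Z" for z z'
  proof -
    have "f z + f z' = 0\<^sub>v h \<longleftrightarrow> f z = f z'"
      using vadd2[OF fc[OF that(1)] fc[OF that(2)]] vadd[OF fc[OF that(2)]] fc[OF that(1)] fc[OF that(2)]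
      by (metis right_zero_vec)
    then show ?thesis using that by (simp add: homologous_def B Zadd fadd)
  qed
  define cl where "cl w = {z \<in> ?Z. f z = w}" for w
  have carrier: "carrier (homology K p) = cl ` carrier_vec h"
  proof -
    have "{(z, z'). z \<in> ?Z \<and> z' \<in> ?Z \<and> homologous K p z z'} `` {z} = cl (f z)" if "z \<in> ?Z" for z
      using that hom by (auto simp: cl_def)
    then have "?Z // {(z, z'). z \<in> ?Z \<and> z' \<in> ?Z \<and> homologous K p z z'} = (\<lambda>z. cl (f z)) ` ?Z"
      unfolding quotient_def by auto
    then show ?thesis unfolding homology_def im[symmetric] by (simp add: image_image)
  qed
  have zero: "zero (homology K p) = cl (0\<^sub>v h)" by (simp add: homology_def B cl_def)
  have add: "add (homology K p) (cl w) (cl w') = cl (w + w')" if w: "w \<in> carrier_vec h" "w' \<in> carrier_vec h" for w w'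
  proof -
    \<comment> \<open>The sum of two fibres fills the whole fibre over the sum: \<open>z\<close> is
      split as \<open>c\<close> plus \<open>sym_diff c z\<close>, with \<open>c\<close> any cycle
      over \<open>w\<close>.\<close>
    have "z \<in> {sym_diff c d |c d. c \<in> cl w \<and> d \<in> cl w'}" if z: "z \<in> cl (w + w')" for z
    proof -
      obtain c where c: "c \<in> ?Z" "f c = w" using w im by (metis imageE)
      have zz: "z \<in> ?Z" "f z = w + w'" using z by (auto simp: cl_def)
      have "sym_diff c z \<in> cl w'" using c zz vadd2[OF w] by (simp add: cl_def Zadd fadd)
      moreover have "z = sym_diff c (sym_diff c z)" by auto
      ultimately show ?thesis using c unfolding cl_def by blast
    qed
    moreover have "sym_diff c d \<in> cl (w + w')" if "c \<in> cl w" "d \<in> cl w'" for c d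
      using that by (auto simp: cl_def Zadd fadd)
    ultimately have "{sym_diff c d |c d. c \<in> cl w \<and> d \<in> cl w'} = cl (w + w')" by blast
    then show ?thesis by (simp add: homology_def)
  qed
  have smult: "smult (homology K p) a (cl w) = cl (a \<cdot>\<^sub>v w)" if w: "w \<in> carrier_vec h" for a w
  proof (cases a)
    case zero
    have "0 \<cdot>\<^sub>v w = 0\<^sub>v h" using w by auto
    then show ?thesis using zero by (simp add: homology_def B cl_def)
  next
    case one
    then show ?thesis using w by (simp add: homology_def)
  qed
  have inj: "inj_on cl (carrier_vec h)"
  proof (rule inj_onI)
    fix w w' assume w: "w \<in> carrier_vec h" "w' \<in> carrier_vec h" "cl w = cl w'"
    obtain c where "c \<in> ?Z" "f c = w" using w im by (metis imageE)
    then have "c \<in> cl w'" unfolding w(3)[symmetric] by (simp add: cl_def)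
    then show "w = w'" using \<open>f c = w\<close> by (simp add: cl_def)
  qed
  interpret V: vec_space "TYPE(bit)" h .
  have W: "vectorspace (class_ring :: bit ring) (homology K p)"
  proof (rule vs_criteria)
    show "field (class_ring :: bit ring)" by (rule VS_Connect.class_field)
    show "\<zero>\<^bsub>homology K p\<^esub> \<in> carrier (homology K p)" unfolding zero carrier by simp
    show "\<forall>v w. v \<in> carrier (homology K p) \<and> w \<in> carrier (homology K p) \<longrightarrow>
       v \<oplus>\<^bsub>homology K p\<^esub> w \<in> carrier (homology K p)"
      unfolding carrier by (auto simp: add)
    show "\<forall>v\<in>carrier (homology K p). \<exists>neg_v\<in>carrier (homology K p). v \<oplus>\<^bsub>homology K p\<^esub> neg_v = \<zero>\<^bsub>homology K p\<^esub>"
      unfolding carrier zero by (auto simp: add vadd intro!: bexI)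
    show "\<forall>c v. c \<in> carrier (class_ring :: bit ring) \<and> v \<in> carrier (homology K p) \<longrightarrow>
       c \<odot>\<^bsub>homology K p\<^esub> v \<in> carrier (homology K p)"
      unfolding carrier by (auto simp: smult)
    show "\<forall>v w. v \<in> carrier (homology K p) \<and> w \<in> carrier (homology K p) \<longrightarrow>
       v \<oplus>\<^bsub>homology K p\<^esub> w = w \<oplus>\<^bsub>homology K p\<^esub> v"
      unfolding carrier by (auto simp: add comm_add_vec)
    show "\<forall>v w x. v \<in> carrier (homology K p) \<and> w \<in> carrier (homology K p) \<and> x \<in> carrier (homology K p) \<longrightarrow>
       v \<oplus>\<^bsub>homology K p\<^esub> w \<oplus>\<^bsub>homology K p\<^esub> x = v \<oplus>\<^bsub>homology K p\<^esub> (w \<oplus>\<^bsub>homology K p\<^esub> x)"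
      unfolding carrier by (auto simp: add assoc_add_vec)
    show "\<forall>v\<in>carrier (homology K p). v \<oplus>\<^bsub>homology K p\<^esub> \<zero>\<^bsub>homology K p\<^esub> = v"
      unfolding carrier zero by (auto simp: add)
    show "\<forall>a b v. a \<in> carrier (class_ring :: bit ring) \<and> b \<in> carrier class_ring \<and> v \<in> carrier (homology K p) \<longrightarrow>
       (a \<otimes>\<^bsub>class_ring\<^esub> b) \<odot>\<^bsub>homology K p\<^esub> v = a \<odot>\<^bsub>homology K p\<^esub> (b \<odot>\<^bsub>homology K p\<^esub> v)"
      unfolding carrier by (auto simp: smult class_ring_simps smult_smult_assoc)
    show "\<forall>v\<in>carrier (homology K p). \<one>\<^bsub>class_ring\<^esub> \<odot>\<^bsub>homology K p\<^esub> v = v"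
      unfolding carrier by (auto simp: smult class_ring_simps)
    show "\<forall>a b v. a \<in> carrier (class_ring :: bit ring) \<and> b \<in> carrier class_ring \<and> v \<in> carrier (homology K p) \<longrightarrow>
       (a \<oplus>\<^bsub>class_ring\<^esub> b) \<odot>\<^bsub>homology K p\<^esub> v = a \<odot>\<^bsub>homology K p\<^esub> v \<oplus>\<^bsub>homology K p\<^esub> b \<odot>\<^bsub>homology K p\<^esub> v"
      unfolding carrier by (auto simp: smult add class_ring_simps add_smult_distrib_vec)
    show "\<forall>a v w. a \<in> carrier (class_ring :: bit ring) \<and> v \<in> carrier (homology K p) \<and> w \<in> carrier (homology K p) \<longrightarrow>
       a \<odot>\<^bsub>homology K p\<^esub> (v \<oplus>\<^bsub>homology K p\<^esub> w) = a \<odot>\<^bsub>homology K p\<^esub> v \<oplus>\<^bsub>homology K p\<^esub> a \<odot>\<^bsub>homology K p\<^esub> w"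
      unfolding carrier by (auto simp: smult add smult_add_distrib_vec)
  qed
  have "linear_map (class_ring :: bit ring) (module_vec TYPE(bit) h) (homology K p) cl"
    unfolding linear_map_def mod_hom_def mod_hom_axioms_def
  proof (intro conjI)
    show "vectorspace (class_ring :: bit ring) (module_vec TYPE(bit) h)" by (rule vec_vs)
    then show "module (class_ring :: bit ring) (module_vec TYPE(bit) h)" by (simp add: vectorspace_def)
    show "vectorspace (class_ring :: bit ring) (homology K p)" by (rule W)
    then show "module (class_ring :: bit ring) (homology K p)" by (simp add: vectorspace_def)
    show "cl \<in> module_hom class_ring (module_vec TYPE(bit) h) (homology K p)"
      unfolding module_hom_def by (auto simp: carrier module_vec_simps add smult)
  qed
  then interpret L: linear_map "class_ring :: bit ring" "module_vec TYPE(bit) h" "homology K p" cl .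
  have "V.dim = vectorspace.dim (class_ring :: bit ring) (homology K p)"
    by (rule L.dim_eq[OF V.fin_dim]) (use inj in \<open>simp_all add: module_vec_simps carrier\<close>)
  then show ?thesis by (simp add: homology_dim_def V.dim_is_n)
qed

text \<open>Keeps the degree in \<open>cycles K 1\<close> and \<open>simplices K 1\<close> from
  turning into \<open>Suc 0\<close>.\<close>

declare One_nat_def [simp del]

lemma bit_of_nat_eq: "(of_nat m :: bit) = of_bool (odd m)"
  by (induction m) auto

lemma sum_of_bool_bit:
  "finite S \<Longrightarrow> (\<Sum>x\<in>S. of_bool (P x) :: bit) = of_bool (odd (card {x \<in> S. P x}))"
proof -
  assume "finite S"
  then have "(\<Sum>x\<in>S. of_bool (P x) :: bit) = of_nat (card {x \<in> S. P x})"
    by (simp add: sum_of_bool_eq Int_def)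
  then show ?thesis by (simp only: bit_of_nat_eq)
qed

lemma bit_eq_of_bool: "x = (of_bool (x = 1) :: bit)"
  by (cases x) auto

lemma of_bool_bit_inject: "(of_bool P :: bit) = of_bool Q \<longleftrightarrow> P = Q"
  by auto

lemma earliest_basis_conv:
  assumes A: "A \<in> carrier_mat n m"
  shows "earliest_basis A \<in> carrier_mat n (card (early A))"
    "i < n \<Longrightarrow> l < card (early A) \<Longrightarrow> earliest_basis A $$ (i, l) = A $$ (i, early_list A ! l)"
proof -
  have "early_list A ! l < m" if "l < card (early A)" for l
    using that early_list[of A] early_subset[of A] A by (metis carrier_matD(2) lessThan_iff nth_mem subsetD)
  then show "earliest_basis A \<in> carrier_mat n (card (early A))"
    "i < n \<Longrightarrow> l < card (early A) \<Longrightarrow> earliest_basis A $$ (i, l) = A $$ (i, early_list A ! l)"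
    using A early_list(4)[of A] unfolding earliest_basis_def earliest_basis_indices_eq[OF A]
    by (auto simp: mat_of_cols_def)
qed

section \<open>Sentinel cycles and annotations\<close>

locale edge_complex =
  fixes K :: "'v set set" and es ts :: "'v set list" and T :: "'v set set" and ss :: "'v set list"
  assumes K: "connected_2_complex K" and es: "enumerates es (simplices K 1)"
    and ts: "enumerates ts (simplices K 2)"
    and T: "spanning_tree (vertices K) (edges K) T" and ss: "enumerates ss (edges K - T)"
begin

definition "n = length es"
definition "d = length ts"
definition "k = length ss"

definition "D = boundary_matrix K es ts"
definition "Z = cycle_matrix K es T ss"
definition "A = mat_of_cols (length es) (cols D @ cols Z)"
definition "cyc i = tree_cycle (vertices K) T (ss ! i)"

lemma finK: "finite K" and face: "\<sigma> \<in> K \<Longrightarrow> \<tau> \<subseteq> \<sigma> \<Longrightarrow> \<tau> \<noteq> {} \<Longrightarrow> \<tau> \<in> K"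
  using K unfolding connected_2_complex_def simplicial_complex_def by blast+

lemma edgesD: "e \<in> edges K \<Longrightarrow> card e = 2 \<and> e \<in> K" by (auto simp: simplices_def)
lemma trianglesD: "t \<in> simplices K 2 \<Longrightarrow> card t = 3 \<and> t \<in> K" by (auto simp: simplices_def)
lemma finE: "finite (edges K)" using finK by (auto simp: simplices_def)

lemma es_nth: "r < n \<Longrightarrow> es ! r \<in> edges K" and ts_nth: "j < d \<Longrightarrow> ts ! j \<in> simplices K 2"
  and ss_nth: "i < k \<Longrightarrow> ss ! i \<in> edges K - T"
  using es ts ss by (auto simp: enumerates_def n_def d_def k_def)

lemma es_ex: "e \<in> edges K \<Longrightarrow> \<exists>r<n. e = es ! r"
  using es unfolding enumerates_def n_def by (metis in_set_conv_nth)
lemma ts_ex: "t \<in> simplices K 2 \<Longrightarrow> \<exists>j<d. t = ts ! j"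
  using ts unfolding enumerates_def d_def by (metis in_set_conv_nth)
lemma ss_ex: "e \<in> edges K - T \<Longrightarrow> \<exists>i<k. e = ss ! i"
  using ss unfolding enumerates_def k_def by (metis in_set_conv_nth)

lemma es_inj: "r < n \<Longrightarrow> r' < n \<Longrightarrow> es ! r = es ! r' \<longleftrightarrow> r = r'"
  and ss_inj: "i < k \<Longrightarrow> i' < k \<Longrightarrow> ss ! i = ss ! i' \<longleftrightarrow> i = i'"
  and ts_inj: "j < d \<Longrightarrow> j' < d \<Longrightarrow> ts ! j = ts ! j' \<longleftrightarrow> j = j'"
  using es ss ts by (auto simp: enumerates_def n_def k_def d_def nth_eq_iff_index_eq)

lemma T_sub: "T \<subseteq> edges K" and T_acyclic: "acyclic_graph T" and T_conn: "connected_graph (vertices K) T"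
  using T by (auto simp: spanning_tree_def)

text \<open>The last two facts say that in the rows of the sentinel edges the matrix
  \<open>Z\<close> is the identity.\<close>

lemma cyc_props: "i < k \<Longrightarrow> even_set (cyc i)" "i < k \<Longrightarrow> ss ! i \<in> cyc i" "i < k \<Longrightarrow> cyc i \<subseteq> insert (ss ! i) T"
proof -
  have "even_set (cyc i) \<and> ss ! i \<in> cyc i \<and> cyc i \<subseteq> insert (ss ! i) T" if i: "i < k" for i
  proof -
    have e: "card (ss ! i) = 2" "ss ! i \<subseteq> vertices K" "ss ! i \<notin> T"
      using ss_nth[OF i] edgesD[of "ss ! i"] by auto
    have T: "finite T" "\<And>f. f \<in> T \<Longrightarrow> card f = 2"
      using T_sub finE finite_subset edgesD by auto
    show ?thesis unfolding cyc_def
      using tree_cycle_props[OF T_acyclic T T_conn e] by blast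
  qed
  then show "i < k \<Longrightarrow> even_set (cyc i)" "i < k \<Longrightarrow> ss ! i \<in> cyc i" "i < k \<Longrightarrow> cyc i \<subseteq> insert (ss ! i) T"
    by blast+
qed

lemma cyc_sub: "i < k \<Longrightarrow> cyc i \<subseteq> edges K"
  using cyc_props(3)[of i] ss_nth[of i] T_sub by blast

text \<open>\<open>boundary\<close> tests faces of every dimension, but for a set of edges only
  single vertices can occur in it; and an element outside the complex lies on no edge.\<close>

lemma cycles_iff: "z \<in> cycles K 1 \<longleftrightarrow> z \<subseteq> edges K \<and> even_set z"
proof -
  have "boundary K z = {} \<longleftrightarrow> even_set z" if z: "z \<subseteq> edges K"
  proof
    assume b: "boundary K z = {}"
    show "even_set z" unfolding even_set_def
    proof
      fix v
      show "even (card {e \<in> z. v \<in> e})"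
      proof (cases "{v} \<in> K")
        case True
        have "{\<sigma> \<in> z. {v} \<subseteq> \<sigma> \<and> card \<sigma> = card {v} + 1} = {e \<in> z. v \<in> e}" using z edgesD by auto
        then show ?thesis using b True unfolding boundary_def by fastforce
      next
        case False
        then have "{e \<in> z. v \<in> e} = {}" using z edgesD face by blast
        then show ?thesis by (simp only: card.empty even_zero)
      qed
    qed
  next
    assume e: "even_set z"
    have "even (card {\<sigma> \<in> z. \<tau> \<subseteq> \<sigma> \<and> card \<sigma> = card \<tau> + 1})" if "\<tau> \<in> K" for \<tau>
    proof (cases "card \<tau> = 1")
      case True
      then obtain v where v: "\<tau> = {v}" by (rule card_1_singletonE)
      have "{\<sigma> \<in> z. \<tau> \<subseteq> \<sigma> \<and> card \<sigma> = card \<tau> + 1} = {e \<in> z. v \<in> e}" using z edgesD v by auto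
      then show ?thesis using e by (simp add: even_set_def)
    next
      case False
      then have "{\<sigma> \<in> z. \<tau> \<subseteq> \<sigma> \<and> card \<sigma> = card \<tau> + 1} = {}" using z edgesD[of \<sigma> for \<sigma>]
        unfolding Collect_empty_eq by (metis Suc_1 Suc_eq_plus1 nat.inject subsetD One_nat_def)
      then show ?thesis by (simp only: card.empty even_zero)
    qed
    then show "boundary K z = {}" unfolding boundary_def Collect_empty_eq by (metis (no_types))
  qed
  then show ?thesis by (auto simp: cycles_def chains_def)
qed

lemma boundary_triangles:
  assumes c: "c \<subseteq> simplices K 2"
  shows "boundary K c = {e \<in> edges K. odd (card {t \<in> c. e \<subseteq> t})}"
proof -
  have c3: "card \<sigma> = 3" if "\<sigma> \<in> c" for \<sigma>
    using trianglesD[OF subsetD[OF c that]] by simp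
  have two: "{\<sigma> \<in> c. \<tau> \<subseteq> \<sigma> \<and> card \<sigma> = card \<tau> + 1} = {t \<in> c. \<tau> \<subseteq> t}" if "card \<tau> = 2" for \<tau>
  proof (rule Collect_cong)
    fix \<sigma>
    have "\<sigma> \<in> c \<Longrightarrow> card \<sigma> = card \<tau> + 1" unfolding that using c3[of \<sigma>] by linarith
    then show "\<sigma> \<in> c \<and> \<tau> \<subseteq> \<sigma> \<and> card \<sigma> = card \<tau> + 1 \<longleftrightarrow> \<sigma> \<in> c \<and> \<tau> \<subseteq> \<sigma>" by blast
  qed
  have "card \<tau> = 2" if "odd (card {\<sigma> \<in> c. \<tau> \<subseteq> \<sigma> \<and> card \<sigma> = card \<tau> + 1})" for \<tau>
  proof -
    have "{\<sigma> \<in> c. \<tau> \<subseteq> \<sigma> \<and> card \<sigma> = card \<tau> + 1} \<noteq> {}"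
    proof
      assume "{\<sigma> \<in> c. \<tau> \<subseteq> \<sigma> \<and> card \<sigma> = card \<tau> + 1} = {}"
      from that[unfolded this] show False by (simp only: card.empty even_zero not_True_eq_False)
    qed
    then obtain \<sigma> where "\<sigma> \<in> c" "card \<sigma> = card \<tau> + 1" by blast
    then show ?thesis using c3[of \<sigma>] by linarith
  qed
  moreover have "\<tau> \<in> edges K \<longleftrightarrow> \<tau> \<in> K \<and> card \<tau> = 2" for \<tau>
    by (simp add: simplices_def numeral_2_eq_2 One_nat_def)
  ultimately have "\<tau> \<in> K \<and> odd (card {\<sigma> \<in> c. \<tau> \<subseteq> \<sigma> \<and> card \<sigma> = card \<tau> + 1}) \<longleftrightarrow>
      \<tau> \<in> edges K \<and> odd (card {t \<in> c. \<tau> \<subseteq> t})" for \<tau>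
    using two[of \<tau>] by (cases "card \<tau> = 2") (simp only: simp_thms, blast)
  then show ?thesis unfolding boundary_def by blast
qed

text \<open>The boundary of a boundary is zero: each vertex of a triangle lies on exactly two of its
  edges.\<close>

lemma even_triangle: "t \<in> simplices K 2 \<Longrightarrow> even_set {e \<in> edges K. e \<subseteq> t}"
  unfolding even_set_def
proof
  fix v assume t: "t \<in> simplices K 2"
  show "even (card {e \<in> {e \<in> edges K. e \<subseteq> t}. v \<in> e})"
  proof (cases "v \<in> t")
    case True
    have "card (t - {v}) = 2" using trianglesD[OF t] True by simp
    then obtain a b where ab: "t - {v} = {a, b}" "a \<noteq> b" by (auto simp: card_2_iff)
    then have tt: "t = {v, a, b}" "v \<noteq> a" "v \<noteq> b" using True by auto
    have "{v, a} \<in> edges K" "{v, b} \<in> edges K"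
      using trianglesD[OF t] face[of t "{v, a}"] face[of t "{v, b}"] tt by (auto simp: simplices_def)
    moreover have "e = {v, a} \<or> e = {v, b}" if e: "e \<in> edges K" "e \<subseteq> t" "v \<in> e" for e
    proof -
      obtain x y where xy: "e = {x, y}" "x \<noteq> y" using edgesD[OF e(1)] by (auto simp: card_2_iff)
      then show ?thesis using e tt by auto
    qed
    ultimately have "{e \<in> {e \<in> edges K. e \<subseteq> t}. v \<in> e} = {{v, a}, {v, b}}" using tt by auto
    moreover have "{v, a} \<noteq> {v, b}" using ab tt by (auto simp: doubleton_eq_iff)
    ultimately show ?thesis by simp
  next
    case False
    then have "{e \<in> {e \<in> edges K. e \<subseteq> t}. v \<in> e} = {}" by blast
    then show ?thesis by (simp only: card.empty even_zero)
  qed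
qed

lemma D_carrier: "D \<in> carrier_mat n d" and D_entry: "r < n \<Longrightarrow> j < d \<Longrightarrow> D $$ (r, j) = of_bool (es ! r \<subseteq> ts ! j)"
proof -
  show "D \<in> carrier_mat n d" unfolding D_def boundary_matrix_def n_def d_def by (metis length_map mat_of_cols_carrier(1))
  assume r: "r < n" and j: "j < d"
  have c: "{t. (t = ts ! j) \<and> e \<subseteq> t} = (if e \<subseteq> ts ! j then {ts ! j} else {})" for e by auto
  have "boundary K {ts ! j} = {e \<in> edges K. e \<subseteq> ts ! j}"
    using boundary_triangles[of "{ts ! j}"] ts_nth[OF j] by (auto simp: c)
  then show "D $$ (r, j) = of_bool (es ! r \<subseteq> ts ! j)"
    using r j es_nth[OF r] by (simp add: D_def boundary_matrix_def n_def d_def mat_of_cols_def chain_vec_def)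
qed

lemma Z_carrier: "Z \<in> carrier_mat n k" and Z_entry: "r < n \<Longrightarrow> i < k \<Longrightarrow> Z $$ (r, i) = of_bool (es ! r \<in> cyc i)"
  by (simp_all add: Z_def cycle_matrix_def n_def k_def mat_of_cols_def chain_vec_def cyc_def)

lemma A_carrier: "A \<in> carrier_mat n (d + k)"
  using D_carrier Z_carrier mat_of_cols_carrier(1)[of n "cols D @ cols Z"] by (simp add: A_def n_def)

lemma A_entry: "r < n \<Longrightarrow> j < d + k \<Longrightarrow> A $$ (r, j) = (if j < d then D $$ (r, j) else Z $$ (r, j - d))"
  using D_carrier Z_carrier by (auto simp: A_def n_def mat_of_cols_def nth_append)

lemma dims [simp]: "dim_row A = n" "dim_col A = d + k" "dim_row D = n" "dim_col D = d" "dim_row Z = n" "dim_col Z = k"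
  using A_carrier D_carrier Z_carrier by auto

text \<open>Column vectors are handled as functions of the row index. \<open>ch\<close> and
  \<open>supp\<close> translate between edge sets and such functions and are inverse to each other
  on rows below \<open>n\<close>.\<close>

definition ch :: "'v set set \<Rightarrow> nat \<Rightarrow> bit" where
  "ch z r = of_bool (es ! r \<in> z)"

definition supp :: "(nat \<Rightarrow> bit) \<Rightarrow> 'v set set" where
  "supp x = {es ! r |r. r < n \<and> x r = 1}"

lemma supp_sub: "supp x \<subseteq> edges K" using es_nth by (auto simp: supp_def)

lemma ch_supp: "r < n \<Longrightarrow> ch (supp x) r = x r"
  using es_inj by (cases "x r") (auto simp: ch_def supp_def)

lemma ch_inj: "z \<subseteq> edges K \<Longrightarrow> z' \<subseteq> edges K \<Longrightarrow> (\<And>r. r < n \<Longrightarrow> ch z r = ch z' r) \<Longrightarrow> z = z'"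
  using es_ex unfolding ch_def of_bool_bit_inject by blast

lemma ch_sym_diff: "ch (sym_diff a b) r = ch a r + ch b r"
  by (auto simp: ch_def)

text \<open>The degree modulo 2 as a linear functional. Cycles are the common kernel of all
  \<open>deg v\<close>, so sums of columns of \<open>A\<close> are cycles because the single columns
  are.\<close>

definition deg :: "'v \<Rightarrow> (nat \<Rightarrow> bit) \<Rightarrow> bit" where
  "deg v x = (\<Sum>r<n. of_bool (v \<in> es ! r) * x r)"

lemma deg_ch: "z \<subseteq> edges K \<Longrightarrow> deg v (ch z) = of_bool (odd (card {e \<in> z. v \<in> e}))"
proof -
  assume z: "z \<subseteq> edges K"
  have "deg v (ch z) = (\<Sum>r<n. of_bool (v \<in> es ! r \<and> es ! r \<in> z))"
    by (simp add: deg_def ch_def of_bool_conj)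
  also have "\<dots> = of_bool (odd (card {r \<in> {..<n}. v \<in> es ! r \<and> es ! r \<in> z}))"
    by (rule sum_of_bool_bit) simp
  also have "bij_betw ((!) es) {r \<in> {..<n}. v \<in> es ! r \<and> es ! r \<in> z} {e \<in> z. v \<in> e}"
    unfolding bij_betw_def
  proof
    show "inj_on ((!) es) {r \<in> {..<n}. v \<in> es ! r \<and> es ! r \<in> z}" by (auto simp: inj_on_def es_inj)
    show "(!) es ` {r \<in> {..<n}. v \<in> es ! r \<and> es ! r \<in> z} = {e \<in> z. v \<in> e}"
      using z es_ex by (fastforce simp: image_iff)
  qed
  then have "card {r \<in> {..<n}. v \<in> es ! r \<and> es ! r \<in> z} = card {e \<in> z. v \<in> e}" by (rule bij_betw_same_card)
  finally show ?thesis .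
qed

lemma even_set_iff_deg: "z \<subseteq> edges K \<Longrightarrow> even_set z \<longleftrightarrow> (\<forall>v. deg v (ch z) = 0)"
  by (simp add: deg_ch even_set_def)

lemma deg_cong: "(\<And>r. r < n \<Longrightarrow> x r = y r) \<Longrightarrow> deg v x = deg v y"
  unfolding deg_def by (intro sum.cong) auto

lemma deg_colsum:
  "finite S \<Longrightarrow> deg v (\<lambda>r. colsum A S r) = (\<Sum>s\<in>S. deg v (\<lambda>r. A $$ (r, s)))"
  unfolding deg_def colsum_def sum_distrib_left by (rule sum.swap)

lemma deg_column: "j < d + k \<Longrightarrow> deg v (\<lambda>r. A $$ (r, j)) = 0"
proof -
  assume j: "j < d + k"
  show ?thesis
  proof (cases "j < d")
    case True
    let ?z = "{e \<in> edges K. e \<subseteq> ts ! j}"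
    have "deg v (\<lambda>r. A $$ (r, j)) = deg v (ch ?z)"
      using True es_nth by (intro deg_cong) (auto simp: A_entry D_entry ch_def)
    also have "\<dots> = 0" using even_triangle[OF ts_nth[OF True]] even_set_iff_deg[of ?z] by simp
    finally show ?thesis .
  next
    case False
    then have i: "j - d < k" using j by simp
    have "deg v (\<lambda>r. A $$ (r, j)) = deg v (ch (cyc (j - d)))"
      using False j i by (intro deg_cong) (auto simp: A_entry Z_entry ch_def)
    also have "\<dots> = 0" using cyc_props(1)[OF i] even_set_iff_deg[OF cyc_sub[OF i]] by simp
    finally show ?thesis .
  qed
qed

lemma colsum_cycle:
  assumes "S \<subseteq> {..<d + k}"
  shows "supp (colsum A S) \<in> cycles K 1"
proof -
  have fin: "finite S" using finite_subset[OF assms] by simp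
  have "deg v (ch (supp (colsum A S))) = 0" for v
  proof -
    have "deg v (ch (supp (colsum A S))) = deg v (\<lambda>r. colsum A S r)" by (intro deg_cong) (simp add: ch_supp)
    also have "\<dots> = 0" unfolding deg_colsum[OF fin] using assms by (intro sum.neutral) (auto simp: deg_column)
    finally show ?thesis .
  qed
  then show ?thesis using supp_sub by (simp add: cycles_iff even_set_iff_deg)
qed

lemma cycle_expansion:
  assumes z: "z \<in> cycles K 1" and r: "r < n"
  shows "ch z r = colsum A {j. d \<le> j \<and> j < d + k \<and> ss ! (j - d) \<in> z} r"
proof -
  let ?S = "{j. d \<le> j \<and> j < d + k \<and> ss ! (j - d) \<in> z}"
  have zz: "z \<subseteq> edges K" "even_set z" using z by (auto simp: cycles_iff)
  let ?w = "sym_diff z (supp (colsum A ?S))"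
  have "supp (colsum A ?S) \<in> cycles K 1" by (rule colsum_cycle) auto
  then have s: "supp (colsum A ?S) \<subseteq> edges K" "even_set (supp (colsum A ?S))" by (auto simp: cycles_iff)
  have w: "?w \<subseteq> edges K" using zz s by blast
  have "?w \<inter> (edges K - T) = {}"
  proof (rule ccontr)
    assume "?w \<inter> (edges K - T) \<noteq> {}"
    then obtain e where e: "e \<in> ?w" "e \<in> edges K - T" by blast
    obtain i where i: "i < k" "e = ss ! i" using ss_ex[OF e(2)] by blast
    obtain r where r: "r < n" "e = es ! r" using es_ex[of e] e(2) by blast
    \<comment> \<open>In the row of sentinel edge \<open>i\<close> only the column of its own cycle
      has a 1. Hence both sides contain the same sentinel edges, and the difference
      \<open>?w\<close> lies in the tree.\<close>
    have "A $$ (r, j) = of_bool (j = d + i)" if "j \<in> ?S" for j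
    proof -
      have j: "d \<le> j" "j < d + k" "j - d < k" using that by auto
      have "es ! r \<in> cyc (j - d) \<longleftrightarrow> j - d = i"
        using cyc_props(2,3)[OF j(3)] r i e(2) ss_inj[OF j(3) i(1)] by auto
      then show ?thesis using j r by (auto simp: A_entry Z_entry)
    qed
    then have "colsum A ?S r = (\<Sum>j\<in>?S. of_bool (j = d + i))" unfolding colsum_def by (intro sum.cong) auto
    also have "\<dots> = of_bool (ss ! i \<in> z)" using i by (simp add: of_bool_def)
    finally have sum: "colsum A ?S r = of_bool (ss ! i \<in> z)" .
    have "ch (supp (colsum A ?S)) r = ch z r"
      unfolding ch_supp[OF r(1)] sum unfolding ch_def i(2)[symmetric] r(2)[symmetric] ..
    then have "ch ?w r = 0" by (simp only: ch_sym_diff bit_add_self)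
    moreover have "ch ?w r = 1" unfolding ch_def using e(1) r(2) by (simp only: of_bool_eq)
    ultimately show False by simp
  qed
  then have "?w \<subseteq> T" using w by blast
  moreover have "even_set ?w"
    using zz s finite_subset[OF zz(1) finE] finite_subset[OF s(1) finE]
    by (intro even_set_sym_diff) (auto simp: even_set_def)
  moreover have "finite ?w" using finite_subset[OF w finE] .
  moreover have "card e = 2" if "e \<in> ?w" for e using w that edgesD by blast
  ultimately have "?w = {}" using acyclic_no_even_set[OF T_acyclic] by blast
  then have "z = supp (colsum A ?S)" by blast
  then show ?thesis using ch_supp[OF r] by metis
qed

lemma boundaries_iff:
  assumes z: "z \<subseteq> edges K"
  shows "z \<in> boundaries K 1 \<longleftrightarrow> (\<exists>S\<subseteq>{..<d}. \<forall>r<n. ch z r = colsum A S r)"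
proof -
  have b: "ch (boundary K c) r = colsum A {j. j < d \<and> ts ! j \<in> c} r" if c: "c \<subseteq> simplices K 2" and r: "r < n" for c r
  proof -
    have "colsum A {j. j < d \<and> ts ! j \<in> c} r = (\<Sum>j\<in>{j. j < d \<and> ts ! j \<in> c}. of_bool (es ! r \<subseteq> ts ! j))"
      unfolding colsum_def using r by (intro sum.cong) (auto simp: A_entry D_entry)
    also have "\<dots> = of_bool (odd (card {j \<in> {j. j < d \<and> ts ! j \<in> c}. es ! r \<subseteq> ts ! j}))"
      by (rule sum_of_bool_bit) simp
    also have "bij_betw ((!) ts) {j \<in> {j. j < d \<and> ts ! j \<in> c}. es ! r \<subseteq> ts ! j} {t \<in> c. es ! r \<subseteq> t}"
      unfolding bij_betw_def
    proof
      show "inj_on ((!) ts) {j \<in> {j. j < d \<and> ts ! j \<in> c}. es ! r \<subseteq> ts ! j}" by (auto simp: inj_on_def ts_inj)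
      show "(!) ts ` {j \<in> {j. j < d \<and> ts ! j \<in> c}. es ! r \<subseteq> ts ! j} = {t \<in> c. es ! r \<subseteq> t}"
        using c ts_ex by (fastforce simp: image_iff)
    qed
    then have "card {j \<in> {j. j < d \<and> ts ! j \<in> c}. es ! r \<subseteq> ts ! j} = card {t \<in> c. es ! r \<subseteq> t}"
      by (rule bij_betw_same_card)
    finally show ?thesis using es_nth[OF r] by (simp add: ch_def boundary_triangles[OF c])
  qed
  show ?thesis
  proof
    assume "z \<in> boundaries K 1"
    then obtain c where c: "c \<subseteq> simplices K 2" "z = boundary K c"
      by (auto simp: boundaries_def chains_def numeral_2_eq_2)
    then show "\<exists>S\<subseteq>{..<d}. \<forall>r<n. ch z r = colsum A S r"
      using b[OF c(1)] by (intro exI[of _ "{j. j < d \<and> ts ! j \<in> c}"]) auto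
  next
    assume "\<exists>S\<subseteq>{..<d}. \<forall>r<n. ch z r = colsum A S r"
    then obtain S where S: "S \<subseteq> {..<d}" "\<forall>r<n. ch z r = colsum A S r" by blast
    let ?c = "(!) ts ` S"
    have c: "?c \<subseteq> simplices K 2" using S ts_nth by auto
    have "{j. j < d \<and> ts ! j \<in> ?c} = S" using S ts_inj by (auto simp: subset_iff)
    then have "z = boundary K ?c"
      using S b[OF c] z boundary_triangles[OF c] by (intro ch_inj) auto
    then show "z \<in> boundaries K 1" using c by (auto simp: boundaries_def chains_def numeral_2_eq_2)
  qed
qed

end

section \<open>Coordinates of cycles in the earliest basis, and the output of the algorithm\<close>

context edge_complex begin

definition "G = early A"
text \<open>The indices of the columns of \<open>H\<close>; their number \<open>h\<close> turns out
  to be the dimension of homology.\<close>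

definition "gh = sorted_list_of_set (G - {..<d})"
definition "h = length gh"

lemma G_sub: "G \<subseteq> {..<d + k}" and finG [simp]: "finite G" and G_indep: "indep A G"
  using early_subset[of A] early_indep[of A] by (auto simp: G_def)

text \<open>The boundary columns come first in \<open>A\<close>, so each of them has the same
  columns to its left in \<open>D\<close> and in \<open>A\<close>. Thus \<open>B\<close> consists of
  the early columns below \<open>d\<close>.\<close>

lemma early_D: "early D = G \<inter> {..<d}"
proof -
  have "in_cspan D {..<j} j \<longleftrightarrow> in_cspan A {..<j} j" if j: "j < d" for j
  proof -
    have "colsum D S i = colsum A S i" if "S \<subseteq> {..<j}" "i < n" for S i
      unfolding colsum_def using that j by (intro sum.cong) (auto simp: A_entry)
    then show ?thesis unfolding in_cspan_def using j by (auto simp: A_entry)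
  qed
  then show ?thesis by (auto simp: early_def G_def)
qed

lemma rank_D: "vec_space.rank n D = card (G \<inter> {..<d})"
  using rank_early[OF D_carrier] by (simp add: early_D)

lemma card_G: "card G = card (G \<inter> {..<d}) + h"
proof -
  have "card G = card (G \<inter> {..<d}) + card (G - {..<d})"
    using card_Int_Diff[OF finG] .
  then show ?thesis by (simp add: h_def gh_def)
qed

lemma gh_props: "set gh = G - {..<d}" "distinct gh" "l < h \<Longrightarrow> gh ! l \<in> G" "l < h \<Longrightarrow> d \<le> gh ! l"
proof -
  show s: "set gh = G - {..<d}" "distinct gh" by (simp_all add: gh_def)
  show "l < h \<Longrightarrow> gh ! l \<in> G" "l < h \<Longrightarrow> d \<le> gh ! l" using s(1) nth_mem[of l gh] by (auto simp: h_def)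
qed

lemma early_list_A: "early_list A = sorted_list_of_set (G \<inter> {..<d}) @ gh"
proof -
  have "sorted_list_of_set G = sorted_list_of_set (G \<inter> {..<d}) @ gh"
    unfolding gh_def
  proof (rule sorted_distinct_set_unique)
    have "sorted (sorted_list_of_set (G \<inter> {..<d}))" "sorted (sorted_list_of_set (G - {..<d}))" by simp_all
    then show "sorted (sorted_list_of_set (G \<inter> {..<d}) @ sorted_list_of_set (G - {..<d}))"
      by (auto simp: sorted_append)
  qed auto
  then show ?thesis by (simp add: early_list_def G_def)
qed

text \<open>The coordinate vector of a cycle in the earliest basis, as the set of basis columns with
  coefficient 1. It is unique because \<open>G\<close> is independent.\<close>

definition rep :: "'v set set \<Rightarrow> nat set" where
  "rep z = (THE C. C \<subseteq> G \<and> (\<forall>r<n. ch z r = colsum A C r))"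

lemma rep_eqI:
  assumes "C \<subseteq> G" "\<And>r. r < n \<Longrightarrow> ch z r = colsum A C r"
  shows "rep z = C"
  unfolding rep_def
proof (rule the_equality)
  fix C' assume "C' \<subseteq> G \<and> (\<forall>r<n. ch z r = colsum A C' r)"
  then show "C' = C" using assms by (intro indep_unique[OF G_indep finG]) auto
qed (use assms in auto)

lemma rep:
  assumes z: "z \<in> cycles K 1"
  shows "rep z \<subseteq> G" "r < n \<Longrightarrow> ch z r = colsum A (rep z) r"
proof -
  let ?S = "{j. d \<le> j \<and> j < d + k \<and> ss ! (j - d) \<in> z}"
  have "finite ?S" by (rule finite_subset[of _ "{..<d + k}"]) auto
  moreover have "in_cspan A G s" if "s \<in> ?S" for s
    using early_spans[of s "d + k" A] that early_subset[of A] by (auto simp: G_def Int_absorb2)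
  ultimately obtain C where "C \<subseteq> G" "\<forall>r<n. colsum A ?S r = colsum A C r"
    using colsum_cspan[of ?S G A] by auto
  then have C: "C \<subseteq> G" "\<And>r. r < n \<Longrightarrow> ch z r = colsum A C r" using cycle_expansion[OF z] by auto
  have "rep z = C" using C by (rule rep_eqI)
  then show "rep z \<subseteq> G" "r < n \<Longrightarrow> ch z r = colsum A (rep z) r" using C by auto
qed

lemma cycles_sym_diff: "a \<in> cycles K 1 \<Longrightarrow> b \<in> cycles K 1 \<Longrightarrow> sym_diff a b \<in> cycles K 1"
  unfolding cycles_iff using finite_subset[OF _ finE]
  by (intro conjI even_set_sym_diff) (auto simp: even_set_def)

lemma rep_sym_diff:
  assumes "a \<in> cycles K 1" "b \<in> cycles K 1"
  shows "rep (sym_diff a b) = sym_diff (rep a) (rep b)"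
proof (rule rep_eqI)
  show "sym_diff (rep a) (rep b) \<subseteq> G" using rep(1)[OF assms(1)] rep(1)[OF assms(2)] by blast
  fix r assume r: "r < n"
  have "finite (rep a)" "finite (rep b)" using rep(1)[OF assms(1)] rep(1)[OF assms(2)] finite_subset finG by blast+
  then show "ch (sym_diff a b) r = colsum A (sym_diff (rep a) (rep b)) r"
    using rep(2)[OF assms(1) r] rep(2)[OF assms(2) r] by (simp only: ch_sym_diff colsum_sym_diff)
qed

text \<open>Boundary columns are already spanned by the early columns below \<open>d\<close>, and
  uniqueness of coordinates leaves no other representation.\<close>

lemma rep_boundary:
  assumes z: "z \<in> cycles K 1"
  shows "z \<in> boundaries K 1 \<longleftrightarrow> rep z \<subseteq> {..<d}"
proof
  have zE: "z \<subseteq> edges K" using z by (simp add: cycles_iff)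
  show "rep z \<subseteq> {..<d} \<Longrightarrow> z \<in> boundaries K 1"
    unfolding boundaries_iff[OF zE] using rep(2)[OF z] by blast
  assume "z \<in> boundaries K 1"
  then obtain S where S: "S \<subseteq> {..<d}" "\<forall>r<n. ch z r = colsum A S r" using boundaries_iff[OF zE] by blast
  have "finite S" using finite_subset[OF S(1)] by simp
  moreover have "in_cspan A (G \<inter> {..<d}) s" if "s \<in> S" for s
    using early_spans[of s d A] that S(1) by (auto simp: G_def)
  ultimately obtain C where C: "C \<subseteq> G \<inter> {..<d}" "\<forall>r<n. colsum A S r = colsum A C r"
    using colsum_cspan[of S "G \<inter> {..<d}" A] by auto
  have "rep z = C" by (rule rep_eqI) (use C S in auto)
  then show "rep z \<subseteq> {..<d}" using C by blast
qed

definition classvec :: "'v set set \<Rightarrow> bit vec" where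
  "classvec z = vec h (\<lambda>l. of_bool (gh ! l \<in> rep z))"

lemma classvec_carrier [simp]: "classvec z \<in> carrier_vec h" by (simp add: classvec_def)

lemma classvec_sym_diff:
  "a \<in> cycles K 1 \<Longrightarrow> b \<in> cycles K 1 \<Longrightarrow> classvec (sym_diff a b) = classvec a + classvec b"
  by (intro eq_vecI) (auto simp: classvec_def rep_sym_diff)

lemma classvec_boundary:
  assumes z: "z \<in> cycles K 1"
  shows "z \<in> boundaries K 1 \<longleftrightarrow> classvec z = 0\<^sub>v h"
proof -
  have "rep z \<subseteq> {..<d} \<longleftrightarrow> (\<forall>g\<in>set gh. g \<notin> rep z)" using rep(1)[OF z] gh_props(1) by auto
  also have "\<dots> \<longleftrightarrow> (\<forall>l<h. gh ! l \<notin> rep z)" by (metis h_def in_set_conv_nth)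
  also have "\<dots> \<longleftrightarrow> classvec z = 0\<^sub>v h"
  proof
    assume "classvec z = 0\<^sub>v h"
    then have "classvec z $ l = 0" if "l < h" for l using that by simp
    then show "\<forall>l<h. gh ! l \<notin> rep z" by (auto simp: classvec_def)
  qed (auto simp: classvec_def)
  finally show ?thesis using rep_boundary[OF z] by simp
qed

lemma boundaries_sub: "z \<in> boundaries K 1 \<Longrightarrow> z \<in> cycles K 1"
proof -
  assume z: "z \<in> boundaries K 1"
  then obtain c where "c \<subseteq> simplices K 2" "z = boundary K c"
    by (auto simp: boundaries_def chains_def numeral_2_eq_2)
  then have zE: "z \<subseteq> edges K" using boundary_triangles by auto
  obtain S where S: "S \<subseteq> {..<d}" "\<forall>r<n. ch z r = colsum A S r" using z boundaries_iff[OF zE] by blast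
  have "z = supp (colsum A S)" using S by (intro ch_inj[OF zE supp_sub]) (simp add: ch_supp)
  moreover have "S \<subseteq> {..<d + k}" using S(1) by (rule order_trans) simp
  ultimately show ?thesis using colsum_cycle by simp
qed

lemma homology_dim: "homology_dim K 1 = h"
proof (rule homology_dim_eqI[where f = classvec])
  show "boundaries K 1 = {z \<in> cycles K 1. classvec z = 0\<^sub>v h}"
    using boundaries_sub classvec_boundary by blast
  show "classvec ` cycles K 1 = carrier_vec h"
  proof
    show "carrier_vec h \<subseteq> classvec ` cycles K 1"
    proof
      fix w :: "bit vec" assume w: "w \<in> carrier_vec h"
      \<comment> \<open>Any prescribed class vector is attained by the sum of the corresponding
        columns of \<open>H\<close>.\<close>
      define C where "C = {gh ! l |l. l < h \<and> w $ l = 1}"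
      have CG: "C \<subseteq> G" using gh_props(3) by (auto simp: C_def)
      let ?z = "supp (colsum A C)"
      have "rep ?z = C" by (rule rep_eqI[OF CG]) (simp add: ch_supp)
      moreover have "gh ! l \<in> C \<longleftrightarrow> w $ l = 1" if "l < h" for l
        using that gh_props(2) by (auto simp: C_def h_def nth_eq_iff_index_eq)
      ultimately have "classvec ?z = w" using w by (intro eq_vecI) (auto simp: classvec_def)
      moreover have "?z \<in> cycles K 1" using CG G_sub by (intro colsum_cycle) blast
      ultimately show "w \<in> classvec ` cycles K 1" by blast
    qed
  qed auto
qed (simp_all only: cycles_sym_diff classvec_sym_diff)

lemma cyc_cycle: "i < k \<Longrightarrow> cyc i \<in> cycles K 1"
  using cyc_sub cyc_props(1) by (simp add: cycles_iff)

text \<open>The columns of the earliest basis are independent, so the system has exactly one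
  solution \<open>X\<close>: column \<open>i\<close> is the indicator vector of
  \<open>rep (cyc i)\<close>. The columns of \<open>H\<close> come last in the basis, so the last
  \<open>h\<close> entries form the class vector.\<close>

lemma output_iff:
  "edge_annotation_output K es ts T ss a \<longleftrightarrow> (\<forall>i<k. a (ss ! i) = classvec (cyc i)) \<and> (\<forall>e\<in>T. a e = 0\<^sub>v h)"
proof -
  let ?Z' = "earliest_basis A" and ?g = "card (G \<inter> {..<d})" and ?gl = "early_list A"
  have Z': "?Z' \<in> carrier_mat n (card G)" "\<And>i l. i < n \<Longrightarrow> l < card G \<Longrightarrow> ?Z' $$ (i, l) = A $$ (i, ?gl ! l)"
    using earliest_basis_conv[OF A_carrier] by (auto simp: G_def)
  have gl: "length ?gl = card G" "set ?gl = G" "distinct ?gl" using early_list[of A] by (auto simp: G_def)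
  have glh: "?gl ! (?g + l) = gh ! l" if "l < h" for l unfolding early_list_A by (simp add: nth_append)
  have hh: "dim_col ?Z' - vec_space.rank (length es) D = h" using Z'(1) rank_D card_G by (simp add: n_def)
  have prod: "(?Z' * X) $$ (r, i) = colsum A {?gl ! l |l. l < card G \<and> X $$ (l, i) = 1} r"
    if X: "X \<in> carrier_mat (card G) k" and ri: "r < n" "i < k" for X r i
  proof -
    have "(?Z' * X) $$ (r, i) = (\<Sum>l<card G. ?Z' $$ (r, l) * X $$ (l, i))"
      using X ri Z'(1) by (simp add: scalar_prod_def lessThan_atLeast0)
    also have "\<dots> = (\<Sum>l<card G. A $$ (r, ?gl ! l) * X $$ (l, i))"
      using Z'(2)[OF ri(1)] by (intro sum.cong) auto
    also have "\<dots> = (\<Sum>l\<in>{l. l < card G \<and> X $$ (l, i) = 1}. A $$ (r, ?gl ! l))"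
    proof (rule sum.mono_neutral_cong_right)
      show "\<forall>l\<in>{..<card G} - {l. l < card G \<and> X $$ (l, i) = 1}. A $$ (r, ?gl ! l) * X $$ (l, i) = 0" by auto
    qed auto
    also have "\<dots> = (\<Sum>s\<in>(!) ?gl ` {l. l < card G \<and> X $$ (l, i) = 1}. A $$ (r, s))"
      using gl by (subst sum.reindex) (auto simp: inj_on_def nth_eq_iff_index_eq)
    also have "(!) ?gl ` {l. l < card G \<and> X $$ (l, i) = 1} = {?gl ! l |l. l < card G \<and> X $$ (l, i) = 1}" by auto
    finally show ?thesis by (simp add: colsum_def)
  qed
  have Zch: "Z $$ (r, i) = ch (cyc i) r" if "r < n" "i < k" for r i using that by (simp add: Z_entry ch_def)
  have mem: "?gl ! l \<in> {?gl ! l |l. l < card G \<and> X $$ (l, i) = 1} \<longleftrightarrow> X $$ (l, i) = 1" if "l < card G" for l X i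
    using that gl by (auto simp: nth_eq_iff_index_eq)
  have last: "vec_last (col X i) h = classvec (cyc i)"
    if X: "X \<in> carrier_mat (card G) k" "?Z' * X = Z" and i: "i < k" for X i
  proof -
    let ?C = "{?gl ! l |l. l < card G \<and> X $$ (l, i) = 1}"
    have "rep (cyc i) = ?C"
    proof (rule rep_eqI)
      have "?gl ! l \<in> G" if "l < card G" for l using nth_mem[of l ?gl] that by (simp only: gl)
      then show "?C \<subseteq> G" by blast
      show "ch (cyc i) r = colsum A ?C r" if "r < n" for r
        using prod[OF X(1) that i] Zch[OF that i] X(2) by simp
    qed
    then have "gh ! l \<in> rep (cyc i) \<longleftrightarrow> X $$ (?g + l, i) = 1" if "l < h" for l
      using mem[of "?g + l" X i] glh[OF that] that card_G by simp
    then show ?thesis using X(1) i card_G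
      by (intro eq_vecI) (auto simp: vec_last_def classvec_def)
  qed
  \<comment> \<open>The solution is written down from the coordinates; its existence rests on the
    sentinel cycles lying in the span of the basis.\<close>
  define X where "X = mat (card G) k (\<lambda>(l, i). of_bool (?gl ! l \<in> rep (cyc i)) :: bit)"
  have X: "X \<in> carrier_mat (card G) k" by (simp add: X_def)
  have "?Z' * X = Z"
  proof (rule eq_matI)
    fix r i assume ri: "r < dim_row Z" "i < dim_col Z"
    then have ri': "r < n" "i < k" by auto
    have "{?gl ! l |l. l < card G \<and> X $$ (l, i) = 1} = rep (cyc i)"
    proof -
      have "g \<in> rep (cyc i) \<longleftrightarrow> (\<exists>l<card G. g = ?gl ! l \<and> ?gl ! l \<in> rep (cyc i))" for g
        using rep(1)[OF cyc_cycle[OF ri'(2)]] gl(1,2) by (metis in_set_conv_nth subsetD)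
      moreover have "X $$ (l, i) = 1 \<longleftrightarrow> ?gl ! l \<in> rep (cyc i)" if "l < card G" for l
        using that ri'(2) by (simp add: X_def)
      ultimately show ?thesis by blast
    qed
    then show "(?Z' * X) $$ (r, i) = Z $$ (r, i)"
      using prod[OF X ri'] rep(2)[OF cyc_cycle[OF ri'(2)] ri'(1)] Zch[OF ri'] by simp
  qed (use X Z'(1) in auto)
  note sol = this
  have "edge_annotation_output K es ts T ss a \<longleftrightarrow> (\<exists>X\<in>carrier_mat (card G) k. ?Z' * X = Z \<and>
      (\<forall>i<k. a (ss ! i) = vec_last (col X i) h) \<and> (\<forall>e\<in>T. a e = 0\<^sub>v h))"
    using Z'(1) hh unfolding edge_annotation_output_def Let_def D_def[symmetric] Z_def[symmetric] A_def[symmetric] k_def[symmetric]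
    by simp
  also have "\<dots> \<longleftrightarrow> (\<forall>i<k. a (ss ! i) = classvec (cyc i)) \<and> (\<forall>e\<in>T. a e = 0\<^sub>v h)"
  proof
    assume "(\<forall>i<k. a (ss ! i) = classvec (cyc i)) \<and> (\<forall>e\<in>T. a e = 0\<^sub>v h)"
    then show "\<exists>X\<in>carrier_mat (card G) k. ?Z' * X = Z \<and>
      (\<forall>i<k. a (ss ! i) = vec_last (col X i) h) \<and> (\<forall>e\<in>T. a e = 0\<^sub>v h)"
      using last[OF X sol] sol by (intro bexI[OF _ X]) simp
  next
    assume "\<exists>X\<in>carrier_mat (card G) k. ?Z' * X = Z \<and>
      (\<forall>i<k. a (ss ! i) = vec_last (col X i) h) \<and> (\<forall>e\<in>T. a e = 0\<^sub>v h)"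
    then show "(\<forall>i<k. a (ss ! i) = classvec (cyc i)) \<and> (\<forall>e\<in>T. a e = 0\<^sub>v h)"
      using last by metis
  qed
  finally show ?thesis .
qed

lemma output_exists: "\<exists>a. edge_annotation_output K es ts T ss a"
proof -
  let ?a = "\<lambda>e. if e \<in> T then 0\<^sub>v h else classvec (tree_cycle (vertices K) T e)"
  have "edge_annotation_output K es ts T ss ?a"
    unfolding output_iff
  proof (intro conjI allI impI ballI)
    show "?a (ss ! i) = classvec (cyc i)" if "i < k" for i
      using ss_nth[OF that] by (simp add: cyc_def)
  qed simp
  then show ?thesis by blast
qed

text \<open>A cycle is the sum of the cycles of its sentinel edges, and coordinates are
  linear.\<close>

lemma rep_expansion:
  assumes z: "z \<in> cycles K 1" and g: "g \<in> G"
  shows "of_bool (g \<in> rep z) = (\<Sum>i\<in>{i. i < k \<and> ss ! i \<in> z}. of_bool (g \<in> rep (cyc i)) :: bit)"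
proof -
  let ?I = "{i. i < k \<and> ss ! i \<in> z}"
  let ?c = "\<lambda>g. (\<Sum>i\<in>?I. of_bool (g \<in> rep (cyc i)) :: bit)"
  let ?C = "{g \<in> G. ?c g = 1}"
  have "rep z = ?C"
  proof (rule rep_eqI)
    fix r assume r: "r < n"
    have "colsum A ?C r = (\<Sum>g\<in>G. A $$ (r, g) * ?c g)" unfolding colsum_def
    proof (rule sum.mono_neutral_cong_left)
      show "\<forall>g\<in>G - ?C. A $$ (r, g) * ?c g = 0" by auto
    qed auto
    also have "\<dots> = (\<Sum>i\<in>?I. \<Sum>g\<in>G. A $$ (r, g) * of_bool (g \<in> rep (cyc i)))"
      unfolding sum_distrib_left by (rule sum.swap)
    also have "\<dots> = (\<Sum>i\<in>?I. ch (cyc i) r)"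
    proof (rule sum.cong[OF refl])
      fix i assume "i \<in> ?I"
      then have i: "i < k" by simp
      have "(\<Sum>g\<in>G. A $$ (r, g) * of_bool (g \<in> rep (cyc i))) = colsum A (rep (cyc i)) r"
        unfolding colsum_def using rep(1)[OF cyc_cycle[OF i]] by (intro sum.mono_neutral_cong_right) auto
      then show "(\<Sum>g\<in>G. A $$ (r, g) * of_bool (g \<in> rep (cyc i))) = ch (cyc i) r"
        using rep(2)[OF cyc_cycle[OF i] r] by simp
    qed
    also have "\<dots> = colsum A {j. d \<le> j \<and> j < d + k \<and> ss ! (j - d) \<in> z} r"
      unfolding colsum_def
      by (rule sum.reindex_bij_witness[of _ "\<lambda>j. j - d" "\<lambda>i. i + d"]) (auto simp: A_entry Z_entry r ch_def)
    finally show "ch z r = colsum A ?C r" using cycle_expansion[OF z r] by simp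
  qed auto
  then show ?thesis using g bit_eq_of_bool[of "?c g"] by simp
qed

text \<open>Tree edges are annotated by zero, so the annotation of a cycle sums the class vectors of
  its sentinel cycles and equals its own class vector.\<close>

lemma output_annotation:
  assumes a: "edge_annotation_output K es ts T ss a"
  shows "is_annotation K 1 a"
proof -
  have a1: "\<And>i. i < k \<Longrightarrow> a (ss ! i) = classvec (cyc i)" and a2: "\<And>e. e \<in> T \<Longrightarrow> a e = 0\<^sub>v h"
    using a unfolding output_iff by auto
  have carrier: "a e \<in> carrier_vec h" if "e \<in> edges K" for e
    using a1 a2 ss_ex[of e] that by (cases "e \<in> T") auto
  have ann: "chain_annotation h a z = classvec z" if z: "z \<in> cycles K 1" for z
  proof (rule eq_vecI)
    fix j assume "j < dim_vec (classvec z)"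
    then have j: "j < h" by (simp add: classvec_def)
    have zE: "z \<subseteq> edges K" using z by (simp add: cycles_iff)
    have "(\<Sum>\<sigma>\<in>z. a \<sigma> $ j) = (\<Sum>\<sigma>\<in>(!) ss ` {i. i < k \<and> ss ! i \<in> z}. a \<sigma> $ j)"
    proof (rule sum.mono_neutral_cong_right)
      show "finite z" using finite_subset[OF zE finE] .
      show "\<forall>\<sigma>\<in>z - (!) ss ` {i. i < k \<and> ss ! i \<in> z}. a \<sigma> $ j = 0"
      proof
        fix \<sigma> assume s: "\<sigma> \<in> z - (!) ss ` {i. i < k \<and> ss ! i \<in> z}"
        have "\<sigma> \<in> T"
        proof (rule ccontr)
          assume "\<sigma> \<notin> T"
          then obtain i where "i < k" "\<sigma> = ss ! i" using s zE ss_ex[of \<sigma>] by blast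
          then show False using s by blast
        qed
        then show "a \<sigma> $ j = 0" using a2 j by simp
      qed
    qed auto
    also have "\<dots> = (\<Sum>i\<in>{i. i < k \<and> ss ! i \<in> z}. a (ss ! i) $ j)"
      by (subst sum.reindex) (auto simp: inj_on_def ss_inj)
    also have "\<dots> = (\<Sum>i\<in>{i. i < k \<and> ss ! i \<in> z}. of_bool (gh ! j \<in> rep (cyc i)))"
      using a1 j by (intro sum.cong) (auto simp: classvec_def)
    also have "\<dots> = of_bool (gh ! j \<in> rep z)" using rep_expansion[OF z gh_props(3)[OF j]] by simp
    finally show "chain_annotation h a z $ j = classvec z $ j" using j by (simp add: chain_annotation_def classvec_def)
  qed (simp add: chain_annotation_def classvec_def)
  have "homologous K 1 z z' \<longleftrightarrow> classvec z = classvec z'" if z: "z \<in> cycles K 1" "z' \<in> cycles K 1" for z z'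
  proof -
    have "homologous K 1 z z' \<longleftrightarrow> classvec z + classvec z' = 0\<^sub>v h"
      unfolding homologous_def classvec_boundary[OF cycles_sym_diff[OF z]] classvec_sym_diff[OF z] ..
    also have "\<dots> \<longleftrightarrow> classvec z = classvec z'"
    proof
      assume eq: "classvec z + classvec z' = 0\<^sub>v h"
      show "classvec z = classvec z'"
      proof (rule eq_vecI)
        fix l assume "l < dim_vec (classvec z')"
        then have l: "l < h" by (simp add: classvec_def)
        have "(classvec z + classvec z') $ l = 0" unfolding eq using l by simp
        then show "classvec z $ l = classvec z' $ l" using l by (simp add: classvec_def bit_add_eq_0)
      qed (simp add: classvec_def)
    next
      assume eq: "classvec z = classvec z'"
      show "classvec z + classvec z' = 0\<^sub>v h"
        unfolding eq by (rule eq_vecI) (auto simp: classvec_def bit_add_self)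
    qed
    finally show ?thesis .
  qed
  then show ?thesis unfolding is_annotation_def homology_dim Let_def using carrier ann by simp
qed

end

section \<open>Recognising the output by dual functionals\<close>

context edge_complex begin

text \<open>A counting argument replaces dimensions: a subset of \<open>G\<close> is determined by
  its sum, and that sum, being a cycle, by its sentinel edges.\<close>

lemma card_G_le: "card G \<le> k"
proof -
  let ?f = "\<lambda>C. {i. i < k \<and> ss ! i \<in> supp (colsum A C)}"
  have "inj_on ?f (Pow G)"
  proof (rule inj_onI)
    fix C C' assume C: "C \<in> Pow G" "C' \<in> Pow G" and eq: "?f C = ?f C'"
    have cyc: "supp (colsum A C) \<in> cycles K 1" "supp (colsum A C') \<in> cycles K 1"
      using C G_sub by (blast intro: colsum_cycle)+
    have "ss ! (j - d) \<in> supp (colsum A C) \<longleftrightarrow> ss ! (j - d) \<in> supp (colsum A C')" if "d \<le> j" "j < d + k" for j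
    proof -
      have "j - d \<in> ?f C \<longleftrightarrow> j - d \<in> ?f C'" unfolding eq ..
      moreover have "j - d < k" using that by linarith
      ultimately show ?thesis by blast
    qed
    then have "{j. d \<le> j \<and> j < d + k \<and> ss ! (j - d) \<in> supp (colsum A C)} =
        {j. d \<le> j \<and> j < d + k \<and> ss ! (j - d) \<in> supp (colsum A C')}" by blast
    then have "colsum A C r = colsum A C' r" if "r < n" for r
      using cycle_expansion[OF cyc(1) that] cycle_expansion[OF cyc(2) that] that by (simp only: ch_supp)
    then show "C = C'" using C by (intro indep_unique[OF G_indep finG]) auto
  qed
  moreover have "?f ` Pow G \<subseteq> Pow {..<k}" by auto
  ultimately have "card (Pow G) \<le> card (Pow {..<k})" by (rule card_inj_on_le) simp
  then have "(2::nat) ^ card G \<le> 2 ^ k" by (simp add: card_Pow)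
  then show ?thesis by (rule power_le_imp_le_exp[rotated]) simp
qed

lemma sum_edges: "(\<Sum>r<n. f (es ! r)) = (\<Sum>e\<in>edges K. f e)"
proof -
  have "bij_betw ((!) es) {..<n} (edges K)"
    unfolding bij_betw_def using es_nth es_ex by (auto simp: inj_on_def es_inj image_iff)
  then show ?thesis by (rule sum.reindex_bij_betw)
qed

text \<open>The entries of \<open>a\<close> define linear functionals that vanish on all boundaries, so the columns of
  the first \<open>g'\<close> sentinel cycles are not spanned by earlier columns.  The rank bound leaves no room
  for further elements of the earliest basis.\<close>

lemma output_if_functionals:
  assumes g': "g' \<le> k" "k \<le> g' + card (G \<inter> {..<d})"
    and aT: "\<And>e. e \<in> T \<Longrightarrow> a e = 0\<^sub>v g'"
    and unit: "\<And>i. i < g' \<Longrightarrow> a (ss ! i) = unit_vec g' i"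
    and carrier: "\<And>i. i < k \<Longrightarrow> a (ss ! i) \<in> carrier_vec g'"
    and triangle: "\<And>t l. t \<in> simplices K 2 \<Longrightarrow> l < g' \<Longrightarrow> (\<Sum>e | e \<in> edges K \<and> e \<subseteq> t. a e $ l) = 0"
  shows "edge_annotation_output K es ts T ss a" "h = g'"
proof -
  \<comment> \<open>Coordinate \<open>l\<close> of \<open>a\<close>, extended linearly to edge
    vectors.\<close>
  define \<phi> where "\<phi> l x = (\<Sum>r<n. a (es ! r) $ l * x r)" for l :: nat and x :: "nat \<Rightarrow> bit"
  have phi_ch: "\<phi> l (ch z) = (\<Sum>e\<in>z. a e $ l)" if z: "z \<subseteq> edges K" for l z
  proof -
    have "\<phi> l (ch z) = (\<Sum>e\<in>edges K. a e $ l * of_bool (e \<in> z))"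
      unfolding \<phi>_def ch_def by (rule sum_edges)
    also have "\<dots> = (\<Sum>e\<in>z. a e $ l)"
      using z finE by (intro sum.mono_neutral_cong_right) auto
    finally show ?thesis .
  qed
  have phi_cong: "\<phi> l x = \<phi> l y" if "\<And>r. r < n \<Longrightarrow> x r = y r" for l x y
    unfolding \<phi>_def using that by (intro sum.cong) auto
  have phi_colsum: "\<phi> l (colsum A S) = (\<Sum>s\<in>S. \<phi> l (\<lambda>r. A $$ (r, s)))" for l S
    unfolding \<phi>_def colsum_def sum_distrib_left by (rule sum.swap)
  have phi_D: "\<phi> l (\<lambda>r. A $$ (r, j)) = 0" if j: "j < d" "l < g'" for j l
  proof -
    have "\<phi> l (\<lambda>r. A $$ (r, j)) = \<phi> l (ch {e \<in> edges K. e \<subseteq> ts ! j})"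
      using j es_nth by (intro phi_cong) (simp add: A_entry D_entry ch_def)
    also have "\<dots> = 0" using triangle[OF ts_nth[OF j(1)] j(2)] by (subst phi_ch) auto
    finally show ?thesis .
  qed
  have phi_cyc: "\<phi> l (ch (cyc i)) = a (ss ! i) $ l" if i: "i < k" "l < g'" for i l
  proof -
    have "(\<Sum>e\<in>cyc i. a e $ l) = (\<Sum>e\<in>{ss ! i}. a e $ l)"
    proof (rule sum.mono_neutral_right)
      show "finite (cyc i)" using finite_subset[OF cyc_sub[OF i(1)] finE] .
      show "\<forall>e\<in>cyc i - {ss ! i}. a e $ l = 0"
      proof
        fix e assume "e \<in> cyc i - {ss ! i}"
        then have "e \<in> T" using cyc_props(3)[OF i(1)] by blast
        then show "a e $ l = 0" using aT i(2) by simp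
      qed
    qed (use cyc_props(2)[OF i(1)] in simp)
    then show ?thesis using phi_ch[OF cyc_sub[OF i(1)]] by simp
  qed
  have phi_Z: "\<phi> l (\<lambda>r. A $$ (r, d + i)) = a (ss ! i) $ l" if i: "i < k" "l < g'" for i l
  proof -
    have "\<phi> l (\<lambda>r. A $$ (r, d + i)) = \<phi> l (ch (cyc i))"
      using i(1) by (intro phi_cong) (simp add: A_entry Z_entry ch_def)
    then show ?thesis using phi_cyc[OF i] by simp
  qed
  have phi_unit: "\<phi> l (\<lambda>r. A $$ (r, s)) = of_bool (s = d + l)" if s: "s < d + g'" "l < g'" for s l
  proof (cases "s < d")
    case True
    then show ?thesis using phi_D s by simp
  next
    case False
    then obtain i where i: "s = d + i" by (metis le_Suc_ex linorder_not_less)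
    then have "i < g'" using s by simp
    then show ?thesis unfolding i using phi_Z[of i l] unit[of i] g'(1) s(2) by simp
  qed
  \<comment> \<open>The functional \<open>\<phi> l\<close> is 1 on this column and 0 on all columns
    to its left, so the column is not spanned by them.\<close>
  have "d + l \<in> G" if l: "l < g'" for l
  proof -
    have "\<not> in_cspan A {..<d + l} (d + l)"
    proof
      assume "in_cspan A {..<d + l} (d + l)"
      then obtain S where S: "S \<subseteq> {..<d + l}" "\<forall>r<n. A $$ (r, d + l) = colsum A S r"
        by (auto simp: in_cspan_def)
      have "\<phi> l (\<lambda>r. A $$ (r, d + l)) = \<phi> l (colsum A S)" using S(2) by (intro phi_cong) simp
      also have "\<dots> = (\<Sum>s\<in>S. \<phi> l (\<lambda>r. A $$ (r, s)))" by (rule phi_colsum)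
      also have "\<dots> = 0"
      proof (rule sum.neutral, rule ballI)
        fix s assume "s \<in> S"
        then have "s < d + l" using S(1) by blast
        then show "\<phi> l (\<lambda>r. A $$ (r, s)) = 0" using phi_unit[of s l] l by simp
      qed
      finally show False using phi_unit[of "d + l" l] l by simp
    qed
    then show ?thesis using l g'(1) by (simp add: G_def early_def)
  qed
  then have sub: "{d..<d + g'} \<subseteq> G - {..<d}"
    by (auto dest!: le_Suc_ex)
  have hc: "h = card (G - {..<d})" by (simp add: h_def gh_def)
  \<comment> \<open>Here the rank enters: \<open>card G\<close> is the rank plus \<open>h\<close>
    and at most \<open>k\<close>, while \<open>k\<close> is at most \<open>g'\<close> plus the
    rank.\<close>
  have "h \<le> g'" using card_G card_G_le g'(2) by linarith
  then have eq: "{d..<d + g'} = G - {..<d}"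
    using sub hc by (intro card_subset_eq) (auto intro: antisym dest: card_mono[rotated])
  then show hg: "h = g'" using hc by (metis card_atLeastLessThan add_diff_cancel_left')
  have gh: "gh = [d..<d + g']" unfolding gh_def eq[symmetric] by simp
  \<comment> \<open>Applying \<open>\<phi> l\<close> to the expansion of the cycle in the basis
    \<open>G\<close> leaves only the coefficient of column \<open>d + l\<close>.\<close>
  have "a (ss ! i) = classvec (cyc i)" if i: "i < k" for i
  proof (rule eq_vecI)
    fix l assume "l < dim_vec (classvec (cyc i))"
    then have l: "l < g'" by (simp add: classvec_def hg)
    have rG: "rep (cyc i) \<subseteq> G" "finite (rep (cyc i))"
      using rep(1)[OF cyc_cycle[OF i]] finite_subset[OF _ finG] by auto
    have "a (ss ! i) $ l = \<phi> l (ch (cyc i))" using phi_cyc[OF i l] by simp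
    also have "\<dots> = \<phi> l (colsum A (rep (cyc i)))" by (rule phi_cong) (rule rep(2)[OF cyc_cycle[OF i]])
    also have "\<dots> = (\<Sum>s\<in>rep (cyc i). \<phi> l (\<lambda>r. A $$ (r, s)))" by (rule phi_colsum)
    also have "\<dots> = (\<Sum>s\<in>rep (cyc i). of_bool (s = d + l))"
    proof (rule sum.cong)
      fix s assume "s \<in> rep (cyc i)"
      then have "s < d \<or> s \<in> G - {..<d}" using rG(1) by auto
      then have "s < d + g'" unfolding eq[symmetric] by auto
      then show "\<phi> l (\<lambda>r. A $$ (r, s)) = of_bool (s = d + l)" using phi_unit l by blast
    qed simp
    also have "\<dots> = of_bool (d + l \<in> rep (cyc i))" using rG(2) by (simp add: of_bool_def)
    also have "\<dots> = classvec (cyc i) $ l" using l by (simp add: classvec_def hg gh)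
    finally show "a (ss ! i) $ l = classvec (cyc i) $ l" .
  qed (use carrier[OF i] in \<open>simp add: classvec_def hg\<close>)
  then show "edge_annotation_output K es ts T ss a" unfolding output_iff using aT hg by simp
qed

end

declare One_nat_def [simp]

section \<open>Programs and their costs\<close>

lemmas exec_simped = exec.intros[simplified]

text \<open>A weakest precondition whose postcondition also receives the elapsed time. For programs
  without loops it is computed by the simplifier through the equations below.\<close>

definition run :: "nat \<Rightarrow> prog \<Rightarrow> memory \<Rightarrow> (nat \<Rightarrow> memory \<Rightarrow> bool) \<Rightarrow> bool" where
  "run w P s Q \<longleftrightarrow> (\<exists>t s'. exec w P s t s' \<and> Q t s')"

inductive_cases exec_SkipE: "exec w Skip s t s'"
inductive_cases exec_PutE: "exec w (Put a i e) s t s'"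
inductive_cases exec_SeqE: "exec w (Seq P R) s t s'"
inductive_cases exec_CondE: "exec w (Cond b P R) s t s'"

lemma run_Skip [simp]: "run w Skip s Q \<longleftrightarrow> Q 1 s"
  unfolding run_def by (auto intro: exec_simped elim: exec_SkipE)

lemma run_Put [simp]:
  "run w (Put a i e) s Q \<longleftrightarrow> fits w i s \<and> fits w e s \<and>
     Q (expr_cost i + expr_cost e + 1) (s(a := (s a)(expr_val i s := expr_val e s)))"
  unfolding run_def by (auto intro: exec_simped elim!: exec_PutE)

lemma run_Seq [simp]:
  "run w (Seq P R) s Q \<longleftrightarrow> run w P s (\<lambda>t s'. run w R s' (\<lambda>u. Q (t + u)))"
  unfolding run_def by (blast intro: exec.intros elim: exec_SeqE)

lemma run_Cond [simp]:
  "run w (Cond b P R) s Q \<longleftrightarrow> fits w b s \<and>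
     (if expr_val b s \<noteq> 0 then run w P s (\<lambda>t. Q (expr_cost b + 1 + t))
      else run w R s (\<lambda>t. Q (expr_cost b + 1 + t)))"
  unfolding run_def by (cases "expr_val b s = 0") (auto 0 5 intro: exec_simped elim!: exec_CondE)

lemma run_mono: "run w P s Q \<Longrightarrow> (\<And>t s'. Q t s' \<Longrightarrow> Q' t s') \<Longrightarrow> run w P s Q'"
  unfolding run_def by blast

lemma run_Loop_unfold:
  "fits w b s \<Longrightarrow> expr_val b s \<noteq> 0 \<Longrightarrow>
     run w P s (\<lambda>t s'. run w (Loop b P) s' (\<lambda>u. Q (expr_cost b + 1 + t + u))) \<Longrightarrow> run w (Loop b P) s Q"
  unfolding run_def by (blast intro: exec.intros)

lemma run_Loop_exit:
  "fits w b s \<Longrightarrow> expr_val b s = 0 \<Longrightarrow> Q (expr_cost b + 1) s \<Longrightarrow> run w (Loop b P) s Q"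
  unfolding run_def by (blast intro: exec.intros)

abbreviation Var :: "nat \<Rightarrow> expr" where "Var v \<equiv> Get v (Const 0)"
abbreviation Set :: "nat \<Rightarrow> expr \<Rightarrow> prog" where "Set v e \<equiv> Put v (Const 0) e"
abbreviation set_var :: "memory \<Rightarrow> nat \<Rightarrow> nat \<Rightarrow> memory" where
  "set_var s v x \<equiv> s(v := (s v)(0 := x))"

definition For :: "nat \<Rightarrow> expr \<Rightarrow> prog \<Rightarrow> prog" where
  "For v e P = Seq (Set v (Const 0))
     (Loop (Op Less (Var v) e) (Seq P (Set v (Op Plus (Var v) (Const 1)))))"

text \<open>\<open>expr_cost e + 10\<close> is the cost of one test and one increment. The bound
  \<open>e\<close> is evaluated anew in every round, so the invariant has to fix its value.\<close>

lemma run_For: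
  assumes I0: "I 0 (set_var s v 0)" and m: "m \<le> w" "1 \<le> w"
    and bound: "\<And>k s. k \<le> m \<Longrightarrow> I k s \<Longrightarrow> s v 0 = k \<and> fits w e s \<and> expr_val e s = m"
    and body: "\<And>k s. k < m \<Longrightarrow> I k s \<Longrightarrow>
       run w P s (\<lambda>t s'. t \<le> C \<and> s' v 0 = k \<and> I (Suc k) (set_var s' v (Suc k)))"
  shows "run w (For v e P) s (\<lambda>t s'. t \<le> m * (C + expr_cost e + 10) + expr_cost e + 10 \<and> I m s')"
proof -
  have loop: "run w (Loop (Op Less (Var v) e) (Seq P (Set v (Op Plus (Var v) (Const 1))))) s
      (\<lambda>t s'. t \<le> j * (C + expr_cost e + 10) + expr_cost e + 7 \<and> I m s')"
    if "j \<le> m" "I (m - j) s" for j s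
    using that
  proof (induction j arbitrary: s)
    case 0
    then show ?case using bound[of m s] m by (intro run_Loop_exit) auto
  next
    case (Suc j)
    have b: "s v 0 = m - Suc j" "fits w e s" "expr_val e s = m"
      using bound[OF _ Suc.prems(2)] by auto
    have lt: "m - Suc j < m" using Suc.prems by simp
    show ?case
    proof (rule run_Loop_unfold)
      show "fits w (Op Less (Var v) e) s" using b m by auto
      show "expr_val (Op Less (Var v) e) s \<noteq> 0" using b Suc.prems by auto
      show "run w (Seq P (Set v (Op Plus (Var v) (Const 1)))) s
        (\<lambda>t s'. run w (Loop (Op Less (Var v) e) (Seq P (Set v (Op Plus (Var v) (Const 1))))) s'
            (\<lambda>u s'. expr_cost (Op Less (Var v) e) + 1 + t + u
              \<le> Suc j * (C + expr_cost e + 10) + expr_cost e + 7 \<and> I m s'))"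
        unfolding run_Seq
      proof (rule run_mono[OF body[OF lt Suc.prems(2)]], goal_cases)
        case (1 t s')
        have "Suc (m - Suc j) = m - j" using Suc.prems by simp
        then have I: "I (m - j) (set_var s' v (m - j))" using 1 by simp
        have "run w (Loop (Op Less (Var v) e) (Seq P (Set v (Op Plus (Var v) (Const 1)))))
           (set_var s' v (m - j))
           (\<lambda>t s'. t \<le> j * (C + expr_cost e + 10) + expr_cost e + 7 \<and> I m s')"
          by (rule Suc.IH) (use I Suc.prems in linarith, fact I)
        then show ?case using 1 m Suc.prems
          by (auto elim!: run_mono simp: Suc_diff_Suc)
      qed
    qed
  qed
  show ?thesis unfolding For_def run_Seq run_Put
    using loop[of m "set_var s v 0"] I0 m by (auto elim!: run_mono)
qed

text \<open>Termination of a loop through finitely many iterations is composed from pieces.\<close>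

inductive iterates :: "nat \<Rightarrow> expr \<Rightarrow> prog \<Rightarrow> memory \<Rightarrow> nat \<Rightarrow> memory \<Rightarrow> bool" for w b P where
  stop: "iterates w b P s 0 s"
| step: "fits w b s \<Longrightarrow> expr_val b s \<noteq> 0 \<Longrightarrow> exec w P s t s' \<Longrightarrow> iterates w b P s' u s'' \<Longrightarrow>
    iterates w b P s (expr_cost b + 1 + t + u) s''"

lemma iterates_trans:
  "iterates w b P s t s' \<Longrightarrow> iterates w b P s' u s'' \<Longrightarrow> iterates w b P s (t + u) s''"
proof (induction rule: iterates.induct)
  case (step s t s' v s'')
  then show ?case
    using iterates.step[of w b s P t s' "v + u"] by (simp add: add.assoc)
qed simp

lemma iterates_exit:
  "iterates w b P s t s' \<Longrightarrow> fits w b s' \<Longrightarrow> expr_val b s' = 0 \<Longrightarrow>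
     exec w (Loop b P) s (t + (expr_cost b + 1)) s'"
proof (induction rule: iterates.induct)
  case (step s t s' v s'')
  then show ?case
    using exec.LoopTrue[of w b s P t s' "v + (expr_cost b + 1)"] by (simp add: add.assoc)
qed (use exec.LoopFalse in simp)

subsection \<open>Relocating a program\<close>

text \<open>A program relies on zero cells outside its input, so every call of the multiplication program
  gets fresh memory: array numbers are shifted by \<open>d\<close>, and addresses by the content of cell 0 of
  array \<open>v\<close>.\<close>

fun shift_expr :: "nat \<Rightarrow> nat \<Rightarrow> expr \<Rightarrow> expr" where
  "shift_expr d v (Const k) = Const k"
| "shift_expr d v (Get a e) = Get (a + d) (Op Plus (shift_expr d v e) (Var v))"
| "shift_expr d v (Op b e f) = Op b (shift_expr d v e) (shift_expr d v f)"

fun shift_prog :: "nat \<Rightarrow> nat \<Rightarrow> prog \<Rightarrow> prog" where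
  "shift_prog d v Skip = Skip"
| "shift_prog d v (Put a i e) = Put (a + d) (Op Plus (shift_expr d v i) (Var v)) (shift_expr d v e)"
| "shift_prog d v (Seq P Q) = Seq (shift_prog d v P) (shift_prog d v Q)"
| "shift_prog d v (Cond b P Q) = Cond (shift_expr d v b) (shift_prog d v P) (shift_prog d v Q)"
| "shift_prog d v (Loop b P) = Loop (shift_expr d v b) (shift_prog d v P)"

text \<open>The copy occupies all addresses from \<open>off\<close> on. What a run can really reach
  inside it is limited by \<open>exec_frame\<close>.\<close>

definition embeds :: "nat \<Rightarrow> nat \<Rightarrow> nat \<Rightarrow> memory \<Rightarrow> memory \<Rightarrow> bool" where
  "embeds d v off S s \<longleftrightarrow> S v 0 = off \<and> (\<forall>a i. S (a + d) (i + off) = s a i)"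

lemma fits_val: "fits w e s \<Longrightarrow> expr_val e s \<le> w"
  by (cases e) auto

lemma shift_expr_val: "embeds d v off S s \<Longrightarrow> expr_val (shift_expr d v e) S = expr_val e s"
  by (induction e) (auto simp: embeds_def)

lemma shift_expr_fits:
  "embeds d v off S s \<Longrightarrow> fits w e s \<Longrightarrow> w + off \<le> W \<Longrightarrow> fits W (shift_expr d v e) S"
  by (induction e) (auto simp: shift_expr_val dest: fits_val, auto simp: embeds_def dest: fits_val)

text \<open>A relocated \<open>Get\<close> adds 4 units where the original adds 1, because of the
  address computation.\<close>

lemma shift_expr_cost: "expr_cost (shift_expr d v e) \<le> 4 * expr_cost e"
  by (induction e) auto

text \<open>An address has to be computed and hence fits a word. Cells above the word bound are
  therefore still untouched after a call and can serve the next one.\<close>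

lemma exec_frame: "exec w P s t s' \<Longrightarrow> w < i \<Longrightarrow> s' a i = s a i"
  by (induction rule: exec.induct) (auto dest: fits_val)

text \<open>Simulation step by step. The word bound grows by \<open>off\<close>, since relocated
  addresses are computed as values.\<close>

lemma exec_shift:
  "exec w P s t s' \<Longrightarrow> embeds d v off S s \<Longrightarrow> v < d \<Longrightarrow> w + off \<le> W \<Longrightarrow>
     \<exists>T S'. exec W (shift_prog d v P) S T S' \<and> T \<le> 4 * t \<and> embeds d v off S' s' \<and>
       (\<forall>a<d. S' a = S a)"
proof (induction arbitrary: S rule: exec.induct)
  case (Skip s)
  then show ?case by (intro exI[of _ 1] exI[of _ S]) (auto intro: exec_simped)
next
  case (Put i s e a)
  let ?i = "Op Plus (shift_expr d v i) (Var v)" and ?e = "shift_expr d v e"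
  let ?S = "S(a + d := (S (a + d))(expr_val ?i S := expr_val ?e S))"
  have iv: "expr_val ?i S = expr_val i s + off" "expr_val ?e S = expr_val e s"
    using Put.prems by (auto simp: shift_expr_val embeds_def)
  have "exec W (shift_prog d v (Put a i e)) S (expr_cost ?i + expr_cost ?e + 1) ?S"
    using Put fits_val[OF Put.hyps(1)]
    by (simp only: shift_prog.simps, intro exec.Put)
      (auto simp: shift_expr_val embeds_def intro: shift_expr_fits)
  moreover have "embeds d v off ?S (s(a := (s a)(expr_val i s := expr_val e s)))"
    unfolding iv using Put.prems by (auto simp: embeds_def)
  moreover have "expr_cost ?i + expr_cost ?e + 1 \<le> 4 * (expr_cost i + expr_cost e + 1)"
    using shift_expr_cost[of d v i] shift_expr_cost[of d v e] by simp
  moreover have "\<forall>b<d. ?S b = S b" by simp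
  ultimately show ?case by blast
next
  case (Seq P s t s' Q u s'')
  obtain T S' where 1: "exec W (shift_prog d v P) S T S'" "T \<le> 4 * t" "embeds d v off S' s'"
    "\<forall>a<d. S' a = S a"
    using Seq.IH(1)[OF Seq.prems] by blast
  obtain U S'' where 2: "exec W (shift_prog d v Q) S' U S''" "U \<le> 4 * u" "embeds d v off S'' s''"
    "\<forall>a<d. S'' a = S' a"
    using Seq.IH(2)[OF 1(3) Seq.prems(2,3)] by blast
  from 1 2 show ?case
    by (intro exI[of _ "T + U"] exI[of _ S'']) (auto intro: exec.Seq)
next
  case (CondTrue b s P t s' Q)
  obtain T S' where 1: "exec W (shift_prog d v P) S T S'" "T \<le> 4 * t" "embeds d v off S' s'"
    "\<forall>a<d. S' a = S a"
    using CondTrue.IH[OF CondTrue.prems] by blast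
  have "exec W (shift_prog d v (Cond b P Q)) S (expr_cost (shift_expr d v b) + 1 + T) S'"
    unfolding shift_prog.simps using CondTrue 1
    by (intro exec.CondTrue) (auto intro: shift_expr_fits simp: shift_expr_val)
  with 1 show ?case using shift_expr_cost[of d v b]
    by (intro exI[of _ "expr_cost (shift_expr d v b) + 1 + T"] exI[of _ S']) auto
next
  case (CondFalse b s Q t s' P)
  obtain T S' where 1: "exec W (shift_prog d v Q) S T S'" "T \<le> 4 * t" "embeds d v off S' s'"
    "\<forall>a<d. S' a = S a"
    using CondFalse.IH[OF CondFalse.prems] by blast
  have "exec W (shift_prog d v (Cond b P Q)) S (expr_cost (shift_expr d v b) + 1 + T) S'"
    unfolding shift_prog.simps using CondFalse 1
    by (intro exec.CondFalse) (auto intro: shift_expr_fits simp: shift_expr_val)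
  with 1 show ?case using shift_expr_cost[of d v b]
    by (intro exI[of _ "expr_cost (shift_expr d v b) + 1 + T"] exI[of _ S']) auto
next
  case (LoopFalse b s P)
  have "exec W (shift_prog d v (Loop b P)) S (expr_cost (shift_expr d v b) + 1) S"
    using LoopFalse by (auto intro!: exec_simped shift_expr_fits simp: shift_expr_val)
  with LoopFalse show ?case using shift_expr_cost[of d v b]
    by (intro exI[of _ "expr_cost (shift_expr d v b) + 1"] exI[of _ S]) auto
next
  case (LoopTrue b s P t s' u s'')
  obtain T S' where 1: "exec W (shift_prog d v P) S T S'" "T \<le> 4 * t" "embeds d v off S' s'"
    "\<forall>a<d. S' a = S a"
    using LoopTrue.IH(1)[OF LoopTrue.prems] by blast
  obtain U S'' where 2: "exec W (shift_prog d v (Loop b P)) S' U S''" "U \<le> 4 * u" "embeds d v off S'' s''"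
    "\<forall>a<d. S'' a = S' a"
    using LoopTrue.IH(2)[OF 1(3) LoopTrue.prems(2,3)] by blast
  have "exec W (shift_prog d v (Loop b P)) S (expr_cost (shift_expr d v b) + 1 + T + U) S''"
    using LoopTrue 1 2 by (auto intro!: exec_simped shift_expr_fits simp: shift_expr_val)
  with 1 2 show ?case using shift_expr_cost[of d v b]
    by (intro exI[of _ "expr_cost (shift_expr d v b) + 1 + T + U"] exI[of _ S'']) auto
qed

lemma fits_mono: "fits w e s \<Longrightarrow> w \<le> W \<Longrightarrow> fits W e s"
  by (induction e) auto

lemma exec_mono: "exec w P s t s' \<Longrightarrow> w \<le> W \<Longrightarrow> exec W P s t s'"
  by (induction rule: exec.induct) (auto intro: exec_simped fits_mono)

text \<open>\<open>insens\<close> keeps both counters out of the invariant, so it survives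
  increments and resets; \<open>nxt\<close> identifies the end of one row with the start of the
  next.\<close>

lemma run_For2:
  assumes J0: "J 0 0 s" and m: "m \<le> w" "m' \<le> w" "1 \<le> w" and v: "v1 \<noteq> v2"
    and insens: "\<And>i j s x. J i j s \<Longrightarrow> J i j (set_var s v1 x) \<and> J i j (set_var s v2 x)"
    and bound: "\<And>i j s. J i j s \<Longrightarrow> fits w e1 s \<and> expr_val e1 s = m \<and> fits w e2 s \<and> expr_val e2 s = m'"
    and nxt: "\<And>i s. J i m' s \<Longrightarrow> J (Suc i) 0 s"
    and body: "\<And>i j s. i < m \<Longrightarrow> j < m' \<Longrightarrow> J i j s \<Longrightarrow> s v1 0 = i \<Longrightarrow> s v2 0 = j \<Longrightarrow>
       run w P s (\<lambda>t s'. t \<le> C \<and> s' v1 0 = i \<and> s' v2 0 = j \<and> J i (Suc j) s')"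
  shows "run w (For v1 e1 (For v2 e2 P)) s (\<lambda>t s'.
     t \<le> m * (m' * (C + expr_cost e2 + 10) + expr_cost e2 + 10 + expr_cost e1 + 10)
       + expr_cost e1 + 10 \<and> J m 0 s')"
proof -
  have inner: "run w (For v2 e2 P) s (\<lambda>t s'. t \<le> m' * (C + expr_cost e2 + 10) + expr_cost e2 + 10 \<and>
        s' v1 0 = i \<and> J i m' s')"
    if "i < m" "J i 0 s" "s v1 0 = i" for i s
  proof (rule run_mono, rule run_For[where I = "\<lambda>j s. J i j s \<and> s v1 0 = i \<and> s v2 0 = j" and m = m' and C = C])
    show "J i 0 (set_var s v2 0) \<and> set_var s v2 0 v1 0 = i \<and> set_var s v2 0 v2 0 = 0"
      using that insens v by simp
    show "run w P s' (\<lambda>t s'. t \<le> C \<and> s' v2 0 = k \<and> J i (Suc k) (set_var s' v2 (Suc k)) \<and>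
           set_var s' v2 (Suc k) v1 0 = i \<and> set_var s' v2 (Suc k) v2 0 = Suc k)"
      if "k < m'" "J i k s' \<and> s' v1 0 = i \<and> s' v2 0 = k" for k s'
      by (rule run_mono[OF body[OF \<open>i < m\<close> that(1)]]) (use that insens v in auto)
  qed (use bound m in auto)
  have "run w (For v1 e1 (For v2 e2 P)) s (\<lambda>t s'.
     t \<le> m * (m' * (C + expr_cost e2 + 10) + expr_cost e2 + 10 + expr_cost e1 + 10)
       + expr_cost e1 + 10 \<and> (J m 0 s' \<and> s' v1 0 = m))"
  proof (rule run_mono, rule run_For[where I = "\<lambda>i s. J i 0 s \<and> s v1 0 = i" and m = m
       and C = "m' * (C + expr_cost e2 + 10) + expr_cost e2 + 10"])
    show "run w (For v2 e2 P) s (\<lambda>t s'. t \<le> m' * (C + expr_cost e2 + 10) + expr_cost e2 + 10 \<and>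
        s' v1 0 = k \<and> J (Suc k) 0 (set_var s' v1 (Suc k)) \<and> set_var s' v1 (Suc k) v1 0 = Suc k)"
      if "k < m" "J k 0 s \<and> s v1 0 = k" for k s
      by (rule run_mono[OF inner[OF that(1)]]) (use that insens nxt in auto)
  qed (use J0 insens bound m in auto)
  then show ?thesis by (rule run_mono) auto
qed

definition agree_off :: "nat set \<Rightarrow> memory \<Rightarrow> memory \<Rightarrow> bool" where
  "agree_off X s s' \<longleftrightarrow> (\<forall>a. a \<notin> X \<longrightarrow> s a = s' a)"

lemma agree_offD: "agree_off X s s' \<Longrightarrow> a \<notin> X \<Longrightarrow> s a = s' a"
  by (simp add: agree_off_def)

lemma agree_off_refl [simp]: "agree_off X s s"
  by (simp add: agree_off_def)

text \<open>\<open>ev\<close> grants that the cell about to be written still has its original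
  content. This admits updates in place, as in \<open>add_prog\<close>.\<close>

lemma run_fill:
  assumes v: "v1 \<noteq> v2" "a \<noteq> v1" "a \<noteq> v2" and m: "m \<le> w" "m' \<le> w" "1 \<le> w"
    and bound: "\<And>s. agree_off {v1, v2, a} s s0 \<Longrightarrow>
       fits w e1 s \<and> expr_val e1 s = m \<and> fits w e2 s \<and> expr_val e2 s = m'"
    and inj: "\<And>i j i' j'. i < m \<Longrightarrow> j < m' \<Longrightarrow> i' < m \<Longrightarrow> j' < m' \<Longrightarrow> f i j = f i' j' \<Longrightarrow> i = i' \<and> j = j'"
    and ev: "\<And>i j s. i < m \<Longrightarrow> j < m' \<Longrightarrow> s v1 0 = i \<Longrightarrow> s v2 0 = j \<Longrightarrow> agree_off {v1, v2, a} s s0 \<Longrightarrow>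
       s a (f i j) = s0 a (f i j) \<Longrightarrow>
       fits w ie s \<and> fits w ve s \<and> expr_val ie s = f i j \<and> expr_val ve s = g i j"
  shows "run w (For v1 e1 (For v2 e2 (Put a ie ve))) s0 (\<lambda>t s.
     t \<le> m * (m' * (expr_cost ie + expr_cost ve + 1 + expr_cost e2 + 10) + expr_cost e2 + 10
         + expr_cost e1 + 10) + expr_cost e1 + 10 \<and>
     agree_off {v1, v2, a} s s0 \<and> (\<forall>i<m. \<forall>j<m'. s a (f i j) = g i j) \<and>
     (\<forall>x. (\<forall>i<m. \<forall>j<m'. x \<noteq> f i j) \<longrightarrow> s a x = s0 a x))"
proof -
  let ?before = "\<lambda>i j i' j'. i' < i \<or> i' = i \<and> j' < (j::nat)"
  let ?J = "\<lambda>i j s. agree_off {v1, v2, a} s s0 \<and>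
     (\<forall>i'<m. \<forall>j'<m'. s a (f i' j') = (if ?before i j i' j' then g i' j' else s0 a (f i' j'))) \<and>
     (\<forall>x. (\<forall>i<m. \<forall>j<m'. x \<noteq> f i j) \<longrightarrow> s a x = s0 a x)"
  show ?thesis
  proof (rule run_mono, rule run_For2[where J = ?J and m = m and m' = m' and C = "expr_cost ie + expr_cost ve + 1"])
    fix i j s assume a: "i < m" "j < m'" "?J i j s" "s v1 0 = i" "s v2 0 = j"
    then have e: "fits w ie s" "fits w ve s" "expr_val ie s = f i j" "expr_val ve s = g i j"
      using ev[of i j s] by auto
    let ?s = "s(a := (s a)(f i j := g i j))"
    have "?s a (f i' j') = (if ?before i (Suc j) i' j' then g i' j' else s0 a (f i' j'))"
      if "i' < m" "j' < m'" for i' j'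
    proof (cases "i' = i \<and> j' = j")
      case False
      then have "f i' j' \<noteq> f i j" using inj[of i' j' i j] that a(1,2) by blast
      moreover have "?before i (Suc j) i' j' \<longleftrightarrow> ?before i j i' j'" using False by auto
      ultimately show ?thesis using a(3) that by simp
    qed simp
    moreover have "agree_off {v1, v2, a} ?s s0" using a(3) by (auto simp: agree_off_def)
    moreover have "\<forall>x. (\<forall>i<m. \<forall>j<m'. x \<noteq> f i j) \<longrightarrow> ?s a x = s0 a x" using a by auto
    ultimately have "?J i (Suc j) ?s" by blast
    then show "run w (Put a ie ve) s (\<lambda>t s'. t \<le> expr_cost ie + expr_cost ve + 1 \<and> s' v1 0 = i \<and>
        s' v2 0 = j \<and> ?J i (Suc j) s')"
      using e a v by simp
  next
    fix i s assume a: "?J i m' s"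
    have "?before (Suc i) 0 i' j' \<longleftrightarrow> ?before i m' i' j'" if "j' < m'" for i' j'
      using that by auto
    then show "?J (Suc i) 0 s" using a by simp
  next
    fix t s assume "t \<le> m * (m' * (expr_cost ie + expr_cost ve + 1 + expr_cost e2 + 10) + expr_cost e2 + 10
        + expr_cost e1 + 10) + expr_cost e1 + 10 \<and> ?J m 0 s"
    then show "t \<le> m * (m' * (expr_cost ie + expr_cost ve + 1 + expr_cost e2 + 10) + expr_cost e2 + 10
         + expr_cost e1 + 10) + expr_cost e1 + 10 \<and>
     agree_off {v1, v2, a} s s0 \<and> (\<forall>i<m. \<forall>j<m'. s a (f i j) = g i j) \<and>
     (\<forall>x. (\<forall>i<m. \<forall>j<m'. x \<noteq> f i j) \<longrightarrow> s a x = s0 a x)" by simp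
  qed (use v m bound in \<open>auto simp: agree_off_def\<close>)
qed

lemma mult_add_inj:
  "j < (n::nat) \<Longrightarrow> j' < n \<Longrightarrow> i * n + j = i' * n + j' \<longleftrightarrow> i = i' \<and> j = j'"
proof
  assume "j < n" "j' < n" and e: "i * n + j = i' * n + j'"
  have "(i * n + j) div n = i" "(i' * n + j') div n = i'"
    using \<open>j < n\<close> \<open>j' < n\<close> by auto
  then have "i = i'" by (simp add: e)
  with e show "i = i' \<and> j = j'" by simp
qed simp

lemma mult_add_less: "i < m \<Longrightarrow> j < (n::nat) \<Longrightarrow> i * n + j < m * n"
proof -
  assume a: "i < m" "j < n"
  have "i * n + j < i * n + n" using a by simp
  also have "\<dots> = Suc i * n" by simp
  also have "\<dots> \<le> m * n" using a by (intro mult_le_mono1) simp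
  finally show ?thesis .
qed

subsection \<open>Calling the multiplication program\<close>

lemma bit_nat_add: "(bit_nat x + bit_nat y) mod 2 = bit_nat (x + y)"
  by (cases x; cases y) (auto simp: bit_nat_def)

lemma bit_nat_simps [simp]: "bit_nat 0 = 0" "bit_nat 1 = 1" "bit_nat (of_bool b) = of_bool b"
  "bit_nat x = 0 \<longleftrightarrow> x = 0" "bit_nat x \<le> 1"
  by (cases x; auto simp: bit_nat_def)+

lemma row_major_conv:
  assumes "A \<in> carrier_mat m m"
  shows "length (row_major A) = m * m" "i < m \<Longrightarrow> j < m \<Longrightarrow> row_major A ! (i * m + j) = bit_nat (A $$ (i, j))"
proof -
  let ?f = "\<lambda>i. map (\<lambda>j. bit_nat (A $$ (i, j))) [0..<m]"
  have rm: "row_major A = concat (map ?f [0..<m])" using assms by (simp add: row_major_def)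
  have len: "length (concat (map ?f [0..<k])) = k * m" for k
    by (induction k) auto
  then show "length (row_major A) = m * m" by (simp add: rm)
  assume ij: "i < m" "j < m"
  have "concat (map ?f [0..<k]) ! (i * m + j) = bit_nat (A $$ (i, j))" if "i < k" for k
    using that
  proof (induction k)
    case (Suc k)
    show ?case
    proof (cases "i = k")
      case True
      then show ?thesis using ij by (simp add: nth_append len)
    next
      case False
      then have "i * m + j < k * m" using Suc.prems ij by (intro mult_add_less) auto
      then show ?thesis using Suc False by (simp add: nth_append len)
    qed
  qed simp
  then show "row_major A ! (i * m + j) = bit_nat (A $$ (i, j))" using ij by (simp add: rm)
qed

definition multiplies :: "prog \<Rightarrow> nat \<Rightarrow> (nat \<Rightarrow> nat) \<Rightarrow> bool" where
  "multiplies P c time \<longleftrightarrow> (\<forall>m. \<forall>A \<in> carrier_mat m m. \<forall>B \<in> carrier_mat m m.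
     halts_within ((m + 2) ^ c) P [[m], row_major A, row_major B] (time m)
       (\<lambda>s. \<forall>i < m. \<forall>j < m. s 3 (i * m + j) = bit_nat ((A * B) $$ (i, j))))"

text \<open>The exponent is \<open>c + 2\<close> instead of \<open>c\<close> so that the reserved
  range also contains the \<open>m * m\<close> input entries, which the word bound of the given
  program need not exceed.\<close>

lemma run_multiplication:
  fixes S :: memory
  assumes P: "multiplies P c time" and d: "v < d" and off: "S v 0 = off"
    and W: "(m + 2) ^ (c + 2) + off \<le> W"
    and m: "S d off = m"
    and A: "\<And>i j. i < m \<Longrightarrow> j < m \<Longrightarrow> S (d + 1) (off + (i * m + j)) = bit_nat (A i j)"
    and B: "\<And>i j. i < m \<Longrightarrow> j < m \<Longrightarrow> S (d + 2) (off + (i * m + j)) = bit_nat (B i j)"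
    and z: "\<And>a x. off \<le> x \<Longrightarrow> d \<le> a \<Longrightarrow> \<not> (a = d \<and> x = off) \<Longrightarrow>
       \<not> ((a = d + 1 \<or> a = d + 2) \<and> x < off + m * m) \<Longrightarrow> S a x = 0"
  shows "run W (shift_prog d v P) S (\<lambda>t S'. t \<le> 4 * time m \<and> (\<forall>a<d. S' a = S a) \<and>
     (\<forall>i<m. \<forall>j<m. S' (d + 3) (off + (i * m + j)) = bit_nat (\<Sum>k<m. A i k * B k j)) \<and>
     (\<forall>a x. d \<le> a \<longrightarrow> off + (m + 2) ^ (c + 2) < x \<longrightarrow> S' a x = 0))"
proof -
  let ?A = "mat m m (\<lambda>(i, j). A i j)" and ?B = "mat m m (\<lambda>(i, j). B i j)"
  let ?xss = "[[m], row_major ?A, row_major ?B]"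
  have len: "length (row_major ?A) = m * m" "length (row_major ?B) = m * m"
    by (simp_all add: row_major_conv[of _ m])
  have nthA: "row_major ?A ! (i * m + j) = bit_nat (A i j)"
    and nthB: "row_major ?B ! (i * m + j) = bit_nat (B i j)" if "i < m" "j < m" for i j
    using that by (simp_all add: row_major_conv[of _ m])
  obtain t s where ex: "exec ((m + 2) ^ c) P (load ?xss) t s" "t \<le> time m"
    and s: "\<And>i j. i < m \<Longrightarrow> j < m \<Longrightarrow> s 3 (i * m + j) = bit_nat ((?A * ?B) $$ (i, j))"
    using P unfolding multiplies_def halts_within_def by (meson mat_carrier)
  have "(m + 2) ^ c \<le> (m + 2) ^ (c + 2)" by (intro power_increasing) auto
  note ex' = exec_mono[OF ex(1) this]
  have "S (a + d) (i + off) = load ?xss a i" for a i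
  proof -
    consider "a = 0" "i = 0" | "a = 0" "i \<noteq> 0" | "a = 1 \<or> a = 2" "i < m * m"
      | "a = 1 \<or> a = 2" "\<not> i < m * m" | "2 < a" by linarith
    then show ?thesis
    proof cases
      case 3
      \<comment> \<open>The position in the row-major list is split into row and column by division
        with remainder.\<close>
      then have "m > 0" by (cases m) auto
      define p q where "p = i div m" and "q = i mod m"
      have pq: "p < m" "q < m" "i = p * m + q"
        using 3 \<open>m > 0\<close> by (auto simp: p_def q_def less_mult_imp_div_less)
      then show ?thesis using 3 A[of p q] B[of p q]
        by (auto simp: load_def len nthA nthB add.commute[of _ off])
    next
      case 4
      then show ?thesis using z[of "i + off" "a + d"] by (auto simp: load_def len)
    next
      case 1
      then show ?thesis using m by (simp add: load_def)
    next
      case 2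
      then show ?thesis using z[of "i + off" "a + d"] by (simp add: load_def)
    next
      case 5
      then show ?thesis using z[of "i + off" "a + d"] by (simp add: load_def)
    qed
  qed
  then have emb: "embeds d v off S (load ?xss)" using off by (simp add: embeds_def)
  obtain T S' where 1: "exec W (shift_prog d v P) S T S'" "T \<le> 4 * t" "embeds d v off S' s" "\<forall>a<d. S' a = S a"
    using exec_shift[OF ex' emb d W] by blast
  have "S' (d + 3) (off + (i * m + j)) = bit_nat (\<Sum>k<m. A i k * B k j)" if "i < m" "j < m" for i j
  proof -
    have "S' (3 + d) ((i * m + j) + off) = s 3 (i * m + j)" using 1(3) unfolding embeds_def by blast
    then show ?thesis using s[OF that] that
      by (simp add: add.commute scalar_prod_def lessThan_atLeast0)
  qed
  moreover have "S' a x = 0" if "d \<le> a" "off + (m + 2) ^ (c + 2) < x" for a x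
  proof -
    have S1: "S' (a - d + d) (x - off + off) = s (a - d) (x - off)" using 1(3) unfolding embeds_def by blast
    have S2: "s (a - d) (x - off) = load ?xss (a - d) (x - off)"
      using that by (intro exec_frame[OF ex']) auto
    have mm: "m * m \<le> (m + 2) ^ (c + 2)"
    proof -
      have "m * m \<le> (m + 2) ^ 2" by (simp add: power2_eq_square)
      also have "\<dots> \<le> (m + 2) ^ (c + 2)" by (intro power_increasing) auto
      finally show ?thesis .
    qed
    then have "load ?xss (a - d) (x - off) = 0" using that
      by (cases "a - d"; cases "a - d - 1"; cases "a - d - 2") (simp_all add: load_def len)
    then show ?thesis using S1 S2 that by simp
  qed
  ultimately show ?thesis unfolding run_def using 1 ex(2) by (intro exI[of _ T] exI[of _ S']) auto
qed

section \<open>Block elimination on the machine\<close>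

abbreviation runs :: "nat \<Rightarrow> prog \<Rightarrow> memory \<Rightarrow> nat \<Rightarrow> (memory \<Rightarrow> bool) \<Rightarrow> bool" where
  "runs w P s b Q \<equiv> run w P s (\<lambda>t s'. t \<le> b \<and> Q s')"

lemma runs_Seq:
  "runs w P s a Q \<Longrightarrow> (\<And>s'. Q s' \<Longrightarrow> runs w R s' b Q') \<Longrightarrow> runs w (Seq P R) s (a + b) Q'"
  unfolding run_Seq
proof (erule run_mono, goal_cases)
  case (1 t s')
  then have "runs w R s' b Q'" by blast
  then show ?case by (rule run_mono) (use 1 in auto)
qed

lemma runs_mono: "runs w P s a Q \<Longrightarrow> a \<le> b \<Longrightarrow> (\<And>s'. Q s' \<Longrightarrow> Q' s') \<Longrightarrow> runs w P s b Q'"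
  by (erule run_mono) auto

abbreviation (input) plus_expr (infixl "+e" 65) where "plus_expr \<equiv> Op Plus"
abbreviation (input) minus_expr (infixl "-e" 65) where "minus_expr \<equiv> Op Minus"
abbreviation (input) times_expr (infixl "*e" 70) where "times_expr \<equiv> Op Times"
abbreviation (input) mod_expr (infixl "mode" 70) where "mod_expr \<equiv> Op Modulo"
abbreviation (input) less_expr (infix "<e" 50) where "less_expr \<equiv> Op Less"
abbreviation (input) equal_expr (infix "=e" 50) where "equal_expr \<equiv> Op Equal"

text \<open>Scalars live in cell 0 of their array: \<open>aN\<close> is the padded matrix size, \<open>aT\<close> the next column,
  \<open>aB\<close> the block size, \<open>aP\<close> and \<open>aQ\<close> the first columns of the source and the target block, \<open>aO\<close> the
  start of the unused memory for calls and \<open>aD\<close> the length reserved per call.  Array \<open>aM\<close> holds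
  the matrix, \<open>aU\<close> marks the used rows, \<open>aV\<close> holds the pivot rows of the columns (shifted by one, 0
  if there is none), \<open>aS\<close> saved pivot rows, and \<open>aL\<close> the component labels of the vertices.  The
  arrays from \<open>dM\<close> on belong to the called program.\<close>

abbreviation (input) "aN \<equiv> 8 :: nat"
abbreviation (input) "aT \<equiv> 9 :: nat"
abbreviation (input) "aB \<equiv> 10 :: nat"
abbreviation (input) "aO \<equiv> 11 :: nat"
abbreviation (input) "aD \<equiv> 12 :: nat"
abbreviation (input) "aR \<equiv> 13 :: nat"
abbreviation (input) "aI \<equiv> 14 :: nat"
abbreviation (input) "aJ \<equiv> 15 :: nat"
abbreviation (input) "aK \<equiv> 16 :: nat"
abbreviation (input) "aP \<equiv> 17 :: nat"
abbreviation (input) "aQ \<equiv> 18 :: nat"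
abbreviation (input) "aM \<equiv> 20 :: nat"
abbreviation (input) "aU \<equiv> 21 :: nat"
abbreviation (input) "aV \<equiv> 22 :: nat"
abbreviation (input) "aS \<equiv> 23 :: nat"
abbreviation (input) "aL \<equiv> 24 :: nat"
abbreviation (input) "dM \<equiv> 40 :: nat"

definition pcode :: "nat option \<Rightarrow> nat" where
  "pcode x = (case x of None \<Rightarrow> 0 | Some r \<Rightarrow> Suc r)"

definition holds_matrix :: "nat \<Rightarrow> memory \<Rightarrow> (nat \<Rightarrow> nat \<Rightarrow> bit) \<Rightarrow> bool" where
  "holds_matrix N s B \<longleftrightarrow> (\<forall>i<N. \<forall>x<N. s aM (i * N + x) = bit_nat (B i x))"

definition fresh :: "memory \<Rightarrow> nat \<Rightarrow> bool" where
  "fresh s off \<longleftrightarrow> (\<forall>a x. dM \<le> a \<longrightarrow> off \<le> x \<longrightarrow> s a x = 0)"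

text \<open>A column without pivot is saved as a zero row: the comparison makes the product 0, and
  truncated subtraction keeps the address valid.\<close>

definition save_prog :: prog where
  "save_prog = For aI (Var aB) (For aJ (Var aB)
     (Put aS (Var aI *e Var aB +e Var aJ)
       ((Const 0 <e Get aV (Var aP +e Var aI)) *e
        Get aM ((Get aV (Var aP +e Var aI) -e Const 1) *e Var aN +e (Var aQ +e Var aJ)))))"

text \<open>The left factor consists of the coefficients \<open>coef\<close>: the block column plus
  the unit vector of its pivot row. \<open>aV\<close> is shifted by one, hence the comparison with
  the row number plus 1.\<close>

definition left_prog :: prog where
  "left_prog = For aI (Var aB) (For aJ (Var aB)
     (Put (dM + 1) (Var aO +e (Var aI *e Var aB +e Var aJ))
       ((Const 0 <e Get aV (Var aP +e Var aJ)) *e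
         ((Get aM ((Var aK *e Var aB +e Var aI) *e Var aN +e (Var aP +e Var aJ)) +e
           ((Var aK *e Var aB +e Var aI) +e Const 1 =e Get aV (Var aP +e Var aJ))) mode Const 2))))"

definition right_prog :: prog where
  "right_prog = For aI (Var aB) (For aJ (Var aB)
     (Put (dM + 2) (Var aO +e (Var aI *e Var aB +e Var aJ)) (Get aS (Var aI *e Var aB +e Var aJ))))"

definition add_prog :: prog where
  "add_prog = For aI (Var aB) (For aJ (Var aB)
     (Put aM ((Var aK *e Var aB +e Var aI) *e Var aN +e (Var aQ +e Var aJ))
       ((Get aM ((Var aK *e Var aB +e Var aI) *e Var aN +e (Var aQ +e Var aJ)) +e
         Get (dM + 3) (Var aO +e (Var aI *e Var aB +e Var aJ))) mode Const 2)))"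

text \<open>The called program finds its three input arrays in \<open>dM\<close>,
  \<open>dM + 1\<close> and \<open>dM + 2\<close> from address \<open>aO\<close> on and leaves the
  product in \<open>dM + 3\<close>. Afterwards the range is abandoned by advancing
  \<open>aO\<close>.\<close>

definition chunk_prog :: "prog \<Rightarrow> prog" where
  "chunk_prog P = Seq (Put dM (Var aO) (Var aB)) (Seq left_prog (Seq right_prog
     (Seq (shift_prog dM aO P) (Seq add_prog (Set aO (Var aO +e Var aD))))))"

text \<open>The target columns in the pivot rows are saved beforehand, because the products for the bands of
  \<open>aB\<close> rows need their old values.\<close>

definition update_prog :: "prog \<Rightarrow> prog" where
  "update_prog P = Seq save_prog (For aK (Op Divide (Var aN) (Var aB)) (chunk_prog P))"

lemma sq_le:
  assumes "b \<le> (N::nat)" "i < b" "j < b"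
  shows "i * b + j < N * N" "i * b < N * N"
proof -
  have "i * b + j < b * b" using assms by (intro mult_add_less) auto
  also have "\<dots> \<le> N * N" using assms by (intro mult_le_mono) auto
  finally show "i * b + j < N * N" .
  then show "i * b < N * N" by simp
qed

text \<open>The bound of \<open>run_fill\<close> for two loop bounds of cost 2; the constant 100
  covers the bodies of all four block loops.\<close>

definition fill_time :: "nat \<Rightarrow> nat" where
  "fill_time b = b * (b * 100 + 24) + 12"

text \<open>\<open>stride\<close> is taken for the full size \<open>N\<close>, so one fixed distance
  suffices for calls with blocks of any size.\<close>

locale machine =
  fixes P :: prog and c :: nat and time :: "nat \<Rightarrow> nat" and N W stride :: nat
  assumes P: "multiplies P c time" and N1: "1 \<le> N"
    and W: "4 * (N * N) + 10 \<le> W" and stride: "stride = (N + 2) ^ (c + 2) + 1"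
begin

lemma NW: "4 * N + 10 \<le> W"
  using W N1 order_trans[of "4 * N + 10" "4 * (N * N) + 10" W] by simp

lemma run_save:
  assumes s: "s aN 0 = N" "s aB 0 = b" "s aP 0 = p" "s aQ 0 = q"
    and b: "1 \<le> b" "p + b \<le> N" "q + b \<le> N"
    and M: "holds_matrix N s B" and V: "\<And>x. x < N \<Longrightarrow> s aV x = pcode (pvf x)"
    and pvf: "\<And>x r. x < N \<Longrightarrow> pvf x = Some r \<Longrightarrow> r < N"
  shows "runs W save_prog s (fill_time b) (\<lambda>s'. agree_off {aI, aJ, aS} s' s \<and>
     (\<forall>i<b. \<forall>j<b. s' aS (i * b + j) = bit_nat (of_bool (pvf (p + i) \<noteq> None) * B (the (pvf (p + i))) (q + j))))"
  unfolding save_prog_def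
proof (rule runs_mono, rule run_fill[where m = b and m' = b and f = "\<lambda>i j. i * b + j"
      and g = "\<lambda>i j. bit_nat (of_bool (pvf (p + i) \<noteq> None) * B (the (pvf (p + i))) (q + j))"])
  fix s1 i j assume ij: "i < b" "j < b" "s1 aI 0 = i" "s1 aJ 0 = j" "agree_off {aI, aJ, aS} s1 s"
  have le: "i * b + j < N * N" "i * b < N * N" using ij b by (auto intro!: sq_le)
  define v where "v = s aV (p + i)"
  have v: "v = pcode (pvf (p + i))" using V[of "p + i"] ij b by (simp add: v_def)
  have v1: "v - Suc 0 < N" "v \<le> N" using v pvf[of "p + i"] ij b N1 by (auto simp: pcode_def split: option.splits)
  have le2: "(v - Suc 0) * N + (q + j) < N * N" using v1 ij b by (intro mult_add_less) auto
  have m: "s aM ((v - Suc 0) * N + (q + j)) = bit_nat (B (v - Suc 0) (q + j))"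
    using M v1 ij b by (auto simp: holds_matrix_def)
  have g: "of_bool (0 < v) * bit_nat (B (v - Suc 0) (q + j))
     = bit_nat (of_bool (pvf (p + i) \<noteq> None) * B (the (pvf (p + i))) (q + j))"
    by (auto simp: v pcode_def split: option.splits)
  have m1: "bit_nat x \<le> W" "of_bool (0 < v) * bit_nat x \<le> W" for x
    using W bit_nat_simps(5)[of x] by (auto simp: of_bool_def intro: order_trans[OF bit_nat_simps(5)])
  show "fits W (Var aI *e Var aB +e Var aJ) s1 \<and>
     fits W ((Const 0 <e Get aV (Var aP +e Var aI)) *e
        Get aM ((Get aV (Var aP +e Var aI) -e Const 1) *e Var aN +e (Var aQ +e Var aJ))) s1 \<and>
     expr_val (Var aI *e Var aB +e Var aJ) s1 = i * b + j \<and>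
     expr_val ((Const 0 <e Get aV (Var aP +e Var aI)) *e
        Get aM ((Get aV (Var aP +e Var aI) -e Const 1) *e Var aN +e (Var aQ +e Var aJ))) s1
     = bit_nat (of_bool (pvf (p + i) \<noteq> None) * B (the (pvf (p + i))) (q + j))"
    using ij(1,2) b le le2 v1 W NW m1
    by (simp add: agree_offD[OF ij(5)] ij(3,4) s v_def[symmetric] m g)
next
  show "b * (b * (expr_cost (Var aI *e Var aB +e Var aJ) + expr_cost ((Const 0 <e Get aV (Var aP +e Var aI)) *e
        Get aM ((Get aV (Var aP +e Var aI) -e Const 1) *e Var aN +e (Var aQ +e Var aJ))) + 1 +
        expr_cost (Var aB) + 10) + expr_cost (Var aB) + 10 + expr_cost (Var aB) + 10)
        + expr_cost (Var aB) + 10 \<le> fill_time b"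
    by (simp add: fill_time_def)
qed (use s b W NW in \<open>auto simp: mult_add_inj agree_off_def\<close>)

lemma bit_W: "bit_nat x \<le> W" "of_bool a * bit_nat x \<le> W" "of_bool a \<le> W"
  using W bit_nat_simps(5)[of x] by (auto simp: of_bool_def intro: order_trans[OF bit_nat_simps(5)])

lemma run_left:
  assumes s: "s aN 0 = N" "s aB 0 = b" "s aP 0 = p" "s aK 0 = k" "s aO 0 = off"
    and b: "1 \<le> b" "p + b \<le> N" "k * b + b \<le> N"
    and off: "off + N * N \<le> W"
    and M: "holds_matrix N s B" and V: "\<And>x. x < N \<Longrightarrow> s aV x = pcode (pvf x)"
    and pvf: "\<And>x r. x < N \<Longrightarrow> pvf x = Some r \<Longrightarrow> r < N"
  shows "runs W left_prog s (fill_time b) (\<lambda>s'. agree_off {aI, aJ, dM + 1} s' s \<and>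
     (\<forall>i<b. \<forall>j<b. s' (dM + 1) (off + (i * b + j)) = bit_nat (of_bool (pvf (p + j) \<noteq> None) *
        (B (k * b + i) (p + j) + of_bool (k * b + i = the (pvf (p + j)))))) \<and>
     (\<forall>x. (\<forall>i<b. \<forall>j<b. x \<noteq> off + (i * b + j)) \<longrightarrow> s' (dM + 1) x = s (dM + 1) x))"
  unfolding left_prog_def
proof (rule runs_mono, rule run_fill[where m = b and m' = b and f = "\<lambda>i j. off + (i * b + j)"
      and g = "\<lambda>i j. bit_nat (of_bool (pvf (p + j) \<noteq> None) *
        (B (k * b + i) (p + j) + of_bool (k * b + i = the (pvf (p + j)))))"])
  fix s1 i j assume ij: "i < b" "j < b" "s1 aI 0 = i" "s1 aJ 0 = j" "agree_off {aI, aJ, dM + 1} s1 s"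
  have le: "i * b + j < N * N" "i * b < N * N" using ij b by (auto intro!: sq_le)
  define v where "v = s aV (p + j)"
  have v: "v = pcode (pvf (p + j))" using V[of "p + j"] ij b by (simp add: v_def)
  have v1: "v \<le> N" using v pvf[of "p + j"] ij b N1 by (auto simp: pcode_def split: option.splits)
  have le2: "(k * b + i) * N + (p + j) < N * N" using ij b by (intro mult_add_less) auto
  have m: "s aM ((k * b + i) * N + (p + j)) = bit_nat (B (k * b + i) (p + j))"
    using M ij b by (auto simp: holds_matrix_def)
  have g: "of_bool (0 < v) * ((bit_nat (B (k * b + i) (p + j)) + of_bool (Suc (k * b + i) = v)) mod 2)
     = bit_nat (of_bool (pvf (p + j) \<noteq> None) *
        (B (k * b + i) (p + j) + of_bool (k * b + i = the (pvf (p + j)))))"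
    using bit_nat_add[of "B (k * b + i) (p + j)" "of_bool (Suc (k * b + i) = v)"]
    by (auto simp: v pcode_def split: option.splits)
  have kW: "k \<le> W" using b NW order_trans[of k "k * b" N] by auto
  have m1: "bit_nat x + of_bool a \<le> W" "(bit_nat x + of_bool a) mod 2 \<le> W" for x a
    using W bit_nat_simps(5)[of x] by (auto simp: of_bool_def)
  show "fits W (Var aO +e (Var aI *e Var aB +e Var aJ)) s1 \<and>
     fits W ((Const 0 <e Get aV (Var aP +e Var aJ)) *e
         ((Get aM ((Var aK *e Var aB +e Var aI) *e Var aN +e (Var aP +e Var aJ)) +e
           ((Var aK *e Var aB +e Var aI) +e Const 1 =e Get aV (Var aP +e Var aJ))) mode Const 2)) s1 \<and>
     expr_val (Var aO +e (Var aI *e Var aB +e Var aJ)) s1 = off + (i * b + j) \<and>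
     expr_val ((Const 0 <e Get aV (Var aP +e Var aJ)) *e
         ((Get aM ((Var aK *e Var aB +e Var aI) *e Var aN +e (Var aP +e Var aJ)) +e
           ((Var aK *e Var aB +e Var aI) +e Const 1 =e Get aV (Var aP +e Var aJ))) mode Const 2)) s1
     = bit_nat (of_bool (pvf (p + j) \<noteq> None) *
        (B (k * b + i) (p + j) + of_bool (k * b + i = the (pvf (p + j)))))"
    unfolding g[symmetric] using ij(1,2) b le le2 v1 W NW off m1 bit_W kW
    by (simp add: agree_offD[OF ij(5)] ij(3,4) s v_def[symmetric] m del: bit_nat_simps)
qed (use s b NW N1 in \<open>auto simp: mult_add_inj agree_off_def fill_time_def\<close>)

lemma run_right:
  assumes s: "s aB 0 = b" "s aO 0 = off"
    and b: "1 \<le> b" "b \<le> N" and off: "off + N * N \<le> W"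
    and Q: "\<And>i j. i < b \<Longrightarrow> j < b \<Longrightarrow> s aS (i * b + j) = bit_nat (Q i j)"
  shows "runs W right_prog s (fill_time b) (\<lambda>s'. agree_off {aI, aJ, dM + 2} s' s \<and>
     (\<forall>i<b. \<forall>j<b. s' (dM + 2) (off + (i * b + j)) = bit_nat (Q i j)) \<and>
     (\<forall>x. (\<forall>i<b. \<forall>j<b. x \<noteq> off + (i * b + j)) \<longrightarrow> s' (dM + 2) x = s (dM + 2) x))"
  unfolding right_prog_def
proof (rule runs_mono, rule run_fill[where m = b and m' = b and f = "\<lambda>i j. off + (i * b + j)"
      and g = "\<lambda>i j. bit_nat (Q i j)"])
  fix s1 i j assume ij: "i < b" "j < b" "s1 aI 0 = i" "s1 aJ 0 = j" "agree_off {aI, aJ, dM + 2} s1 s"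
  have le: "i * b + j < N * N" "i * b < N * N" using ij b by (auto intro!: sq_le)
  show "fits W (Var aO +e (Var aI *e Var aB +e Var aJ)) s1 \<and>
     fits W (Get aS (Var aI *e Var aB +e Var aJ)) s1 \<and>
     expr_val (Var aO +e (Var aI *e Var aB +e Var aJ)) s1 = off + (i * b + j) \<and>
     expr_val (Get aS (Var aI *e Var aB +e Var aJ)) s1 = bit_nat (Q i j)"
    using ij(1,2) b le W NW off bit_W
    by (simp add: agree_offD[OF ij(5)] ij(3,4) s Q del: bit_nat_simps)
qed (use s b NW N1 in \<open>auto simp: mult_add_inj agree_off_def fill_time_def\<close>)

lemma run_add:
  assumes s: "s aN 0 = N" "s aB 0 = b" "s aQ 0 = q" "s aK 0 = k" "s aO 0 = off"
    and b: "1 \<le> b" "q + b \<le> N" "k * b + b \<le> N" and off: "off + N * N \<le> W"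
    and M: "holds_matrix N s B"
    and C: "\<And>i j. i < b \<Longrightarrow> j < b \<Longrightarrow> s (dM + 3) (off + (i * b + j)) = bit_nat (C i j)"
  shows "runs W add_prog s (fill_time b) (\<lambda>s'. agree_off {aI, aJ, aM} s' s \<and>
     holds_matrix N s' (\<lambda>i x. if k * b \<le> i \<and> i < k * b + b \<and> q \<le> x \<and> x < q + b
       then B i x + C (i - k * b) (x - q) else B i x))"
  unfolding add_prog_def
proof (rule runs_mono, rule run_fill[where m = b and m' = b and f = "\<lambda>i j. (k * b + i) * N + (q + j)"
      and g = "\<lambda>i j. bit_nat (B (k * b + i) (q + j) + C i j)"])
  fix s1 i j assume ij: "i < b" "j < b" "s1 aI 0 = i" "s1 aJ 0 = j" "agree_off {aI, aJ, aM} s1 s"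
    "s1 aM ((k * b + i) * N + (q + j)) = s aM ((k * b + i) * N + (q + j))"
  have le: "i * b + j < N * N" "i * b < N * N" using ij b by (auto intro!: sq_le)
  have le2: "(k * b + i) * N + (q + j) < N * N" using ij b by (intro mult_add_less) auto
  have m: "s aM ((k * b + i) * N + (q + j)) = bit_nat (B (k * b + i) (q + j))"
    using M ij b by (auto simp: holds_matrix_def)
  have kW: "k \<le> W" using b NW order_trans[of k "k * b" N] by auto
  have m1: "bit_nat x + bit_nat a \<le> W" "(bit_nat x + bit_nat a) mod 2 \<le> W" for x a
    using W bit_nat_simps(5)[of x] bit_nat_simps(5)[of a] by linarith+
  show "fits W ((Var aK *e Var aB +e Var aI) *e Var aN +e (Var aQ +e Var aJ)) s1 \<and>
     fits W ((Get aM ((Var aK *e Var aB +e Var aI) *e Var aN +e (Var aQ +e Var aJ)) +e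
         Get (dM + 3) (Var aO +e (Var aI *e Var aB +e Var aJ))) mode Const 2) s1 \<and>
     expr_val ((Var aK *e Var aB +e Var aI) *e Var aN +e (Var aQ +e Var aJ)) s1 = (k * b + i) * N + (q + j) \<and>
     expr_val ((Get aM ((Var aK *e Var aB +e Var aI) *e Var aN +e (Var aQ +e Var aJ)) +e
         Get (dM + 3) (Var aO +e (Var aI *e Var aB +e Var aJ))) mode Const 2) s1
     = bit_nat (B (k * b + i) (q + j) + C i j)"
    unfolding bit_nat_add[symmetric] using ij(1,2) b le le2 W NW off m1 bit_W kW C[OF ij(1,2)]
    by (simp add: agree_offD[OF ij(5)] ij(3,4,6) s m del: bit_nat_simps)
next
  fix i j i' j' assume "i < b" "j < b" "i' < b" "j' < b"
    "(k * b + i) * N + (q + j) = (k * b + i') * N + (q + j')"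
  then show "i = i' \<and> j = j'" using b mult_add_inj[of "q + j" N "q + j'" "k * b + i" "k * b + i'"] by auto
next
  fix s1 assume a: "agree_off {aI, aJ, aM} s1 s \<and>
    (\<forall>i<b. \<forall>j<b. s1 aM ((k * b + i) * N + (q + j)) = bit_nat (B (k * b + i) (q + j) + C i j)) \<and>
    (\<forall>x. (\<forall>i<b. \<forall>j<b. x \<noteq> (k * b + i) * N + (q + j)) \<longrightarrow> s1 aM x = s aM x)"
  have "s1 aM (i * N + x) = bit_nat (if k * b \<le> i \<and> i < k * b + b \<and> q \<le> x \<and> x < q + b
       then B i x + C (i - k * b) (x - q) else B i x)" if "i < N" "x < N" for i x
  proof (cases "k * b \<le> i \<and> i < k * b + b \<and> q \<le> x \<and> x < q + b")
    case True
    then have "i - k * b < b" "x - q < b" by auto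
    then have "s1 aM ((k * b + (i - k * b)) * N + (q + (x - q)))
      = bit_nat (B (k * b + (i - k * b)) (q + (x - q)) + C (i - k * b) (x - q))" using a by blast
    then show ?thesis using True by simp
  next
    case False
    have "i * N + x \<noteq> (k * b + i') * N + (q + j')" if "i' < b" "j' < b" for i' j'
      using that False b \<open>x < N\<close> mult_add_inj[of x N "q + j'" i "k * b + i'"] by auto
    then have "s1 aM (i * N + x) = s aM (i * N + x)" using a by blast
    then show ?thesis using M that False by (auto simp: holds_matrix_def)
  qed
  then show "agree_off {aI, aJ, aM} s1 s \<and>
     holds_matrix N s1 (\<lambda>i x. if k * b \<le> i \<and> i < k * b + b \<and> q \<le> x \<and> x < q + b
       then B i x + C (i - k * b) (x - q) else B i x)" using a by (simp add: holds_matrix_def)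
qed (use s b NW N1 in \<open>auto simp: agree_off_def fill_time_def\<close>)

end

lemma holds_matrix_cong:
  "(\<And>i x. i < N \<Longrightarrow> x < N \<Longrightarrow> B i x = B' i x) \<Longrightarrow> holds_matrix N s B \<longleftrightarrow> holds_matrix N s B'"
  by (simp add: holds_matrix_def)

context machine begin

lemma stride_bounds: "N * N < stride" "b \<le> N \<Longrightarrow> (b + 2) ^ (c + 2) < stride"
proof -
  have "N * N \<le> (N + 2) ^ 2" by (simp add: power2_eq_square)
  also have "\<dots> \<le> (N + 2) ^ (c + 2)" by (intro power_increasing) auto
  finally show "N * N < stride" by (simp add: stride)
  assume "b \<le> N"
  then have "(b + 2) ^ (c + 2) \<le> (N + 2) ^ (c + 2)" by (intro power_mono) auto
  then show "(b + 2) ^ (c + 2) < stride" by (simp add: stride)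
qed

text \<open>\<open>coef\<close> as the machine computes it from the stored matrix and pivot table.
  Both agree when the source columns have reached their version after the block.\<close>

definition pivot_coef :: "(nat \<Rightarrow> nat option) \<Rightarrow> (nat \<Rightarrow> nat \<Rightarrow> bit) \<Rightarrow> nat \<Rightarrow> nat \<Rightarrow> bit" where
  "pivot_coef pvf B i x = of_bool (pvf x \<noteq> None) * (B i x + of_bool (i = the (pvf x)))"

lemma run_chunk:
  assumes s: "s aN 0 = N" "s aB 0 = b" "s aP 0 = p" "s aQ 0 = q" "s aK 0 = k" "s aO 0 = off" "s aD 0 = stride"
    and b: "1 \<le> b" "p + b \<le> N" "q + b \<le> N" "k * b + b \<le> N" and off: "off + stride \<le> W"
    and M: "holds_matrix N s B" and V: "\<And>x. x < N \<Longrightarrow> s aV x = pcode (pvf x)"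
    and pvf: "\<And>x r. x < N \<Longrightarrow> pvf x = Some r \<Longrightarrow> r < N"
    and Q: "\<And>i j. i < b \<Longrightarrow> j < b \<Longrightarrow> s aS (i * b + j) = bit_nat (Q i j)"
    and fr: "fresh s off"
  shows "runs W (chunk_prog P) s (3 * fill_time b + 4 * time b + 20) (\<lambda>s'.
     agree_off ({aI, aJ, aO, aM} \<union> {dM..}) s' s \<and> s' aO 0 = off + stride \<and> fresh s' (off + stride) \<and>
     holds_matrix N s' (\<lambda>i x. if k * b \<le> i \<and> i < k * b + b \<and> q \<le> x \<and> x < q + b
       then B i x + (\<Sum>l<b. pivot_coef pvf B i (p + l) * Q l (x - q)) else B i x))"
proof -
  have bN: "b \<le> N" using b by simp
  have offN: "off + N * N \<le> W" and offm: "(b + 2) ^ (c + 2) + off \<le> W"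
    using off stride_bounds(1) stride_bounds(2)[OF bN] by auto
  define s1 where "s1 = s(dM := (s dM)(off := b))"
  have s1: "s1 aN 0 = N" "s1 aB 0 = b" "s1 aP 0 = p" "s1 aQ 0 = q" "s1 aK 0 = k" "s1 aO 0 = off" "s1 aD 0 = stride"
    using s by (auto simp: s1_def)
  have M1: "holds_matrix N s1 B" using M by (simp add: holds_matrix_def s1_def)
  have V1: "\<And>x. x < N \<Longrightarrow> s1 aV x = pcode (pvf x)" using V by (simp add: s1_def)
  have Q1: "\<And>i j. i < b \<Longrightarrow> j < b \<Longrightarrow> s1 aS (i * b + j) = bit_nat (Q i j)" using Q by (simp add: s1_def)
  define L where "L i j = pivot_coef pvf B (k * b + i) (p + j)" for i j
  define C where "C i j = (\<Sum>l<b. L i l * Q l j)" for i j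
  let ?Q2 = "\<lambda>s'. agree_off {aI, aJ, dM + 1} s' s1 \<and>
     (\<forall>i<b. \<forall>j<b. s' (dM + 1) (off + (i * b + j)) = bit_nat (L i j)) \<and>
     (\<forall>x. (\<forall>i<b. \<forall>j<b. x \<noteq> off + (i * b + j)) \<longrightarrow> s' (dM + 1) x = s1 (dM + 1) x)"
  let ?Q3 = "\<lambda>s'. agree_off {aI, aJ, dM + 1, dM + 2} s' s1 \<and>
     (\<forall>i<b. \<forall>j<b. s' (dM + 1) (off + (i * b + j)) = bit_nat (L i j)) \<and>
     (\<forall>x. (\<forall>i<b. \<forall>j<b. x \<noteq> off + (i * b + j)) \<longrightarrow> s' (dM + 1) x = s1 (dM + 1) x) \<and>
     (\<forall>i<b. \<forall>j<b. s' (dM + 2) (off + (i * b + j)) = bit_nat (Q i j)) \<and>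
     (\<forall>x. (\<forall>i<b. \<forall>j<b. x \<noteq> off + (i * b + j)) \<longrightarrow> s' (dM + 2) x = s1 (dM + 2) x)"
  let ?Q4 = "\<lambda>s'. agree_off ({aI, aJ} \<union> {dM..}) s' s \<and> fresh s' (off + stride) \<and>
     (\<forall>i<b. \<forall>j<b. s' (dM + 3) (off + (i * b + j)) = bit_nat (C i j))"
  let ?Q5 = "\<lambda>s'. agree_off ({aI, aJ, aM} \<union> {dM..}) s' s \<and> fresh s' (off + stride) \<and>
     holds_matrix N s' (\<lambda>i x. if k * b \<le> i \<and> i < k * b + b \<and> q \<le> x \<and> x < q + b
       then B i x + C (i - k * b) (x - q) else B i x)"
  let ?Q6 = "\<lambda>s'. agree_off ({aI, aJ, aO, aM} \<union> {dM..}) s' s \<and> s' aO 0 = off + stride \<and>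
     fresh s' (off + stride) \<and>
     holds_matrix N s' (\<lambda>i x. if k * b \<le> i \<and> i < k * b + b \<and> q \<le> x \<and> x < q + b
       then B i x + C (i - k * b) (x - q) else B i x)"
  have r1: "runs W (Put dM (Var aO) (Var aB)) s 5 (\<lambda>s'. s' = s1)"
    using s offN bN NW by (simp add: s1_def)
  have r2: "runs W left_prog s1 (fill_time b) ?Q2"
    unfolding L_def pivot_coef_def by (rule run_left[OF s1(1,2,3,5,6) b(1,2,4) offN M1 V1 pvf])
  have r3: "runs W right_prog s' (fill_time b) ?Q3" if "?Q2 s'" for s'
  proof -
    have a: "s' x = s1 x" if "x \<notin> {aI, aJ, dM + 1}" for x using \<open>?Q2 s'\<close> that by (auto simp: agree_off_def)
    show ?thesis
      by (rule runs_mono[OF run_right[where b = b and off = off and Q = Q]])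
        (use that a s1 b bN offN Q1 in \<open>auto simp: agree_off_def\<close>)
  qed
  have r4: "runs W (shift_prog dM aO P) s' (4 * time b) ?Q4" if h: "?Q3 s'" for s'
  proof -
    have a: "s' x = s1 x" if "x \<notin> {aI, aJ, dM + 1, dM + 2}" for x using h that by (auto simp: agree_off_def)
    show ?thesis
    proof (rule runs_mono[OF run_multiplication[OF P, where m = b and off = off and A = L and B = Q]])
      \<comment> \<open>Beyond the \<open>b * b\<close> entries just written the arrays still have
        the zeros granted by \<open>fresh\<close>.\<close>
      fix x y assume xy: "off \<le> y" "dM \<le> x" "\<not> (x = dM \<and> y = off)"
        "\<not> ((x = dM + 1 \<or> x = dM + 2) \<and> y < off + b * b)"
      have "y \<noteq> off + (i * b + j)" if "off + b * b \<le> y" "i < b" "j < b" for i j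
        using mult_add_less[of i b j b] that by linarith
      then have "s' x y = s1 x y" using xy h a[of x] by (cases "x = dM + 1 \<or> x = dM + 2") auto
      also have "\<dots> = 0" using xy fr by (auto simp: s1_def fresh_def)
      finally show "s' x y = 0" .
    next
      fix s'' assume h2: "(\<forall>a<dM. s'' a = s' a) \<and>
          (\<forall>i<b. \<forall>j<b. s'' (dM + 3) (off + (i * b + j)) = bit_nat (\<Sum>k<b. L i k * Q k j)) \<and>
          (\<forall>a x. dM \<le> a \<longrightarrow> off + (b + 2) ^ (c + 2) < x \<longrightarrow> s'' a x = 0)"
      then have "fresh s'' (off + stride)" using stride_bounds(2)[OF bN] by (auto simp: fresh_def)
      then show "?Q4 s''" using h2 a by (auto simp: C_def agree_off_def s1_def)
    qed (use h a s1 offm in \<open>auto simp: s1_def\<close>)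
  qed
  have r5: "runs W add_prog s' (fill_time b) ?Q5" if h: "?Q4 s'" for s'
  proof -
    have a: "s' x = s x" if "x \<notin> {aI, aJ} \<union> {dM..}" for x using h that by (auto simp: agree_off_def)
    have "holds_matrix N s' B" using M a by (simp add: holds_matrix_def)
    then show ?thesis
      by (intro runs_mono[OF run_add[where b = b and off = off and C = C and q = q and k = k and B = B]])
        (use h a s b offN in \<open>auto simp: agree_off_def fresh_def\<close>)
  qed
  have r6: "runs W (Set aO (Var aO +e Var aD)) s' 7 ?Q6" if h: "?Q5 s'" for s'
  proof -
    have a: "s' x = s x" if "x \<notin> {aI, aJ, aM} \<union> {dM..}" for x using h that by (auto simp: agree_off_def)
    show ?thesis using h a s off by (simp add: fresh_def holds_matrix_def agree_off_def)
  qed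
  have C: "C (i - k * b) (x - q) = (\<Sum>l<b. pivot_coef pvf B i (p + l) * Q l (x - q))" if "k * b \<le> i" for i x
    using that by (simp add: C_def L_def)
  have r: "runs W (chunk_prog P) s (5 + (fill_time b + (fill_time b + (4 * time b + (fill_time b + 7))))) ?Q6"
    unfolding chunk_prog_def
    by (rule runs_Seq[OF r1], simp only:, rule runs_Seq[OF r2], rule runs_Seq[OF r3], assumption,
        rule runs_Seq[OF r4], assumption, rule runs_Seq[OF r5], assumption, rule r6, assumption)
  show ?thesis
    by (rule runs_mono[OF r]) (auto simp: C holds_matrix_def cong: if_cong)
qed

definition update_time :: "nat \<Rightarrow> nat" where
  "update_time b = (N div b) * (3 * fill_time b + 4 * time b + 40) + fill_time b + 20"

text \<open>The target block must be disjoint from the source block: the coefficients are read anew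
  for each band of rows, while the pivot rows come from the saved copy.\<close>

lemma run_update:
  assumes s: "s aN 0 = N" "s aB 0 = b" "s aP 0 = p" "s aQ 0 = q" "s aO 0 = off" "s aD 0 = stride"
    and b: "1 \<le> b" "b dvd N" "p + b \<le> N" "q + b \<le> N" "p + b \<le> q \<or> q + b \<le> p"
    and off: "off + N * stride \<le> W"
    and M: "holds_matrix N s B" and V: "\<And>x. x < N \<Longrightarrow> s aV x = pcode (pvf x)"
    and pvf: "\<And>x r. x < N \<Longrightarrow> pvf x = Some r \<Longrightarrow> r < N"
    and fr: "fresh s off"
  shows "runs W (update_prog P) s (update_time b) (\<lambda>s'.
     agree_off ({aI, aJ, aK, aO, aM, aS} \<union> {dM..}) s' s \<and>
     (\<exists>off'. s' aO 0 = off' \<and> off' \<le> off + N * stride \<and> fresh s' off') \<and>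
     holds_matrix N s' (\<lambda>i x. if q \<le> x \<and> x < q + b
       then B i x + (\<Sum>y\<in>{p..<p + b}. pivot_coef pvf B i y * B (the (pvf y)) x) else B i x))"
proof -
  define Q where "Q i j = of_bool (pvf (p + i) \<noteq> None) * B (the (pvf (p + i))) (q + j)" for i j
  define m where "m = N div b"
  have Nm: "N = m * b" using b by (simp add: m_def)
  have mN: "m \<le> N" by (simp add: m_def)
  \<comment> \<open>The matrix after \<open>k\<close> bands: only the target columns in the first
    \<open>k * b\<close> rows are updated.\<close>
  define R where "R k i x = (if i < k * b \<and> q \<le> x \<and> x < q + b
     then B i x + (\<Sum>l<b. pivot_coef pvf B i (p + l) * Q l (x - q)) else B i x)" for k i x
  let ?X = "{aI, aJ, aK, aO, aM, aS} \<union> {dM..}"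
  let ?I = "\<lambda>k s'. agree_off ?X s' s \<and> s' aK 0 = k \<and> s' aO 0 = off + k * stride \<and> fresh s' (off + k * stride) \<and>
     (\<forall>i<b. \<forall>j<b. s' aS (i * b + j) = bit_nat (Q i j)) \<and> holds_matrix N s' (R k)"
  have r1: "runs W save_prog s (fill_time b) (\<lambda>s'. agree_off {aI, aJ, aS} s' s \<and>
     (\<forall>i<b. \<forall>j<b. s' aS (i * b + j) = bit_nat (Q i j)))"
    unfolding Q_def by (rule run_save[OF s(1-4) b(1,3,4) M V pvf])
  have r2: "runs W (For aK (Op Divide (Var aN) (Var aB)) (chunk_prog P)) s1
      (m * (3 * fill_time b + 4 * time b + 20 + 5 + 10) + 5 + 10) (?I m)"
    if h: "agree_off {aI, aJ, aS} s1 s \<and> (\<forall>i<b. \<forall>j<b. s1 aS (i * b + j) = bit_nat (Q i j))" for s1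
  proof -
    have a1: "s1 x = s x" if "x \<notin> {aI, aJ, aS}" for x using h that by (auto simp: agree_off_def)
    show ?thesis
    proof (rule runs_mono, rule run_For[where I = ?I and m = m and C = "3 * fill_time b + 4 * time b + 20"])
      show "?I 0 (set_var s1 aK 0)"
        using h a1 s M fr by (auto simp: agree_off_def fresh_def holds_matrix_def R_def)
    next
      fix k s' assume k: "k \<le> m" "?I k s'"
      then have "s' x = s x" if "x \<notin> ?X" for x using that by (auto simp: agree_off_def)
      moreover have "N div b \<le> W" using mN NW unfolding m_def by linarith
      ultimately show "s' aK 0 = k \<and> fits W (Op Divide (Var aN) (Var aB)) s' \<and>
          expr_val (Op Divide (Var aN) (Var aB)) s' = m"
        using k s b NW mN by (simp add: m_def)
    next
      fix k s' assume k: "k < m" "?I k s'"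
      have a: "s' x = s x" if "x \<notin> ?X" for x using k that by (auto simp: agree_off_def)
      have "Suc k * b \<le> m * b" using k by (intro mult_le_mono1) simp
      then have kb: "k * b + b \<le> N" by (simp add: Nm)
      have "Suc k * stride \<le> N * stride" using k mN by (intro mult_le_mono1) simp
      then have o: "off + k * stride + stride \<le> W" using off by simp
      \<comment> \<open>Source columns lie outside the target, so their coefficients are unaffected
        by earlier bands.\<close>
      have src: "pivot_coef pvf (R k) i (p + l) = pivot_coef pvf B i (p + l)" if "l < b" for i l
        using that b by (auto simp: pivot_coef_def R_def)
      have new: "(if k * b \<le> i \<and> i < k * b + b \<and> q \<le> x \<and> x < q + b
         then R k i x + (\<Sum>l<b. pivot_coef pvf (R k) i (p + l) * Q l (x - q)) else R k i x) = R (Suc k) i x" for i x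
        by (auto simp: src R_def)
      have s': "s' aN 0 = N" "s' aB 0 = b" "s' aP 0 = p" "s' aQ 0 = q" "s' aK 0 = k" "s' aO 0 = off + k * stride"
          "s' aD 0 = stride" "holds_matrix N s' (R k)" "\<And>x. x < N \<Longrightarrow> s' aV x = pcode (pvf x)"
          "\<And>x r. x < N \<Longrightarrow> pvf x = Some r \<Longrightarrow> r < N"
          "\<And>i j. i < b \<Longrightarrow> j < b \<Longrightarrow> s' aS (i * b + j) = bit_nat (Q i j)"
          "fresh s' (off + k * stride)"
        using a s k V pvf by auto
      show "runs W (chunk_prog P) s' (3 * fill_time b + 4 * time b + 20)
          (\<lambda>s'. s' aK 0 = k \<and> ?I (Suc k) (set_var s' aK (Suc k)))"
      proof (rule runs_mono[OF run_chunk[OF s'(1-7) b(1,3,4) kb o s'(8-12)]])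
        fix s''
        let ?D = "\<lambda>i x. if k * b \<le> i \<and> i < k * b + b \<and> q \<le> x \<and> x < q + b
           then R k i x + (\<Sum>l<b. pivot_coef pvf (R k) i (p + l) * Q l (x - q)) else R k i x"
        assume h: "agree_off ({aI, aJ, aO, aM} \<union> {dM..}) s'' s' \<and> s'' aO 0 = off + k * stride + stride \<and>
          fresh s'' (off + k * stride + stride) \<and> holds_matrix N s'' ?D"
        then have a2: "s'' x = s' x" if "x \<notin> {aI, aJ, aO, aM} \<union> {dM..}" for x
          using that by (auto simp: agree_off_def)
        then have a3: "s'' x = s x" if "x \<notin> ?X" for x using a that by auto
        have o2: "off + k * stride + stride = off + Suc k * stride" by simp
        have "agree_off ?X (set_var s'' aK (Suc k)) s" using a3 by (auto simp: agree_off_def)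
        moreover have "holds_matrix N (set_var s'' aK (Suc k)) (R (Suc k))"
          using h unfolding new by (simp add: holds_matrix_def)
        moreover have "fresh (set_var s'' aK (Suc k)) (off + Suc k * stride)"
          using h unfolding o2 by (simp add: fresh_def)
        moreover have "s'' aK 0 = k" "s'' aS = s' aS" "s'' aO 0 = off + Suc k * stride" using h k a2 by auto
        ultimately show "s'' aK 0 = k \<and> ?I (Suc k) (set_var s'' aK (Suc k))" using k by simp
      qed (assumption | rule order.refl)+
    qed (use NW mN in auto)
  qed
  have r: "runs W (update_prog P) s (fill_time b + (m * (3 * fill_time b + 4 * time b + 20 + 5 + 10) + 5 + 10)) (?I m)"
    unfolding update_prog_def by (rule runs_Seq[OF r1], rule r2, assumption)
  have Rm: "R m i x = (if q \<le> x \<and> x < q + b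
       then B i x + (\<Sum>y\<in>{p..<p + b}. pivot_coef pvf B i y * B (the (pvf y)) x) else B i x)"
    if "i < N" for i x
  proof -
    have "(\<Sum>y\<in>{p..<p + b}. pivot_coef pvf B i y * B (the (pvf y)) x)
      = (\<Sum>l<b. pivot_coef pvf B i (p + l) * B (the (pvf (p + l))) x)"
      by (rule sum.reindex_bij_witness[of _ "\<lambda>l. p + l" "\<lambda>y. y - p"]) auto
    also have "\<dots> = (\<Sum>l<b. pivot_coef pvf B i (p + l) * Q l (x - q))" if "q \<le> x"
      using that by (intro sum.cong) (auto simp: Q_def pivot_coef_def)
    finally show ?thesis using \<open>i < N\<close> by (auto simp: R_def Nm)
  qed
  have "m * stride \<le> N * stride" using mN by (rule mult_le_mono1)
  then have le: "off + m * stride \<le> off + N * stride" by simp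
  have Rm': "holds_matrix N s' (R m) \<longleftrightarrow> holds_matrix N s' (\<lambda>i x. if q \<le> x \<and> x < q + b
       then B i x + (\<Sum>y\<in>{p..<p + b}. pivot_coef pvf B i y * B (the (pvf y)) x) else B i x)" for s'
    by (rule holds_matrix_cong) (rule Rm)
  have "fill_time b + (m * (3 * fill_time b + 4 * time b + 20 + 5 + 10) + 5 + 10) \<le> update_time b"
    unfolding update_time_def m_def[symmetric] by (simp add: algebra_simps)
  then show ?thesis
  proof (rule runs_mono[OF r])
    fix s' assume I: "?I m s'"
    then show "agree_off ?X s' s \<and> (\<exists>off'. s' aO 0 = off' \<and> off' \<le> off + N * stride \<and> fresh s' off') \<and>
      holds_matrix N s' (\<lambda>i x. if q \<le> x \<and> x < q + b
       then B i x + (\<Sum>y\<in>{p..<p + b}. pivot_coef pvf B i y * B (the (pvf y)) x) else B i x)"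
      unfolding Rm'[symmetric] using le by (intro conjI exI[of _ "off + m * stride"]) (elim conjE; assumption)+
  qed
qed

end

text \<open>A value of \<open>r\<close> that is not below \<open>N\<close> stands for failure;
  \<open>leaf_prog\<close> starts its candidate at \<open>N\<close>.\<close>

lemma pick_eqI:
  assumes "r < N \<Longrightarrow> r \<notin> U \<and> A r t = 1" "\<And>i. i < N \<Longrightarrow> r < i \<or> \<not> r < N \<Longrightarrow> i \<in> U \<or> A i t = 0"
  shows "pick N A U t = (if r < N then Some r else None)"
proof (cases "r < N")
  case True
  let ?S = "{i. i < N \<and> i \<notin> U \<and> A i t = 1}"
  have "Max ?S = r"
  proof (intro Max_eqI)
    show "y \<le> r" if "y \<in> ?S" for y using that assms(2)[of y] by (cases "r < y") auto
  qed (use True assms(1) in auto)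
  moreover have "\<exists>i<N. i \<notin> U \<and> A i t = 1" using True assms(1) by blast
  ultimately show ?thesis using True by (simp add: pick_def)
next
  case False
  then show ?thesis using assms(2) by (auto simp: pick_def)
qed

lemma iterates_run:
  assumes "fits w b s" "expr_val b s \<noteq> 0" "runs w R s t Q"
  shows "\<exists>T s'. iterates w b R s T s' \<and> T \<le> expr_cost b + 1 + t \<and> Q s'"
proof -
  obtain u s' where "exec w R s u s'" "u \<le> t" "Q s'" using assms(3) unfolding run_def by blast
  with iterates.step[OF assms(1,2) this(1) iterates.stop] show ?thesis by (intro exI conjI) auto
qed

lemma runs_le: "runs w P s a Q \<Longrightarrow> a \<le> b \<Longrightarrow> runs w P s b Q"
  by (erule run_mono) auto

lemma runs_Set:
  "fits w e s \<Longrightarrow> runs w R (set_var s v (expr_val e s)) n Q \<Longrightarrow>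
     runs w (Seq (Set v e) R) s (n + expr_cost e + 2) Q"
  unfolding run_Seq run_Put by (auto elim!: run_mono)

lemma runs_Cond:
  "fits w b s \<Longrightarrow> (expr_val b s \<noteq> 0 \<Longrightarrow> runs w P s n Q) \<Longrightarrow> (expr_val b s = 0 \<Longrightarrow> runs w R s n Q) \<Longrightarrow>
     runs w (Cond b P R) s (n + expr_cost b + 1) Q"
  unfolding run_Cond by (auto elim!: run_mono)

text \<open>The pivot is only chosen and recorded; no row is touched. The pivot column itself stays
  unchanged in its step, and the other columns receive the operation later through block
  updates.\<close>

definition leaf_prog :: prog where
  "leaf_prog = Seq (Set aR (Var aN))
     (Seq (For aI (Var aN) (Cond ((Get aU (Var aI) =e Const 0) *e Get aM (Var aI *e Var aN +e Var aT))
        (Set aR (Var aI)) Skip))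
     (Seq (Cond (Var aR <e Var aN)
        (Seq (Put aU (Var aR) (Const 1)) (Put aV (Var aT) (Var aR +e Const 1))) Skip)
     (Seq (Set aT (Var aT +e Const 1)) (Set aB (Const 1)))))"

text \<open>The recursion of block elimination as a single loop.  A block of \<open>aB\<close> columns that ends before
  column \<open>aT\<close> has just been completed.  If it is the right half of a block of twice its size, its left
  half is brought up to date and the size doubles; otherwise the next block on the right is updated
  and \<open>aB = 0\<close> requests the elimination of single columns.\<close>

definition step_prog :: "prog \<Rightarrow> prog" where
  "step_prog P = Cond (Var aB =e Const 0) leaf_prog
     (Cond (Var aT mode (Const 2 *e Var aB) =e Const 0)
       (Seq (Set aP (Var aT -e Var aB)) (Seq (Set aQ (Var aT -e Const 2 *e Var aB))
         (Seq (update_prog P) (Set aB (Const 2 *e Var aB)))))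
       (Seq (Set aP (Var aT -e Var aB)) (Seq (Set aQ (Var aT))
         (Seq (update_prog P) (Set aB (Const 0))))))"

context machine begin

lemma run_leaf:
  assumes s: "s aN 0 = N" "s aT 0 = t" and t: "t < N"
    and U: "\<And>i. i < N \<Longrightarrow> s aU i = of_bool (i \<in> U)"
    and M: "\<And>i. i < N \<Longrightarrow> s aM (i * N + t) = bit_nat (A i t)"
    and V: "s aV t = 0"
  shows "runs W leaf_prog s (N * 50 + 60) (\<lambda>s'. agree_off {aI, aR, aU, aV, aT, aB} s' s \<and>
     s' aT 0 = Suc t \<and> s' aB 0 = 1 \<and>
     (\<forall>i<N. s' aU i = of_bool (i \<in> set_option (pick N A U t) \<union> U)) \<and>
     s' aV = (s aV)(t := pcode (pick N A U t)))"
proof -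
  let ?good = "\<lambda>i. i \<notin> U \<and> A i t = 1"
  let ?I = "\<lambda>k s'. agree_off {aI, aR} s' s \<and> s' aI 0 = k \<and>
     (let r = s' aR 0 in if r < N then r < k \<and> ?good r \<and> (\<forall>i. r < i \<and> i < k \<longrightarrow> \<not> ?good i)
       else r = N \<and> (\<forall>i<k. \<not> ?good i))"
  have r1: "runs W (Set aR (Var aN)) s 5 (\<lambda>s'. s' = set_var s aR N)"
    using s NW by simp
  have r2: "runs W (For aI (Var aN) (Cond ((Get aU (Var aI) =e Const 0) *e Get aM (Var aI *e Var aN +e Var aT))
        (Set aR (Var aI)) Skip)) (set_var s aR N) (N * 50 + 12) (?I N)"
  proof (rule runs_mono, rule run_For[where I = ?I and m = N and C = 30])
    fix k s' assume k: "k < N" "?I k s'"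
    have a: "s' x = s x" if "x \<notin> {aI, aR}" for x using k that by (auto simp: agree_off_def)
    have kN: "k * N + t < N * N" using k t by (intro mult_add_less)
    have g: "0 < of_bool (k \<notin> U) * bit_nat (A k t) \<longleftrightarrow> ?good k" by (cases "A k t") auto
    show "runs W (Cond ((Get aU (Var aI) =e Const 0) *e Get aM (Var aI *e Var aN +e Var aT)) (Set aR (Var aI)) Skip) s' 30
      (\<lambda>s'. s' aI 0 = k \<and> ?I (Suc k) (set_var s' aI (Suc k)))"
    proof (cases "?good k")
      case True
      have v: "expr_val ((Get aU (Var aI) =e Const 0) *e Get aM (Var aI *e Var aN +e Var aT)) s' \<noteq> 0"
        using True k U[of k] M[of k] a s by (cases "A k t") auto
      have f: "fits W ((Get aU (Var aI) =e Const 0) *e Get aM (Var aI *e Var aN +e Var aT)) s'"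
        using True k U[of k] M[of k] a s kN W NW t bit_W by simp
      show ?thesis unfolding run_Cond using f v True k NW
        by (auto simp: Let_def agree_off_def less_Suc_eq split: if_splits)
    next
      case False
      have v: "expr_val ((Get aU (Var aI) =e Const 0) *e Get aM (Var aI *e Var aN +e Var aT)) s' = 0"
        using False k U[of k] M[of k] a s by (cases "A k t") auto
      have f: "fits W ((Get aU (Var aI) =e Const 0) *e Get aM (Var aI *e Var aN +e Var aT)) s'"
        using False k U[of k] M[of k] a s kN W NW t bit_W by simp
      show ?thesis unfolding run_Cond using f v False k NW
        by (auto simp: Let_def agree_off_def less_Suc_eq split: if_splits)
    qed
  qed (use s NW N1 in \<open>auto simp: agree_off_def Let_def\<close>)
  have r3: "runs W (Seq (Cond (Var aR <e Var aN)
        (Seq (Put aU (Var aR) (Const 1)) (Put aV (Var aT) (Var aR +e Const 1))) Skip)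
     (Seq (Set aT (Var aT +e Const 1)) (Set aB (Const 1)))) s' 40 (\<lambda>s'. agree_off {aI, aR, aU, aV, aT, aB} s' s \<and>
     s' aT 0 = Suc t \<and> s' aB 0 = 1 \<and>
     (\<forall>i<N. s' aU i = of_bool (i \<in> set_option (pick N A U t) \<union> U)) \<and>
     s' aV = (s aV)(t := pcode (pick N A U t)))" if h: "?I N s'" for s'
  proof -
    have a: "s' x = s x" if "x \<notin> {aI, aR}" for x using h that by (auto simp: agree_off_def)
    let ?r = "s' aR 0"
    have p: "pick N A U t = (if ?r < N then Some ?r else None)"
      using h by (intro pick_eqI) (auto simp: Let_def split: if_splits)
    show ?thesis
    proof (cases "?r < N")
      case True
      then show ?thesis unfolding p using a s t NW U by (auto simp: pcode_def agree_off_def)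
    next
      case False
      then have "?r = N" using h by (simp add: Let_def)
      then show ?thesis unfolding p using False a s t NW U V by (auto simp: pcode_def agree_off_def)
    qed
  qed
  have "runs W leaf_prog s (5 + (N * 50 + 12 + 40)) (\<lambda>s'. agree_off {aI, aR, aU, aV, aT, aB} s' s \<and>
     s' aT 0 = Suc t \<and> s' aB 0 = 1 \<and>
     (\<forall>i<N. s' aU i = of_bool (i \<in> set_option (pick N A U t) \<union> U)) \<and>
     s' aV = (s aV)(t := pcode (pick N A U t)))"
    unfolding leaf_prog_def
    by (rule runs_Seq[OF r1], simp only:, rule runs_Seq[OF r2], rule r3, assumption)
  then show ?thesis by (rule runs_mono) auto
qed

end

section \<open>Recursive block elimination and its invariant\<close>

locale solver = machine P c time N W stride + elimination N M U0
  for P c time N W stride M U0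
begin

definition progress :: "nat \<Rightarrow> memory \<Rightarrow> bool" where
  "progress t s \<longleftrightarrow> s aN 0 = N \<and> s aT 0 = t \<and> s aD 0 = stride \<and>
     (\<forall>i<N. s aU i = of_bool (i \<in> Ut t)) \<and> (\<forall>x<N. s aV x = (if x < t then pcode (pv x) else 0))"

abbreviation (input) "scratch \<equiv> {aT, aB, aR, aI, aJ, aK, aP, aQ, aO, aM, aU, aV, aS} \<union> {dM..}"

text \<open>\<open>block_update\<close> for a matrix of mixed versions: the source block is at
  version \<open>v\<close>, the target column still at version \<open>u\<close>.\<close>

lemma update_versions:
  assumes uv: "u \<le> v" and x: "x \<notin> {u..<v}" and B: "\<And>i. B i x = At u i x" "\<And>i y. y \<in> {u..<v} \<Longrightarrow> B i y = At v i y"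
    and pvf: "\<And>y. y < v \<Longrightarrow> pvf y = pv y"
  shows "B i x + (\<Sum>y\<in>{u..<v}. pivot_coef pvf B i y * B (the (pvf y)) x) = At v i x"
proof -
  have "At v i x = At u i x + (\<Sum>y\<in>{u..<v}. coef v i y * At u (prow y) x)"
    by (rule block_update[OF uv column_evolves[OF x]])
  also have "(\<Sum>y\<in>{u..<v}. coef v i y * At u (prow y) x)
     = (\<Sum>y\<in>{u..<v}. pivot_coef pvf B i y * B (the (pvf y)) x)"
    using pvf B by (intro sum.cong) (auto simp: coef_def pivot_coef_def prow_def)
  finally show ?thesis using B by simp
qed

lemma run_block:
  assumes g: "progress t s" and s: "s aB 0 = b" "s aP 0 = p" "s aQ 0 = q" "s aO 0 = off" and t: "t = p + b" "t \<le> N"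
    and b: "1 \<le> b" "b dvd N" "q + b \<le> N" "p + b \<le> q \<or> q + b \<le> p"
    and off: "off + N * stride \<le> W" and fr: "fresh s off" and M: "holds_matrix N s B"
    and src: "\<And>i y. y \<in> {p..<t} \<Longrightarrow> B i y = At t i y" and tgt: "\<And>i x. x \<in> {q..<q + b} \<Longrightarrow> B i x = At p i x"
  shows "runs W (update_prog P) s (update_time b) (\<lambda>s'.
     agree_off ({aI, aJ, aK, aO, aM, aS} \<union> {dM..}) s' s \<and> progress t s' \<and>
     (\<exists>off'. s' aO 0 = off' \<and> off' \<le> off + N * stride \<and> fresh s' off') \<and>
     holds_matrix N s' (\<lambda>i x. if x \<in> {q..<q + b} then At t i x else B i x))"
proof -
  \<comment> \<open>At time \<open>t\<close> the pivot table has entries only for the columns before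
    \<open>t\<close>.\<close>
  define pvf where "pvf x = (if x < t then pv x else None)" for x
  have V: "s aV x = pcode (pvf x)" if "x < N" for x
    using g that by (auto simp: progress_def pvf_def pcode_def)
  have pvfN: "r < N" if "pvf x = Some r" for x r
    using that pv_Some[of x r] by (auto simp: pvf_def split: if_splits)
  have g': "s aN 0 = N" "s aD 0 = stride" using g by (auto simp: progress_def)
  have new: "(if q \<le> x \<and> x < q + b
       then B i x + (\<Sum>y\<in>{p..<p + b}. pivot_coef pvf B i y * B (the (pvf y)) x) else B i x)
     = (if x \<in> {q..<q + b} then At t i x else B i x)" for i x
  proof (cases "x \<in> {q..<q + b}")
    case True
    then have "x \<notin> {p..<t}" using b t by auto
    then show ?thesis using True update_versions[of p t x B pvf i] src tgt t by (simp add: pvf_def)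
  qed auto
  have pb: "p + b \<le> N" using t by simp
  show ?thesis
    by (rule runs_mono[OF run_update[OF g'(1) s(1-4) g'(2) b(1,2) pb b(3,4) off M V pvfN fr, unfolded new]])
      (use g in \<open>auto simp: progress_def agree_off_def\<close>)
qed

text \<open>A block of double size needs two recursive eliminations and two updates, one from the
  left half to the right and one back.\<close>

primrec block_time :: "nat \<Rightarrow> nat" where
  "block_time 0 = N * 50 + 80"
| "block_time (Suc j) = 2 * block_time j + 2 * (update_time (2 ^ j) + 80)"

text \<open>One round of the loop after a block of \<open>b\<close> columns has been completed. The
  remainder of \<open>t\<close> modulo \<open>2 * b\<close> tells which half that block is, and
  thereby the target \<open>q\<close> and the next value \<open>b'\<close> of
  \<open>aB\<close>.\<close>

lemma iterate_update:
  assumes g: "progress t s" and s: "s aB 0 = b" "s aO 0 = off" and t: "b \<le> t" "t \<le> N"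
    and b: "1 \<le> b" "b dvd N" "2 * b \<le> N"
    and q: "if t mod (2 * b) = 0 then q = t - 2 * b \<and> 2 * b \<le> t \<and> b' = 2 * b
       else q = t \<and> t + b \<le> N \<and> b' = 0"
    and off: "off + N * stride \<le> W" and fr: "fresh s off" and M: "holds_matrix N s B"
    and src: "\<And>i y. y \<in> {t - b..<t} \<Longrightarrow> B i y = At t i y"
    and tgt: "\<And>i x. x \<in> {q..<q + b} \<Longrightarrow> B i x = At (t - b) i x"
  shows "\<exists>T s' off'. iterates W (Var aB <e Var aN) (step_prog P) s T s' \<and> T \<le> update_time b + 80 \<and>
     agree_off scratch s' s \<and> progress t s' \<and> s' aB 0 = b' \<and>
     holds_matrix N s' (\<lambda>i x. if x \<in> {q..<q + b} then At t i x else B i x) \<and>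
     s' aO 0 = off' \<and> fresh s' off' \<and> off' \<le> off + N * stride"
proof -
  have g': "s aN 0 = N" "s aT 0 = t" using g by (auto simp: progress_def)
  let ?Q = "\<lambda>s'. agree_off scratch s' s \<and> progress t s' \<and>
     holds_matrix N s' (\<lambda>i x. if x \<in> {q..<q + b} then At t i x else B i x) \<and>
     (\<exists>off'. s' aO 0 = off' \<and> fresh s' off' \<and> off' \<le> off + N * stride)"
  let ?s = "set_var (set_var s aP (t - b)) aQ q"
  have "runs W (update_prog P) ?s (update_time b) (\<lambda>s'.
     agree_off ({aI, aJ, aK, aO, aM, aS} \<union> {dM..}) s' ?s \<and> progress t s' \<and>
     (\<exists>off'. s' aO 0 = off' \<and> off' \<le> off + N * stride \<and> fresh s' off') \<and>
     holds_matrix N s' (\<lambda>i x. if x \<in> {q..<q + b} then At t i x else B i x))"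
  proof (rule run_block[where p = "t - b"])
    show "q + b \<le> N" "t - b + b \<le> q \<or> q + b \<le> t - b" using q t by (auto split: if_splits)
  qed (use assms in \<open>auto simp: progress_def fresh_def holds_matrix_def\<close>)
  then have u: "runs W (update_prog P) ?s (update_time b) (\<lambda>s'. s' aB 0 = b \<and> s' aN 0 = N \<and> ?Q s')"
    by (rule runs_mono) (use s g' in \<open>auto simp: agree_off_def progress_def\<close>)
  have Qb: "?Q (set_var s' aB x)" if "?Q s'" for s' x
    using that by (auto simp: agree_off_def progress_def holds_matrix_def fresh_def)
  have mW: "t mod (2 * b) \<le> W"
    using mod_less_eq_dividend[of t "2 * b"] t NW by linarith
  have f: "fits W (Var aB =e Const 0) s" "expr_val (Var aB =e Const 0) s = 0"
    "fits W (Var aT mode (Const 2 *e Var aB) =e Const 0) s"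
    "expr_val (Var aT mode (Const 2 *e Var aB) =e Const 0) s = of_bool (t mod (2 * b) = 0)"
    using s g' b t NW mW by auto
  have L: "runs W (Seq (Set aP (Var aT -e Var aB)) (Seq (Set aQ (Var aT -e Const 2 *e Var aB))
         (Seq (update_prog P) (Set aB (Const 2 *e Var aB))))) s (update_time b + 50) (\<lambda>s'. s' aB 0 = b' \<and> ?Q s')"
    if "t mod (2 * b) = 0"
  proof -
    have q': "q = t - 2 * b" "b' = 2 * b" using q that by auto
    have "runs W (Seq (update_prog P) (Set aB (Const 2 *e Var aB))) ?s (update_time b + 10) (\<lambda>s'. s' aB 0 = b' \<and> ?Q s')"
      by (rule runs_Seq[OF u]) (use Qb b NW q' in auto)
    then have r: "runs W (Seq (update_prog P) (Set aB (Const 2 *e Var aB))) (set_var (set_var s aP (expr_val (Var aT -e Var aB) s)) aQ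
        (expr_val (Var aT -e Const 2 *e Var aB) (set_var s aP (expr_val (Var aT -e Var aB) s))))
      (update_time b + 10) (\<lambda>s'. s' aB 0 = b' \<and> ?Q s')"
      using s g' q' by simp
    show ?thesis
      by (rule runs_le, rule runs_Set[OF _ runs_Set[OF _ r]]) (use s g' b t NW in auto)
  qed
  have R: "runs W (Seq (Set aP (Var aT -e Var aB)) (Seq (Set aQ (Var aT))
         (Seq (update_prog P) (Set aB (Const 0))))) s (update_time b + 50) (\<lambda>s'. s' aB 0 = b' \<and> ?Q s')"
    if "t mod (2 * b) \<noteq> 0"
  proof -
    have q': "q = t" "b' = 0" using q that by auto
    have "runs W (Seq (update_prog P) (Set aB (Const 0))) ?s (update_time b + 10) (\<lambda>s'. s' aB 0 = b' \<and> ?Q s')"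
      by (rule runs_Seq[OF u]) (use Qb b NW q' in auto)
    then have r: "runs W (Seq (update_prog P) (Set aB (Const 0))) (set_var (set_var s aP (expr_val (Var aT -e Var aB) s)) aQ
        (expr_val (Var aT) (set_var s aP (expr_val (Var aT -e Var aB) s))))
      (update_time b + 10) (\<lambda>s'. s' aB 0 = b' \<and> ?Q s')"
      using s g' q' by simp
    show ?thesis
      by (rule runs_le, rule runs_Set[OF _ runs_Set[OF _ r]]) (use s g' b t NW in auto)
  qed
  have "runs W (step_prog P) s (update_time b + 70) (\<lambda>s'. s' aB 0 = b' \<and> ?Q s')"
    unfolding step_prog_def
    by (rule runs_le, rule runs_Cond[OF f(1) _ runs_Cond[OF f(3) L R]]) (use f in \<open>simp_all del: expr_val.simps\<close>)
  from iterates_run[OF _ _ this, of "Var aB <e Var aN"]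
  have "\<exists>T s'. iterates W (Var aB <e Var aN) (step_prog P) s T s' \<and> T \<le> expr_cost (Var aB <e Var aN) + 1 + (update_time b + 70)
      \<and> s' aB 0 = b' \<and> ?Q s'"
    using g' s b NW by simp
  then show ?thesis by fastforce
qed

text \<open>The block enters at version \<open>a\<close> and leaves at version
  \<open>a + 2 ^ j\<close>; columns outside it are left behind. The number of updates doubles and
  grows by two with each level, which gives \<open>2 * 2 ^ j - 2\<close>, and each update uses up at
  most \<open>N * stride\<close> addresses.\<close>

lemma iterate_blocks:
  assumes "2 ^ j dvd a" "a + 2 ^ j \<le> N" "\<And>k. 2 ^ k \<le> N \<Longrightarrow> 2 ^ k dvd N" "progress a s" "s aB 0 = 0" "holds_matrix N s B"
    and "\<And>i x. x \<in> {a..<a + 2 ^ j} \<Longrightarrow> B i x = At a i x"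
    and "s aO 0 = off" "fresh s off" "off + (2 * 2 ^ j - 2) * (N * stride) \<le> W"
  shows "\<exists>T s' off'. iterates W (Var aB <e Var aN) (step_prog P) s T s' \<and> T \<le> block_time j \<and>
     agree_off scratch s' s \<and> progress (a + 2 ^ j) s' \<and> s' aB 0 = 2 ^ j \<and>
     holds_matrix N s' (\<lambda>i x. if x \<in> {a..<a + 2 ^ j} then At (a + 2 ^ j) i x else B i x) \<and>
     s' aO 0 = off' \<and> fresh s' off' \<and> off' \<le> off + (2 * 2 ^ j - 2) * (N * stride)"
  using assms
proof (induction j arbitrary: a s B off)
  case 0
  note g = "0.prems"(4)[unfolded progress_def]
  have aN: "a < N" using 0 by simp
  have M: "s aM (i * N + a) = bit_nat (At a i a)" if "i < N" for i
    using that aN "0.prems"(6,7) by (auto simp: holds_matrix_def)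
  have "runs W leaf_prog s (N * 50 + 60) (\<lambda>s'. agree_off {aI, aR, aU, aV, aT, aB} s' s \<and>
     s' aT 0 = Suc a \<and> s' aB 0 = 1 \<and>
     (\<forall>i<N. s' aU i = of_bool (i \<in> set_option (pick N (At a) (Ut a) a) \<union> Ut a)) \<and>
     s' aV = (s aV)(a := pcode (pick N (At a) (Ut a) a)))"
    by (rule run_leaf[where A = "At a" and U = "Ut a"]) (use g aN M in auto)
  then have r: "runs W (step_prog P) s (N * 50 + 70) (\<lambda>s'. agree_off {aI, aR, aU, aV, aT, aB} s' s \<and>
     s' aT 0 = Suc a \<and> s' aB 0 = 1 \<and>
     (\<forall>i<N. s' aU i = of_bool (i \<in> set_option (pick N (At a) (Ut a) a) \<union> Ut a)) \<and>
     s' aV = (s aV)(a := pcode (pick N (At a) (Ut a) a)))"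
    unfolding step_prog_def run_Cond using 0 NW by (auto elim!: run_mono)
  have c: "fits W (Var aB <e Var aN) s" "expr_val (Var aB <e Var aN) s \<noteq> 0" using g 0 NW N1 by auto
  obtain T s' where T: "iterates W (Var aB <e Var aN) (step_prog P) s T s'" "T \<le> N * 50 + 80"
    and s': "agree_off {aI, aR, aU, aV, aT, aB} s' s" "s' aT 0 = Suc a" "s' aB 0 = 1"
      "\<forall>i<N. s' aU i = of_bool (i \<in> set_option (pick N (At a) (Ut a) a) \<union> Ut a)"
      "s' aV = (s aV)(a := pcode (pick N (At a) (Ut a) a))"
    using iterates_run[OF c r] by fastforce
  have eq: "s' x = s x" if "x \<notin> {aI, aR, aU, aV, aT, aB}" for x using s' that by (auto simp: agree_off_def)
  have "progress (Suc a) s'"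
    using g s' eq by (auto simp: progress_def Ut_Suc pv_def less_Suc_eq)
  moreover have "holds_matrix N s' (\<lambda>i x. if x \<in> {a..<a + 2 ^ 0} then At (a + 2 ^ 0) i x else B i x)"
    using "0.prems"(6,7) eq by (auto simp: holds_matrix_def At_Suc)
  moreover have "agree_off scratch s' s" using s'(1) by (auto simp: agree_off_def)
  ultimately show ?case using T s' eq "0.prems" by (intro exI[of _ T] exI[of _ s'] exI[of _ off]) (auto simp: fresh_def)
next
  case (Suc j)
  let ?b = "2 ^ j :: nat"
  define S where "S = N * stride"
  have b: "1 \<le> ?b" by simp
  have bN: "?b dvd N" "2 * ?b \<le> N" using Suc.prems(2) by (auto intro: Suc.prems(3))
  have da: "?b dvd a" "2 * ?b dvd a" using Suc.prems(1) by (auto intro: dvd_mult_left)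
  have "2 * (2 * x) - 2 = 2 * (2 * x - 2) + 2" if "1 \<le> x" for x :: nat using that by arith
  from this[OF b] have "2 * 2 ^ Suc j - 2 = 2 * (2 * ?b - 2) + (2::nat)" by simp
  then have cl: "(2 * 2 ^ Suc j - 2) * S = 2 * ((2 * ?b - 2) * S) + 2 * S"
    by (simp only: add_mult_distrib mult.assoc)
  obtain T1 s1 off1 where 1: "iterates W (Var aB <e Var aN) (step_prog P) s T1 s1" "T1 \<le> block_time j"
     "agree_off scratch s1 s" "progress (a + ?b) s1" "s1 aB 0 = ?b"
     "holds_matrix N s1 (\<lambda>i x. if x \<in> {a..<a + ?b} then At (a + ?b) i x else B i x)"
     "s1 aO 0 = off1" "fresh s1 off1" "off1 \<le> off + (2 * ?b - 2) * S"
    using Suc.IH[of a s B off] Suc.prems da cl unfolding S_def[symmetric] by auto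
  \<comment> \<open>\<open>B1\<close> to \<open>B4\<close> are the matrices after the left half, the
    update of the right half, the right half, and the update of the left half.\<close>
  define B1 where "B1 i x = (if x \<in> {a..<a + ?b} then At (a + ?b) i x else B i x)" for i x
  define B2 where "B2 i x = (if x \<in> {a + ?b..<a + ?b + ?b} then At (a + ?b) i x else B1 i x)" for i x
  define B3 where "B3 i x = (if x \<in> {a + ?b..<a + ?b + ?b} then At (a + ?b + ?b) i x else B2 i x)" for i x
  define B4 where "B4 i x = (if x \<in> {a..<a + ?b} then At (a + ?b + ?b) i x else B3 i x)" for i x
  \<comment> \<open>The left half ends at an odd multiple of \<open>?b\<close>, the right half at an
    even one; the alignment of \<open>a\<close> is needed for this.\<close>
  have m1: "(a + ?b) mod (2 * ?b) \<noteq> 0"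
  proof
    assume "(a + ?b) mod (2 * ?b) = 0"
    then have "2 * ?b dvd ?b" using da(2) by (metis dvd_add_right_iff dvd_eq_mod_eq_0)
    then show False using b by (auto dest: dvd_imp_le)
  qed
  have m2: "(a + ?b + ?b) mod (2 * ?b) = 0"
    using da(2) by (simp add: mult_2 flip: dvd_eq_mod_eq_0) (metis add.assoc dvd_add_triv_right_iff mult_2)
  obtain T2 s2 off2 where 2: "iterates W (Var aB <e Var aN) (step_prog P) s1 T2 s2" "T2 \<le> update_time ?b + 80"
      "agree_off scratch s2 s1" "progress (a + ?b) s2" "s2 aB 0 = 0" "holds_matrix N s2 B2"
      "s2 aO 0 = off2" "fresh s2 off2" "off2 \<le> off1 + S"
    using iterate_update[OF 1(4,5,7), of "a + ?b" 0 B1] m1 1 bN b Suc.prems cl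
    unfolding S_def[symmetric] B1_def[abs_def] B2_def[abs_def] by auto
  obtain T3 s3 off3 where 3: "iterates W (Var aB <e Var aN) (step_prog P) s2 T3 s3" "T3 \<le> block_time j"
     "agree_off scratch s3 s2" "progress (a + ?b + ?b) s3" "s3 aB 0 = ?b" "holds_matrix N s3 B3"
     "s3 aO 0 = off3" "fresh s3 off3" "off3 \<le> off2 + (2 * ?b - 2) * S"
    using Suc.IH[of "a + ?b" s2 B2 off2] Suc.prems(2,3,10) da 1 2 cl
    unfolding S_def[symmetric] B2_def[abs_def] B3_def[abs_def] by auto
  obtain T4 s4 off4 where 4: "iterates W (Var aB <e Var aN) (step_prog P) s3 T4 s4" "T4 \<le> update_time ?b + 80"
      "agree_off scratch s4 s3" "progress (a + ?b + ?b) s4" "s4 aB 0 = 2 * ?b" "holds_matrix N s4 B4"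
      "s4 aO 0 = off4" "fresh s4 off4" "off4 \<le> off3 + S"
    using iterate_update[OF 3(4,5,7), of a "2 * ?b" B3] m2 1 2 3 bN b Suc.prems cl
    unfolding S_def[symmetric] B1_def[abs_def] B2_def[abs_def] B3_def[abs_def] B4_def[abs_def] by auto
  have two: "a + 2 ^ Suc j = a + ?b + ?b" by simp
  have B4: "B4 = (\<lambda>i x. if x \<in> {a..<a + 2 ^ Suc j} then At (a + 2 ^ Suc j) i x else B i x)"
    unfolding two by (auto simp: fun_eq_iff B4_def B3_def B2_def B1_def)
  have "agree_off scratch s4 s" using 1(3) 2(3) 3(3) 4(3) by (auto simp: agree_off_def)
  moreover have "iterates W (Var aB <e Var aN) (step_prog P) s (T1 + (T2 + (T3 + T4))) s4"
    using 1(1) 2(1) 3(1) 4(1) by (intro iterates_trans)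
  moreover have "T1 + (T2 + (T3 + T4)) \<le> block_time (Suc j)" using 1(2) 2(2) 3(2) 4(2) by simp
  moreover have "off4 \<le> off + (2 * 2 ^ Suc j - 2) * (N * stride)"
    using 1(9) 2(9) 3(9) 4(9) cl unfolding S_def[symmetric] by simp
  moreover have "s4 aB 0 = 2 ^ Suc j" using 4(5) by simp
  ultimately show ?case using 4(4,6,7,8) unfolding B4[symmetric] two[symmetric]
    by (intro exI[of _ "T1 + (T2 + (T3 + T4))"] exI[of _ s4] exI[of _ off4] conjI)
qed

end

section \<open>The annotation program\<close>

text \<open>\<open>aH\<close> lists the sentinel rows without a pivot, and \<open>aW\<close> is the inverse of \<open>aV\<close>.\<close>

abbreviation (input) "aH \<equiv> 25 :: nat"
abbreviation (input) "aW \<equiv> 26 :: nat"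
abbreviation (input) "cV \<equiv> Get 0 (Const 0)"
abbreviation (input) "cE \<equiv> Get 0 (Const 1)"
abbreviation (input) "cF \<equiv> Get 0 (Const 2)"

definition pad_prog :: prog where
  "pad_prog = Seq (Set aN (Const 1)) (Loop (Var aN <e cE +e cF) (Set aN (Const 2 *e Var aN)))"

text \<open>Less than doubling is needed to reach a power of two; the \<open>+ 1\<close> covers the
  case without edges and triangles, where the size is 1.\<close>

lemma run_pad:
  assumes s: "s 0 1 = n1" "s 0 2 = n2" and W: "2 * (n1 + n2) + 2 \<le> W"
  shows "runs W pad_prog s ((n1 + n2) * 20 + 20)
     (\<lambda>s'. \<exists>k. s' = set_var s aN (2 ^ k) \<and> n1 + n2 \<le> 2 ^ k \<and> 2 ^ k \<le> 2 * (n1 + n2) + 1)"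
proof -
  let ?m = "n1 + n2"
  have loop: "runs W (Loop (Var aN <e cE +e cF) (Set aN (Const 2 *e Var aN))) (set_var s aN (2 ^ k)) ((?m - 2 ^ k) * 20 + 10)
     (\<lambda>s'. \<exists>k. s' = set_var s aN (2 ^ k) \<and> ?m \<le> 2 ^ k \<and> 2 ^ k \<le> 2 * ?m + 1)"
    if "2 ^ k \<le> 2 * ?m + 1" for k
    using that
  proof (induction "?m - 2 ^ k" arbitrary: k rule: less_induct)
    case less
    have x: "?m - 2 * x < ?m - x" if "1 \<le> x" "x < ?m" for x using that by arith
    from x[of "2 ^ k"] have one: "2 ^ k < ?m \<Longrightarrow> ?m - 2 ^ Suc k < ?m - 2 ^ k" by simp
    show ?case
    proof (cases "2 ^ k < ?m")
      case True
      let ?s = "set_var s aN (2 ^ k)"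
      have "runs W (Loop (Var aN <e cE +e cF) (Set aN (Const 2 *e Var aN))) (set_var s aN (2 ^ Suc k)) ((?m - 2 ^ Suc k) * 20 + 10)
        (\<lambda>s'. \<exists>k. s' = set_var s aN (2 ^ k) \<and> ?m \<le> 2 ^ k \<and> 2 ^ k \<le> 2 * ?m + 1)"
        using True one by (intro less.hyps) auto
      moreover have "(?m - 2 ^ Suc k) + 1 \<le> ?m - 2 ^ k" using one[OF True] by simp
      ultimately show ?thesis
        using True s W by (intro run_Loop_unfold) (auto elim!: run_mono)
    next
      case False
      then show ?thesis using s W less.prems by (intro run_Loop_exit) auto
    qed
  qed
  have "runs W (Loop (Var aN <e cE +e cF) (Set aN (Const 2 *e Var aN))) (set_var s aN (expr_val (Const 1) s)) (?m * 20 + 10)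
     (\<lambda>s'. \<exists>k. s' = set_var s aN (2 ^ k) \<and> ?m \<le> 2 ^ k \<and> 2 ^ k \<le> 2 * ?m + 1)"
    using runs_le[OF loop[of 0], of "?m * 20 + 10"] by simp
  from runs_Set[where v = aN, OF _ this] show ?thesis unfolding pad_prog_def
    by (rule runs_le) (use W in auto)
qed

definition label_prog :: prog where
  "label_prog = For aI cV (Put aL (Var aI) (Var aI))"

definition relabel_prog :: prog where
  "relabel_prog = For aJ cV (Cond (Get aL (Var aJ) =e Var aP) (Put aL (Var aJ) (Var aQ)) Skip)"

definition tree_prog :: prog where
  "tree_prog = Seq label_prog (For aI cE
     (Seq (Set aP (Get aL (Get 1 (Var aI)))) (Seq (Set aQ (Get aL (Get 2 (Var aI))))
       (Cond (Var aP =e Var aQ) Skip (Seq (Put aU (Var aI) (Const 1)) relabel_prog)))))"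

text \<open>Kruskal's algorithm with explicit component labels: an edge joining different labels is
  accepted, and the component of \<open>u e\<close> takes over the other label. Relabelling all
  vertices per edge takes quadratic time in total, which \<omega> > 2 allows.\<close>

primrec kruskal :: "(nat \<Rightarrow> nat) \<Rightarrow> (nat \<Rightarrow> nat) \<Rightarrow> nat \<Rightarrow> (nat \<Rightarrow> nat) \<times> nat set" where
  "kruskal u v 0 = (\<lambda>x. x, {})"
| "kruskal u v (Suc e) = (let L = fst (kruskal u v e); S = snd (kruskal u v e) in
     if L (u e) = L (v e) then (L, S)
     else (\<lambda>x. if L x = L (u e) then L (v e) else L x, insert e S))"

lemma kruskal_less:
  "(\<And>e. e < m \<Longrightarrow> u e < n \<and> v e < n) \<Longrightarrow> e \<le> m \<Longrightarrow> x < n \<Longrightarrow> fst (kruskal u v e) x < n"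
  by (induction e arbitrary: x) (auto simp: Let_def)

lemma kruskal_subset: "snd (kruskal u v e) \<subseteq> {..<e}"
  by (induction e) (auto simp: Let_def less_Suc_eq)

lemma run_label:
  assumes s: "s 0 0 = n0" and W: "n0 + 2 \<le> W"
  shows "runs W label_prog s (n0 * 20 + 20) (\<lambda>s'. agree_off {aI, aL} s' s \<and> (\<forall>x<n0. s' aL x = x))"
  unfolding label_prog_def
proof (rule runs_mono, rule run_For[where m = n0 and C = 5
      and I = "\<lambda>k s'. agree_off {aI, aL} s' s \<and> s' aI 0 = k \<and> (\<forall>x<k. s' aL x = x)"])
  fix k s' assume k: "k \<le> n0" "agree_off {aI, aL} s' s \<and> s' aI 0 = k \<and> (\<forall>x<k. s' aL x = x)"
  then have "s' 0 = s 0" by (auto simp: agree_off_def)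
  then show "s' aI 0 = k \<and> fits W cV s' \<and> expr_val cV s' = n0" using k s W by simp
next
  fix k s' assume k: "k < n0" "agree_off {aI, aL} s' s \<and> s' aI 0 = k \<and> (\<forall>x<k. s' aL x = x)"
  then show "runs W (Put aL (Var aI) (Var aI)) s' 5 (\<lambda>s'. s' aI 0 = k \<and>
      agree_off {aI, aL} (set_var s' aI (Suc k)) s \<and> set_var s' aI (Suc k) aI 0 = Suc k \<and>
      (\<forall>x<Suc k. set_var s' aI (Suc k) aL x = x))"
    using W by (auto simp: agree_off_def less_Suc_eq)
qed (use s W in \<open>auto simp: agree_off_def\<close>)

lemma run_relabel:
  assumes s: "s 0 0 = n0" "s aP 0 = p" "s aQ 0 = q" and L: "\<And>x. x < n0 \<Longrightarrow> s aL x = L x" "\<And>x. x < n0 \<Longrightarrow> L x < n0"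
    and W: "n0 + 2 \<le> W" "p < n0" "q < n0"
  shows "runs W relabel_prog s (n0 * 40 + 20) (\<lambda>s'. agree_off {aJ, aL} s' s \<and>
     (\<forall>x<n0. s' aL x = (if L x = p then q else L x)))"
  unfolding relabel_prog_def
proof (rule runs_mono, rule run_For[where m = n0 and C = 20
      and I = "\<lambda>k s'. agree_off {aJ, aL} s' s \<and> s' aJ 0 = k \<and>
        (\<forall>x<n0. s' aL x = (if x < k \<and> L x = p then q else L x))"])
  fix k s' assume k: "k \<le> n0" "agree_off {aJ, aL} s' s \<and> s' aJ 0 = k \<and>
        (\<forall>x<n0. s' aL x = (if x < k \<and> L x = p then q else L x))"
  then have "s' 0 = s 0" by (auto simp: agree_off_def)
  then show "s' aJ 0 = k \<and> fits W cV s' \<and> expr_val cV s' = n0" using k s W by simp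
next
  fix k s' assume k: "k < n0" "agree_off {aJ, aL} s' s \<and> s' aJ 0 = k \<and>
        (\<forall>x<n0. s' aL x = (if x < k \<and> L x = p then q else L x))"
  then have a: "s' x = s x" if "x \<notin> {aJ, aL}" for x using that by (auto simp: agree_off_def)
  show "runs W (Cond (Get aL (Var aJ) =e Var aP) (Put aL (Var aJ) (Var aQ)) Skip) s' 20 (\<lambda>s'. s' aJ 0 = k \<and>
      agree_off {aJ, aL} (set_var s' aJ (Suc k)) s \<and> set_var s' aJ (Suc k) aJ 0 = Suc k \<and>
      (\<forall>x<n0. set_var s' aJ (Suc k) aL x = (if x < Suc k \<and> L x = p then q else L x)))"
    using W k s L(2)[of k] a by (auto simp: agree_off_def less_Suc_eq)
qed (use s W L in \<open>auto simp: agree_off_def\<close>)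

lemma run_tree:
  assumes s: "s 0 0 = n0" "s 0 1 = n1" and uv: "\<And>e. e < n1 \<Longrightarrow> s 1 e = u e \<and> s 2 e = v e \<and> u e < n0 \<and> v e < n0"
    and W: "n0 + n1 + 2 \<le> W" and U: "\<And>e. s aU e = 0"
  shows "runs W tree_prog s (n1 * (n0 * 40 + 92) + n0 * 20 + 50) (\<lambda>s'. agree_off {aI, aJ, aL, aP, aQ, aU} s' s \<and>
     (\<forall>e. s' aU e = of_bool (e \<in> snd (kruskal u v n1))))"
proof -
  let ?X = "{aI, aJ, aL, aP, aQ, aU}"
  let ?L = "\<lambda>k. fst (kruskal u v k)" and ?S = "\<lambda>k. snd (kruskal u v k)"
  let ?I = "\<lambda>k s'. agree_off ?X s' s \<and> s' aI 0 = k \<and> (\<forall>x<n0. s' aL x = ?L k x) \<and> (\<forall>e. s' aU e = of_bool (e \<in> ?S k))"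
  have r2: "runs W (For aI cE
     (Seq (Set aP (Get aL (Get 1 (Var aI)))) (Seq (Set aQ (Get aL (Get 2 (Var aI))))
       (Cond (Var aP =e Var aQ) Skip (Seq (Put aU (Var aI) (Const 1)) relabel_prog))))) s1 (n1 * (n0 * 40 + 92) + 20) (?I n1)"
    if h: "agree_off {aI, aL} s1 s \<and> (\<forall>x<n0. s1 aL x = x)" for s1
  proof (rule runs_mono, rule run_For[where m = n1 and C = "n0 * 40 + 80" and I = ?I])
    fix k s' assume k: "k \<le> n1" "?I k s'"
    then have "s' 0 = s 0" by (auto simp: agree_off_def)
    then show "s' aI 0 = k \<and> fits W cE s' \<and> expr_val cE s' = n1" using k s W by simp
  next
    fix k s' assume k: "k < n1" "?I k s'"
    have a: "s' x = s x" if "x \<notin> ?X" for x using k that by (auto simp: agree_off_def)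
    note uvk = uv[OF k(1)]
    have Lk: "?L k x < n0" if "x < n0" for x using kruskal_less[of n1 u n0 v k x] uv k that by auto
    have LW: "?L k (u k) \<le> W" "?L k (v k) \<le> W" using Lk[of "u k"] Lk[of "v k"] uvk W by auto
    have uvL: "s' 1 k = u k" "s' 2 k = v k" "s' aL (u k) = ?L k (u k)" "s' aL (v k) = ?L k (v k)"
      using uvk a k by auto
    let ?s = "set_var (set_var s' aP (?L k (u k))) aQ (?L k (v k))"
    have post: "s'' aI 0 = k \<and> ?I (Suc k) (set_var s'' aI (Suc k))"
      if "agree_off {aJ, aL, aU, aP, aQ} s'' s'" "\<forall>x<n0. s'' aL x = ?L (Suc k) x" "\<forall>e. s'' aU e = of_bool (e \<in> ?S (Suc k))" for s''
      using that k by (auto simp: agree_off_def)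
    have c: "runs W (Cond (Var aP =e Var aQ) Skip (Seq (Put aU (Var aI) (Const 1)) relabel_prog)) ?s (n0 * 40 + 40)
       (\<lambda>s'. s' aI 0 = k \<and> ?I (Suc k) (set_var s' aI (Suc k)))"
    proof (cases "?L k (u k) = ?L k (v k)")
      case True
      have "?s aI 0 = k \<and> ?I (Suc k) (set_var ?s aI (Suc k))"
        using k True by (intro post) (auto simp: Let_def agree_off_def)
      then show ?thesis by (intro runs_le[OF runs_Cond[where n = 1]]) (use True LW W in simp_all)
    next
      case False
      have "runs W relabel_prog (?s(aU := (?s aU)(k := 1))) (n0 * 40 + 20) (\<lambda>s''. agree_off {aJ, aL} s'' (?s(aU := (?s aU)(k := 1))) \<and>
         (\<forall>x<n0. s'' aL x = (if ?L k x = ?L k (u k) then ?L k (v k) else ?L k x)))"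
        by (rule run_relabel) (use a s k Lk uvk W in auto)
      then have "runs W relabel_prog (?s(aU := (?s aU)(k := 1))) (n0 * 40 + 20) (\<lambda>s''. s'' aI 0 = k \<and> ?I (Suc k) (set_var s'' aI (Suc k)))"
      proof (rule runs_mono)
        fix s'' assume h2: "agree_off {aJ, aL} s'' (?s(aU := (?s aU)(k := 1))) \<and>
           (\<forall>x<n0. s'' aL x = (if ?L k x = ?L k (u k) then ?L k (v k) else ?L k x))"
        show "s'' aI 0 = k \<and> ?I (Suc k) (set_var s'' aI (Suc k))"
          by (rule post) (use h2 False k in \<open>auto simp: agree_off_def Let_def\<close>)
      qed simp
      then have "runs W (Seq (Put aU (Var aI) (Const 1)) relabel_prog) ?s (5 + (n0 * 40 + 20))
         (\<lambda>s''. s'' aI 0 = k \<and> ?I (Suc k) (set_var s'' aI (Suc k)))"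
        by (intro runs_Seq[where Q = "\<lambda>s''. s'' = ?s(aU := (?s aU)(k := 1))"]) (use k W in \<open>simp, simp only:\<close>)
      then show ?thesis by (intro runs_le[OF runs_Cond[where n = "5 + (n0 * 40 + 20)"]]) (use False LW W in simp_all)
    qed
    have e1: "expr_val (Get aL (Get 1 (Var aI))) s' = ?L k (u k)" using k uvL by simp
    have e2: "expr_val (Get aL (Get 2 (Var aI))) (set_var s' aP (?L k (u k))) = ?L k (v k)" using k uvL by simp
    have c': "runs W (Cond (Var aP =e Var aQ) Skip (Seq (Put aU (Var aI) (Const 1)) relabel_prog))
       (set_var (set_var s' aP (expr_val (Get aL (Get 1 (Var aI))) s')) aQ
          (expr_val (Get aL (Get 2 (Var aI))) (set_var s' aP (expr_val (Get aL (Get 1 (Var aI))) s')))) (n0 * 40 + 40)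
       (\<lambda>s'. s' aI 0 = k \<and> ?I (Suc k) (set_var s' aI (Suc k)))"
      unfolding e1 e2 by (rule c)
    show "runs W (Seq (Set aP (Get aL (Get 1 (Var aI)))) (Seq (Set aQ (Get aL (Get 2 (Var aI))))
       (Cond (Var aP =e Var aQ) Skip (Seq (Put aU (Var aI) (Const 1)) relabel_prog)))) s' (n0 * 40 + 80)
       (\<lambda>s'. s' aI 0 = k \<and> ?I (Suc k) (set_var s' aI (Suc k)))"
      by (rule runs_le, rule runs_Set[OF _ runs_Set[OF _ c']])
        (use k uvL uvk Lk W less_imp_le[OF Lk[of "u k"]] less_imp_le[OF Lk[of "v k"]] in \<open>auto intro: order_trans[of _ n0]\<close>)
  qed (use h s W U in \<open>auto simp: agree_off_def algebra_simps\<close>)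
  have "runs W tree_prog s (n0 * 20 + 20 + (n1 * (n0 * 40 + 92) + 20)) (?I n1)"
    unfolding tree_prog_def by (rule runs_Seq[OF run_label r2]) (use s W in auto)
  then show ?thesis by (rule runs_mono) auto
qed

text \<open>Padding rows are marked as used, like the tree edges before, so that pivots occur only
  in sentinel rows.\<close>

definition padrow_prog :: prog where
  "padrow_prog = For aI (Var aN) (Cond (Var aI <e cE) Skip (Put aU (Var aI) (Const 1)))"

lemma run_padrow:
  assumes s: "s aN 0 = N" "s 0 1 = n1" and W: "N + n1 + 2 \<le> W"
  shows "runs W padrow_prog s (N * 40 + 20) (\<lambda>s'. agree_off {aI, aU} s' s \<and>
     (\<forall>e<N. s' aU e = (if e < n1 then s aU e else 1)))"
  unfolding padrow_prog_def
proof (rule runs_mono, rule run_For[where m = N and C = 25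
      and I = "\<lambda>k s'. agree_off {aI, aU} s' s \<and> s' aI 0 = k \<and>
        (\<forall>e<N. s' aU e = (if e < n1 \<or> k \<le> e then s aU e else 1))"])
  fix k s' assume k: "k \<le> N" "agree_off {aI, aU} s' s \<and> s' aI 0 = k \<and>
        (\<forall>e<N. s' aU e = (if e < n1 \<or> k \<le> e then s aU e else 1))"
  then have "s' aN = s aN" by (auto simp: agree_off_def)
  then show "s' aI 0 = k \<and> fits W (Var aN) s' \<and> expr_val (Var aN) s' = N" using k s W by simp
next
  fix k s' assume k: "k < N" "agree_off {aI, aU} s' s \<and> s' aI 0 = k \<and>
        (\<forall>e<N. s' aU e = (if e < n1 \<or> k \<le> e then s aU e else 1))"
  then have "s' 0 = s 0" by (auto simp: agree_off_def)
  then show "runs W (Cond (Var aI <e cE) Skip (Put aU (Var aI) (Const 1))) s' 25 (\<lambda>s'. s' aI 0 = k \<and>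
      agree_off {aI, aU} (set_var s' aI (Suc k)) s \<and> set_var s' aI (Suc k) aI 0 = Suc k \<and>
      (\<forall>e<N. set_var s' aI (Suc k) aU e = (if e < n1 \<or> Suc k \<le> e then s aU e else 1)))"
    using W k s by (auto simp: agree_off_def)
qed (use s W in \<open>auto simp: agree_off_def\<close>)

abbreviation (input) mem_expr :: "nat \<Rightarrow> expr" where
  "mem_expr a \<equiv> (Get a (Var aI) =e Get 3 (Var aJ)) +e (Get a (Var aI) =e Get 4 (Var aJ)) +e (Get a (Var aI) =e Get 5 (Var aJ))"

text \<open>The sums in \<open>mem_expr\<close> act as disjunctions with value 0 or 1, because the
  three vertices of a triangle are distinct.\<close>

definition incidence_prog :: prog where
  "incidence_prog = For aI cE (For aJ cF (Put aM (Var aI *e Var aN +e Var aJ)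
     ((Get aU (Var aI) =e Const 0) *e (mem_expr 1 *e mem_expr 2))))"

lemma run_incidence:
  assumes s: "s aN 0 = N" "s 0 1 = n1" "s 0 2 = n2"
    and uv: "\<And>e. e < n1 \<Longrightarrow> s 1 e = u e \<and> s 2 e = v e \<and> u e < n0 \<and> v e < n0"
    and xyz: "\<And>f. f < n2 \<Longrightarrow> s 3 f = x f \<and> s 4 f = y f \<and> s 5 f = z f \<and> x f < n0 \<and> y f < n0 \<and> z f < n0"
    and dist: "\<And>f. f < n2 \<Longrightarrow> x f \<noteq> y f \<and> x f \<noteq> z f \<and> y f \<noteq> z f"
    and U: "\<And>e. e < n1 \<Longrightarrow> s aU e = of_bool (e \<in> U)"
    and N: "n1 + n2 \<le> N" and W: "n0 + N * N + 2 * N + 10 \<le> W" and M: "\<And>i. s aM i = 0"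
  shows "runs W incidence_prog s (n1 * (n2 * 90 + 40) + 20) (\<lambda>s'. agree_off {aI, aJ, aM} s' s \<and>
     holds_matrix N s' (\<lambda>i j. of_bool (i < n1 \<and> j < n2 \<and> i \<notin> U \<and> {u i, v i} \<subseteq> {x j, y j, z j})))"
  unfolding incidence_prog_def
proof (rule runs_mono, rule run_fill[where m = n1 and m' = n2 and f = "\<lambda>i j. i * N + j"
      and g = "\<lambda>i j. of_bool (i \<notin> U \<and> {u i, v i} \<subseteq> {x j, y j, z j})"])
  fix i j s' assume ij: "i < n1" "j < n2" "s' aI 0 = i" "s' aJ 0 = j" "agree_off {aI, aJ, aM} s' s"
  have le: "i * N + j < N * N" using ij N by (intro mult_add_less) auto
  have mem: "of_bool (w = x j) + of_bool (w = y j) + of_bool (w = z j) = (of_bool (w \<in> {x j, y j, z j}) :: nat)" for w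
    using dist[OF ij(2)] by auto
  have memW: "of_bool (w = x j) + of_bool (w = y j) \<le> W" for w
    using W by (auto simp: of_bool_def)
  note uv' = uv[OF ij(1)] and xyz' = xyz[OF ij(2)] and U' = U[OF ij(1)]
  have W1: "of_bool b \<le> W" for b using W by (auto simp: of_bool_def)
  show "fits W (Var aI *e Var aN +e Var aJ) s' \<and>
     fits W ((Get aU (Var aI) =e Const 0) *e (mem_expr 1 *e mem_expr 2)) s' \<and>
     expr_val (Var aI *e Var aN +e Var aJ) s' = i * N + j \<and>
     expr_val ((Get aU (Var aI) =e Const 0) *e (mem_expr 1 *e mem_expr 2)) s'
     = of_bool (i \<notin> U \<and> {u i, v i} \<subseteq> {x j, y j, z j})"
    using ij(1,2) le W N W1 uv' xyz' memW
    by (simp add: agree_offD[OF ij(5)] ij(3,4) s U' mem flip: of_bool_conj)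
next
  fix i j i' j' assume "i < n1" "j < n2" "i' < n1" "j' < n2" "i * N + j = i' * N + j'"
  then show "i = i' \<and> j = j'" using N mult_add_inj[of j N j' i i'] by auto
next
  fix s' assume h: "agree_off {aI, aJ, aM} s' s \<and>
     (\<forall>i<n1. \<forall>j<n2. s' aM (i * N + j) = of_bool (i \<notin> U \<and> {u i, v i} \<subseteq> {x j, y j, z j})) \<and>
     (\<forall>w. (\<forall>i<n1. \<forall>j<n2. w \<noteq> i * N + j) \<longrightarrow> s' aM w = s aM w)"
  have "s' aM (i * N + j) = of_bool (i < n1 \<and> j < n2 \<and> i \<notin> U \<and> {u i, v i} \<subseteq> {x j, y j, z j})"
    if "i < N" "j < N" for i j
  proof (cases "i < n1 \<and> j < n2")
    case True
    then show ?thesis using h by auto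
  next
    case False
    have "i * N + j \<noteq> i' * N + j'" if "i' < n1" "j' < n2" for i' j'
      using that False \<open>j < N\<close> N mult_add_inj[of j N j' i i'] by auto
    then have "s' aM (i * N + j) = s aM (i * N + j)" using h by blast
    then show ?thesis using False M by auto
  qed
  then show "agree_off {aI, aJ, aM} s' s \<and>
     holds_matrix N s' (\<lambda>i j. of_bool (i < n1 \<and> j < n2 \<and> i \<notin> U \<and> {u i, v i} \<subseteq> {x j, y j, z j}))"
    using h by (simp add: holds_matrix_def)
qed (use s W N in \<open>auto simp: agree_off_def algebra_simps\<close>)

text \<open>The exponent is a constant of the given multiplication program, so the power is unrolled
  in the program text.\<close>

primrec pow_prog :: "nat \<Rightarrow> prog" where
  "pow_prog 0 = Set aD (Const 1)"
| "pow_prog (Suc k) = Seq (pow_prog k) (Set aD (Var aD *e (Var aN +e Const 2)))"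

definition stride_prog :: "nat \<Rightarrow> prog" where
  "stride_prog c = Seq (pow_prog (c + 2)) (Set aD (Var aD +e Const 1))"

lemma run_pow:
  assumes "s aN 0 = N" "(N + 2) ^ k + N + 2 \<le> W"
  shows "runs W (pow_prog k) s (k * 10 + 10) (\<lambda>s'. agree_off {aD} s' s \<and> s' aD 0 = (N + 2) ^ k)"
  using assms(2)
proof (induction k)
  case (Suc k)
  have le: "(N + 2) ^ k \<le> (N + 2) ^ Suc k" by (intro power_increasing) auto
  have IH: "runs W (pow_prog k) s (k * 10 + 10) (\<lambda>s'. agree_off {aD} s' s \<and> s' aD 0 = (N + 2) ^ k)"
    by (rule Suc.IH) (use le Suc.prems in linarith)
  have "runs W (pow_prog (Suc k)) s (k * 10 + 10 + 10) (\<lambda>s'. agree_off {aD} s' s \<and> s' aD 0 = (N + 2) ^ Suc k)"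
    unfolding pow_prog.simps
  proof (rule runs_Seq[OF IH])
    fix s' assume h: "agree_off {aD} s' s \<and> s' aD 0 = (N + 2) ^ k"
    then have "s' aN 0 = N" using assms(1) by (auto simp: agree_off_def)
    then show "runs W (Set aD (Var aD *e (Var aN +e Const 2))) s' 10
       (\<lambda>s'. agree_off {aD} s' s \<and> s' aD 0 = (N + 2) ^ Suc k)"
      using h Suc.prems le by (auto simp: agree_off_def mult.commute)
  qed
  then show ?case by simp
qed (use assms in \<open>simp add: agree_off_def\<close>)

lemma run_stride:
  assumes "s aN 0 = N" "(N + 2) ^ (c + 2) + N + 2 \<le> W"
  shows "runs W (stride_prog c) s (c * 10 + 50) (\<lambda>s'. agree_off {aD} s' s \<and> s' aD 0 = (N + 2) ^ (c + 2) + 1)"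
proof -
  have "runs W (stride_prog c) s ((c + 2) * 10 + 10 + 10) (\<lambda>s'. agree_off {aD} s' s \<and> s' aD 0 = (N + 2) ^ (c + 2) + 1)"
    unfolding stride_prog_def
  proof (rule runs_Seq[OF run_pow[where N = N]])
    fix s' assume h: "agree_off {aD} s' s \<and> s' aD 0 = (N + 2) ^ (c + 2)"
    show "runs W (Set aD (Var aD +e Const 1)) s' 10
       (\<lambda>s'. agree_off {aD} s' s \<and> s' aD 0 = (N + 2) ^ (c + 2) + 1)"
      using h assms(2) by (auto simp: agree_off_def)
  qed (use assms in auto)
  then show ?thesis by (rule runs_le) simp
qed

section \<open>Reading off the annotations, and the complete program\<close>

definition rows_prog :: prog where
  "rows_prog = For aI cE (Cond (Get aU (Var aI) =e Const 0)
     (Seq (Put aH (Var 6) (Var aI)) (Set 6 (Var 6 +e Const 1))) Skip)"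

lemma run_rows:
  assumes s: "s 0 1 = n1" "s 6 0 = 0" and U: "\<And>e. e < n1 \<Longrightarrow> s aU e = of_bool (e \<in> U)" and W: "n1 + 2 \<le> W"
  shows "runs W rows_prog s (n1 * 50 + 20) (\<lambda>s'. agree_off {aI, aH, 6} s' s \<and>
     (let hs = filter (\<lambda>i. i \<notin> U) [0..<n1] in s' 6 0 = length hs \<and> (\<forall>j<length hs. s' aH j = hs ! j)))"
  unfolding rows_prog_def
proof (rule runs_mono, rule run_For[where m = n1 and C = 35
      and I = "\<lambda>k s'. agree_off {aI, aH, 6} s' s \<and> s' aI 0 = k \<and>
        (let hs = filter (\<lambda>i. i \<notin> U) [0..<k] in s' 6 0 = length hs \<and> (\<forall>j<length hs. s' aH j = hs ! j))"])
  fix k s' assume k: "k \<le> n1" "agree_off {aI, aH, 6} s' s \<and> s' aI 0 = k \<and>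
        (let hs = filter (\<lambda>i. i \<notin> U) [0..<k] in s' 6 0 = length hs \<and> (\<forall>j<length hs. s' aH j = hs ! j))"
  then have "s' 0 = s 0" by (auto simp: agree_off_def)
  then show "s' aI 0 = k \<and> fits W cE s' \<and> expr_val cE s' = n1" using k s W by simp
next
  fix k s' assume k: "k < n1" "agree_off {aI, aH, 6} s' s \<and> s' aI 0 = k \<and>
        (let hs = filter (\<lambda>i. i \<notin> U) [0..<k] in s' 6 0 = length hs \<and> (\<forall>j<length hs. s' aH j = hs ! j))"
  have "s' aU = s aU" using k by (auto simp: agree_off_def)
  moreover have "length (filter (\<lambda>i. i \<notin> U) [0..<k]) \<le> k" using length_filter_le[of _ "[0..<k]"] by simp
  ultimately show "runs W (Cond (Get aU (Var aI) =e Const 0)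
     (Seq (Put aH (Var 6) (Var aI)) (Set 6 (Var 6 +e Const 1))) Skip) s' 35 (\<lambda>s'. s' aI 0 = k \<and>
      agree_off {aI, aH, 6} (set_var s' aI (Suc k)) s \<and> set_var s' aI (Suc k) aI 0 = Suc k \<and>
      (let hs = filter (\<lambda>i. i \<notin> U) [0..<Suc k] in set_var s' aI (Suc k) 6 0 = length hs \<and>
         (\<forall>j<length hs. set_var s' aI (Suc k) aH j = hs ! j)))"
    using W k U[of k] by (auto simp: agree_off_def Let_def nth_append)
qed (use s W in \<open>auto simp: agree_off_def Let_def\<close>)

definition inverse_prog :: prog where
  "inverse_prog = For aJ (Var aN) (Cond (Get aV (Var aJ))
     (Put aW (Get aV (Var aJ) -e Const 1) (Var aJ +e Const 1)) Skip)"

lemma run_inverse: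
  assumes s: "s aN 0 = N" and V: "\<And>x. x < N \<Longrightarrow> s aV x = pcode (pvf x)" and pvf: "\<And>x r. pvf x = Some r \<Longrightarrow> r < N"
    and inj: "\<And>x x' r. pvf x = Some r \<Longrightarrow> pvf x' = Some r \<Longrightarrow> x = x'" and W: "2 * N + 2 \<le> W" and Z: "\<And>x. s aW x = 0"
  shows "runs W inverse_prog s (N * 50 + 20) (\<lambda>s'. agree_off {aJ, aW} s' s \<and>
     (\<forall>x<N. \<forall>r. pvf x = Some r \<longrightarrow> s' aW r = Suc x) \<and> (\<forall>r. (\<forall>x<N. pvf x \<noteq> Some r) \<longrightarrow> s' aW r = 0))"
  unfolding inverse_prog_def
proof (rule runs_mono, rule run_For[where m = N and C = 35
      and I = "\<lambda>k s'. agree_off {aJ, aW} s' s \<and> s' aJ 0 = k \<and>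
     (\<forall>x<k. \<forall>r. pvf x = Some r \<longrightarrow> s' aW r = Suc x) \<and> (\<forall>r. (\<forall>x<k. pvf x \<noteq> Some r) \<longrightarrow> s' aW r = 0)"])
  fix k s' assume k: "k \<le> N" "agree_off {aJ, aW} s' s \<and> s' aJ 0 = k \<and>
     (\<forall>x<k. \<forall>r. pvf x = Some r \<longrightarrow> s' aW r = Suc x) \<and> (\<forall>r. (\<forall>x<k. pvf x \<noteq> Some r) \<longrightarrow> s' aW r = 0)"
  then have "s' aN = s aN" by (auto simp: agree_off_def)
  then show "s' aJ 0 = k \<and> fits W (Var aN) s' \<and> expr_val (Var aN) s' = N" using k s W by simp
next
  fix k s' assume k: "k < N" "agree_off {aJ, aW} s' s \<and> s' aJ 0 = k \<and>
     (\<forall>x<k. \<forall>r. pvf x = Some r \<longrightarrow> s' aW r = Suc x) \<and> (\<forall>r. (\<forall>x<k. pvf x \<noteq> Some r) \<longrightarrow> s' aW r = 0)"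
  have V': "s' aV k = pcode (pvf k)" using k V by (auto simp: agree_off_def)
  show "runs W (Cond (Get aV (Var aJ))
     (Put aW (Get aV (Var aJ) -e Const 1) (Var aJ +e Const 1)) Skip) s' 35 (\<lambda>s'. s' aJ 0 = k \<and>
      agree_off {aJ, aW} (set_var s' aJ (Suc k)) s \<and> set_var s' aJ (Suc k) aJ 0 = Suc k \<and>
      (\<forall>x<Suc k. \<forall>r. pvf x = Some r \<longrightarrow> set_var s' aJ (Suc k) aW r = Suc x) \<and>
      (\<forall>r. (\<forall>x<Suc k. pvf x \<noteq> Some r) \<longrightarrow> set_var s' aJ (Suc k) aW r = 0))"
  proof (cases "pvf k")
    case None
    then show ?thesis using W k V' by (auto simp: agree_off_def pcode_def less_Suc_eq)
  next
    case (Some q)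
    have "pvf x \<noteq> Some q" if "x < k" for x using inj[OF Some, of x] that by auto
    then show ?thesis using W k V' Some pvf[OF Some] by (auto simp: agree_off_def pcode_def less_Suc_eq)
  qed
qed (use s W Z in \<open>auto simp: agree_off_def\<close>)

text \<open>The two summands need no reduction modulo 2: a row without pivot has \<open>aW\<close>
  equal to 0, so at most one of them is nonzero.\<close>

definition out_prog :: prog where
  "out_prog = For aI cE (For aJ (Var 6) (Put 7 (Var aI *e Var 6 +e Var aJ)
     ((Var aI =e Get aH (Var aJ)) +e ((Const 0 <e Get aW (Var aI)) *e
       Get aM (Get aH (Var aJ) *e Var aN +e (Get aW (Var aI) -e Const 1))))))"

lemma run_out:
  assumes s: "s aN 0 = N" "s 0 1 = n1" "s 6 0 = g" and H: "\<And>j. j < g \<Longrightarrow> s aH j = h j \<and> h j < n1 \<and> s aW (h j) = 0"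
    and Wd: "\<And>i. i < n1 \<Longrightarrow> s aW i \<le> N" and M: "holds_matrix N s A" and N: "1 \<le> N" "n1 \<le> N" "g \<le> N"
    and W: "2 * (N * N) + 2 * N + 10 \<le> W"
  shows "runs W out_prog s (n1 * (g * 60 + 40) + 20) (\<lambda>s'. agree_off {aI, aJ, 7} s' s \<and>
     (\<forall>i<n1. \<forall>j<g. s' 7 (i * g + j) = bit_nat (of_bool (i = h j) + of_bool (0 < s aW i) * A (h j) (s aW i - 1))))"
  unfolding out_prog_def
proof (rule runs_mono, rule run_fill[where m = n1 and m' = g and f = "\<lambda>i j. i * g + j"
      and g = "\<lambda>i j. bit_nat (of_bool (i = h j) + of_bool (0 < s aW i) * A (h j) (s aW i - 1))"])
  fix i j s' assume ij: "i < n1" "j < g" "s' aI 0 = i" "s' aJ 0 = j" "agree_off {aI, aJ, 7} s' s"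
  have "i * g + j < n1 * g" using ij by (intro mult_add_less)
  also have "\<dots> \<le> N * N" using N by (intro mult_le_mono)
  finally have le: "i * g + j < N * N" .
  note H' = H[OF ij(2)] and Wd' = Wd[OF ij(1)]
  have le2: "h j * N + (s aW i - 1) < N * N" using H' Wd' N by (intro mult_add_less) auto
  have m: "s aM (h j * N + (s aW i - Suc 0)) = bit_nat (A (h j) (s aW i - 1))"
    using M H' Wd' N by (auto simp: holds_matrix_def)
  have W1: "of_bool b \<le> W" "bit_nat x \<le> W" "of_bool b * bit_nat x \<le> W" "of_bool a + of_bool b * bit_nat x \<le> W" for a b x
    using W bit_nat_simps(5)[of x] by (auto simp: of_bool_def)
  have v: "of_bool (i = h j) + of_bool (0 < s aW i) * bit_nat (A (h j) (s aW i - 1))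
     = bit_nat (of_bool (i = h j) + of_bool (0 < s aW i) * A (h j) (s aW i - 1))"
    using H' by auto
  show "fits W (Var aI *e Var 6 +e Var aJ) s' \<and>
     fits W ((Var aI =e Get aH (Var aJ)) +e ((Const 0 <e Get aW (Var aI)) *e
       Get aM (Get aH (Var aJ) *e Var aN +e (Get aW (Var aI) -e Const 1)))) s' \<and>
     expr_val (Var aI *e Var 6 +e Var aJ) s' = i * g + j \<and>
     expr_val ((Var aI =e Get aH (Var aJ)) +e ((Const 0 <e Get aW (Var aI)) *e
       Get aM (Get aH (Var aJ) *e Var aN +e (Get aW (Var aI) -e Const 1)))) s'
     = bit_nat (of_bool (i = h j) + of_bool (0 < s aW i) * A (h j) (s aW i - 1))"
    unfolding v[symmetric] using ij(1,2) le le2 W N W1 H' Wd'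
    by (simp add: agree_offD[OF ij(5)] ij(3,4) s m del: bit_nat_simps)
next
  fix i j i' j' assume "j < g" "j' < g" "i * g + j = i' * g + j'"
  then show "i = i' \<and> j = j'" using mult_add_inj by blast
qed (use s W N in \<open>auto simp: agree_off_def algebra_simps\<close>)

context solver begin

lemma run_solve:
  assumes s: "progress 0 s" "s aB 0 = 0" "s aO 0 = 0" "holds_matrix N s M" "fresh s 0" and q: "N = 2 ^ q"
    and W2: "2 * N * (N * stride) \<le> W"
  shows "runs W (Loop (Var aB <e Var aN) (step_prog P)) s (block_time q + 10) (\<lambda>s'.
     agree_off scratch s' s \<and> progress N s' \<and> holds_matrix N s' (At N))"
proof -
  have dv: "2 ^ k dvd N" if "2 ^ k \<le> N" for k
  proof -
    have "k \<le> q" using that q by simp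
    then show ?thesis using q by (simp add: le_imp_power_dvd)
  qed
  have off: "0 + (2 * 2 ^ q - 2) * (N * stride) \<le> W"
    using order_trans[OF mult_le_mono1[of "2 * N - 2" "2 * N" "N * stride"] W2] unfolding q[symmetric] by simp
  have q': "0 + 2 ^ q = N" using q by simp
  have "\<exists>T s' off'. iterates W (Var aB <e Var aN) (step_prog P) s T s' \<and> T \<le> block_time q \<and>
     agree_off scratch s' s \<and> progress (0 + 2 ^ q) s' \<and> s' aB 0 = 2 ^ q \<and>
     holds_matrix N s' (\<lambda>i x. if x \<in> {0..<0 + 2 ^ q} then At (0 + 2 ^ q) i x else M i x) \<and>
     s' aO 0 = off' \<and> fresh s' off' \<and> off' \<le> 0 + (2 * 2 ^ q - 2) * (N * stride)"
    by (rule iterate_blocks[OF _ _ dv s(1,2,4) _ s(3,5) off]) (use q' in \<open>simp_all add: At_0\<close>)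
  then have "\<exists>T s' off'. iterates W (Var aB <e Var aN) (step_prog P) s T s' \<and> T \<le> block_time q \<and>
     agree_off scratch s' s \<and> progress N s' \<and> s' aB 0 = N \<and>
     holds_matrix N s' (\<lambda>i x. if x \<in> {0..<N} then At N i x else M i x) \<and>
     s' aO 0 = off' \<and> fresh s' off' \<and> off' \<le> 0 + (2 * N - 2) * (N * stride)"
    by (simp only: q[symmetric] add_0)
  then obtain T s' where T: "iterates W (Var aB <e Var aN) (step_prog P) s T s'" "T \<le> block_time q"
     "agree_off scratch s' s" "progress N s'" "s' aB 0 = N"
     "holds_matrix N s' (\<lambda>i x. if x \<in> {0..<N} then At N i x else M i x)"
    by blast
  have M: "holds_matrix N s' (At N)" using T(6) by (simp add: holds_matrix_def)
  have "exec W (Loop (Var aB <e Var aN) (step_prog P)) s (T + (expr_cost (Var aB <e Var aN) + 1)) s'"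
    using T(4,5) NW by (intro iterates_exit[OF T(1)]) (auto simp: progress_def)
  then show ?thesis unfolding run_def using T(2,3,4) M by (intro exI conjI) auto
qed

end

definition full_prog :: "prog \<Rightarrow> nat \<Rightarrow> prog" where
  "full_prog P c = Seq pad_prog (Seq tree_prog (Seq padrow_prog (Seq incidence_prog (Seq (stride_prog c)
     (Seq (Loop (Var aB <e Var aN) (step_prog P)) (Seq rows_prog (Seq inverse_prog out_prog)))))))"

text \<open>Entry \<open>(h, i)\<close> of the accumulated row transformation, for a row
  \<open>h\<close> without pivot: the identity part plus the column stored in place of the pivot
  column of row \<open>i\<close>. Rows that never became pivot rows were never added to
  others.\<close>

definition annotation_bit :: "(nat \<Rightarrow> nat \<Rightarrow> bit) \<Rightarrow> (nat \<Rightarrow> nat option) \<Rightarrow> nat \<Rightarrow> nat \<Rightarrow> nat \<Rightarrow> bit" where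
  "annotation_bit A pvf N h i = of_bool (i = h) +
     (if \<exists>x<N. pvf x = Some i then A h (THE x. x < N \<and> pvf x = Some i) else 0)"

context solver begin

lemma run_eliminate_and_output:
  assumes s: "s aN 0 = N" "s 0 1 = n1" "s aD 0 = stride" "holds_matrix N s M"
    and U: "\<And>e. e < N \<Longrightarrow> s aU e = of_bool (e \<in> U0)"
    and zero: "\<And>a x. a \<in> {6, aB, aO, aT, aV, aW} \<union> {dM..} \<Longrightarrow> s a x = 0"
    and q: "N = 2 ^ q" and n1: "n1 \<le> N" and pads: "{n1..<N} \<subseteq> U0" and W2: "2 * N * (N * stride) \<le> W"
  shows "runs W (Seq (Loop (Var aB <e Var aN) (step_prog P)) (Seq rows_prog (Seq inverse_prog out_prog))) s
     (block_time q + n1 * (n1 * 60 + 90) + N * 50 + 70)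
     (\<lambda>s'. let hs = filter (\<lambda>i. i \<notin> Ut N) [0..<n1] in s' 6 0 = length hs \<and>
       (\<forall>i<n1. \<forall>j<length hs. s' 7 (i * length hs + j) = bit_nat (annotation_bit (At N) pv N (hs ! j) i)))"
proof -
  define hs where "hs = filter (\<lambda>i. i \<notin> Ut N) [0..<n1]"
  have len: "length hs \<le> n1" using length_filter_le[of _ "[0..<n1]"] by (simp add: hs_def)
  have hs: "hs ! j < n1 \<and> hs ! j \<notin> Ut N" if "j < length hs" for j
  proof -
    have "hs ! j \<in> set hs" using that by simp
    then show ?thesis unfolding hs_def by simp
  qed
  have pg: "progress 0 s" using s U zero by (auto simp: progress_def Ut_0)
  have r1: "runs W (Loop (Var aB <e Var aN) (step_prog P)) s (block_time q + 10) (\<lambda>s'.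
     agree_off scratch s' s \<and> progress N s' \<and> holds_matrix N s' (At N))"
    by (rule run_solve) (use pg s zero q W2 in \<open>auto simp: fresh_def\<close>)
  have r2: "runs W rows_prog s1 (n1 * 50 + 20) (\<lambda>s'. agree_off (scratch \<union> {6, aH}) s' s \<and> progress N s' \<and>
      holds_matrix N s' (At N) \<and> s' 6 0 = length hs \<and> (\<forall>j<length hs. s' aH j = hs ! j))"
    if h: "agree_off scratch s1 s \<and> progress N s1 \<and> holds_matrix N s1 (At N)" for s1
  proof (rule runs_mono, rule run_rows[where U = "Ut N"])
    fix s' assume "agree_off {aI, aH, 6} s' s1 \<and>
      (let hs = filter (\<lambda>i. i \<notin> Ut N) [0..<n1] in s' 6 0 = length hs \<and> (\<forall>j<length hs. s' aH j = hs ! j))"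
    then show "agree_off (scratch \<union> {6, aH}) s' s \<and> progress N s' \<and>
      holds_matrix N s' (At N) \<and> s' 6 0 = length hs \<and> (\<forall>j<length hs. s' aH j = hs ! j)"
      using h unfolding hs_def[symmetric] by (auto simp: agree_off_def progress_def holds_matrix_def Let_def)
  qed (use h s n1 NW zero in \<open>auto simp: agree_off_def progress_def\<close>)
  have r3: "runs W inverse_prog s1 (N * 50 + 20) (\<lambda>s'. s' aN 0 = N \<and> s' 0 1 = n1 \<and>
      holds_matrix N s' (At N) \<and> s' 6 0 = length hs \<and> (\<forall>j<length hs. s' aH j = hs ! j) \<and>
      (\<forall>x<N. \<forall>r. pv x = Some r \<longrightarrow> s' aW r = Suc x) \<and> (\<forall>r. (\<forall>x<N. pv x \<noteq> Some r) \<longrightarrow> s' aW r = 0))"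
    if h: "agree_off (scratch \<union> {6, aH}) s1 s \<and> progress N s1 \<and>
      holds_matrix N s1 (At N) \<and> s1 6 0 = length hs \<and> (\<forall>j<length hs. s1 aH j = hs ! j)" for s1
  proof (rule runs_mono, rule run_inverse[where pvf = pv])
    show "s1 aW x = 0" for x using h zero[of aW x] by (simp add: agree_off_def)
    fix s' assume "agree_off {aJ, aW} s' s1 \<and>
      (\<forall>x<N. \<forall>r. pv x = Some r \<longrightarrow> s' aW r = Suc x) \<and> (\<forall>r. (\<forall>x<N. pv x \<noteq> Some r) \<longrightarrow> s' aW r = 0)"
    then show "s' aN 0 = N \<and> s' 0 1 = n1 \<and>
      holds_matrix N s' (At N) \<and> s' 6 0 = length hs \<and> (\<forall>j<length hs. s' aH j = hs ! j) \<and>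
      (\<forall>x<N. \<forall>r. pv x = Some r \<longrightarrow> s' aW r = Suc x) \<and> (\<forall>r. (\<forall>x<N. pv x \<noteq> Some r) \<longrightarrow> s' aW r = 0)"
      using h s by (auto simp: agree_off_def progress_def holds_matrix_def)
  qed (use h NW pv_Some pv_inj in \<open>auto simp: progress_def\<close>)
  have r4: "runs W out_prog s1 (n1 * (n1 * 60 + 40) + 20)
     (\<lambda>s'. s' 6 0 = length hs \<and>
       (\<forall>i<n1. \<forall>j<length hs. s' 7 (i * length hs + j) = bit_nat (annotation_bit (At N) pv N (hs ! j) i)))"
    if h: "s1 aN 0 = N \<and> s1 0 1 = n1 \<and>
      holds_matrix N s1 (At N) \<and> s1 6 0 = length hs \<and> (\<forall>j<length hs. s1 aH j = hs ! j) \<and>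
      (\<forall>x<N. \<forall>r. pv x = Some r \<longrightarrow> s1 aW r = Suc x) \<and> (\<forall>r. (\<forall>x<N. pv x \<noteq> Some r) \<longrightarrow> s1 aW r = 0)" for s1
  proof -
    have unp: "pv x \<noteq> Some r" if "r \<notin> Ut N" "x < N" for r x using that by (auto simp: Ut_eq)
    have bit: "of_bool (i = h) + of_bool (0 < s1 aW i) * At N h (s1 aW i - 1) = annotation_bit (At N) pv N h i" for i h
    proof (cases "\<exists>x<N. pv x = Some i")
      case True
      then obtain x where x: "x < N" "pv x = Some i" by blast
      then have "(THE x. x < N \<and> pv x = Some i) = x" using pv_inj by blast
      moreover have "s1 aW i = Suc x" using h x by blast
      ultimately show ?thesis using True by (simp add: annotation_bit_def)
    next
      case False
      then have "s1 aW i = 0" using h by blast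
      then show ?thesis using False by (auto simp: annotation_bit_def)
    qed
    have Wd: "s1 aW i \<le> N" for i
    proof (cases "\<exists>x<N. pv x = Some i")
      case True
      then obtain x where x: "x < N" "pv x = Some i" by blast
      then have "s1 aW i = Suc x" using h by blast
      then show ?thesis using x by simp
    next
      case False
      then have "s1 aW i = 0" using h by blast
      then show ?thesis by simp
    qed
    have H: "s1 aH j = hs ! j \<and> hs ! j < n1 \<and> s1 aW (hs ! j) = 0" if "j < length hs" for j
      using h hs[OF that] unp that by blast
    have "length hs \<le> N" using len n1 by simp
    have W': "2 * (N * N) + 2 * N + 10 \<le> W" using W mult_le_mono2[OF N1, of N] by linarith
    show ?thesis
    proof (rule runs_mono, rule run_out[where g = "length hs" and h = "(!) hs" and A = "At N" and N = N and ?n1.0 = n1])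
      show "n1 * (length hs * 60 + 40) + 20 \<le> n1 * (n1 * 60 + 40) + 20" using len by simp
      fix s' assume "agree_off {aI, aJ, 7} s' s1 \<and>
       (\<forall>i<n1. \<forall>j<length hs. s' 7 (i * length hs + j) =
          bit_nat (of_bool (i = hs ! j) + of_bool (0 < s1 aW i) * At N (hs ! j) (s1 aW i - 1)))"
      then show "s' 6 0 = length hs \<and>
       (\<forall>i<n1. \<forall>j<length hs. s' 7 (i * length hs + j) = bit_nat (annotation_bit (At N) pv N (hs ! j) i))"
        using h unfolding bit by (auto simp: agree_off_def)
    qed (use h H Wd W' N1 n1 \<open>length hs \<le> N\<close> in auto)
  qed
  have "runs W (Seq (Loop (Var aB <e Var aN) (step_prog P)) (Seq rows_prog (Seq inverse_prog out_prog))) s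
     ((block_time q + 10) + ((n1 * 50 + 20) + ((N * 50 + 20) + (n1 * (n1 * 60 + 40) + 20))))
     (\<lambda>s'. s' 6 0 = length hs \<and>
       (\<forall>i<n1. \<forall>j<length hs. s' 7 (i * length hs + j) = bit_nat (annotation_bit (At N) pv N (hs ! j) i)))"
    by (rule runs_Seq[OF r1], rule runs_Seq[OF r2], assumption, rule runs_Seq[OF r3], assumption, rule r4, assumption)
  then show ?thesis by (rule runs_mono) (auto simp: hs_def Let_def algebra_simps)
qed

end

definition tree_edges :: "(nat \<times> nat) list \<Rightarrow> nat set" where
  "tree_edges E = snd (kruskal (\<lambda>e. fst (E ! e)) (\<lambda>e. snd (E ! e)) (length E))"

text \<open>The boundary matrix with the tree rows replaced by zero rows. The restriction to
  sentinel rows is thus obtained without renumbering the edges.\<close>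

definition incidence :: "(nat \<times> nat) list \<Rightarrow> (nat \<times> nat \<times> nat) list \<Rightarrow> nat \<Rightarrow> nat \<Rightarrow> bit" where
  "incidence E F i j = of_bool (i < length E \<and> j < length F \<and> i \<notin> tree_edges E \<and>
     pair_edges E ! i \<subseteq> triple_triangles F ! j)"

text \<open>The time hypothesis ranges over all admissible powers of two, since the size is found
  only by \<open>pad_prog\<close> at run time.\<close>

lemma run_full:
  fixes E :: "(nat \<times> nat) list" and F :: "(nat \<times> nat \<times> nat) list"
  defines "n1 \<equiv> length E" and "n2 \<equiv> length F"
  assumes P: "multiplies P c time"
    and E: "\<And>u v. (u, v) \<in> set E \<Longrightarrow> u < n0 \<and> v < n0"
    and F: "\<And>x y z. (x, y, z) \<in> set F \<Longrightarrow> x < n0 \<and> y < n0 \<and> z < n0 \<and> x \<noteq> y \<and> x \<noteq> z \<and> y \<noteq> z"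
    and W: "\<And>N. N \<le> 2 * (n1 + n2) + 1 \<Longrightarrow>
       n0 + n1 + 4 * (N * N) + 4 * N + 10 + (2 * N * N + 1) * ((N + 2) ^ (c + 2) + 1) \<le> W"
    and T: "\<And>q. n1 + n2 \<le> 2 ^ q \<Longrightarrow> 2 ^ q \<le> 2 * (n1 + n2) + 1 \<Longrightarrow>
       solver.block_time time (2 ^ q) q + n1 * (n1 * 60 + n0 * 40 + n2 * 90 + 300) + n0 * 20 + n2 * 20 + 2 ^ q * 90 + c * 10 + 300 \<le> T"
  shows "runs W (full_prog P c) (load (complex_input n0 E F)) T (\<lambda>s. \<exists>N. n1 + n2 \<le> N \<and>
     (let M = incidence E F; U0 = tree_edges E \<union> {n1..<N};
          hs = filter (\<lambda>i. i \<notin> elimination.Ut N M U0 N) [0..<n1] in s 6 0 = length hs \<and>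
       (\<forall>i<n1. \<forall>j<length hs. s 7 (i * length hs + j) =
          bit_nat (annotation_bit (elimination.At N M U0 N) (elimination.pv N M U0) N (hs ! j) i))))"
proof -
  let ?s0 = "load (complex_input n0 E F)"
  let ?u = "\<lambda>e. fst (E ! e)" and ?v = "\<lambda>e. snd (E ! e)"
  let ?x = "\<lambda>f. fst (F ! f)" and ?y = "\<lambda>f. fst (snd (F ! f))" and ?z = "\<lambda>f. snd (snd (F ! f))"
  let ?Q = "\<lambda>s. \<exists>N. n1 + n2 \<le> N \<and>
     (let M = incidence E F; U0 = tree_edges E \<union> {n1..<N};
          hs = filter (\<lambda>i. i \<notin> elimination.Ut N M U0 N) [0..<n1] in s 6 0 = length hs \<and>
       (\<forall>i<n1. \<forall>j<length hs. s 7 (i * length hs + j) =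
          bit_nat (annotation_bit (elimination.At N M U0 N) (elimination.pv N M U0) N (hs ! j) i)))"
  have s0: "?s0 0 0 = n0" "?s0 0 1 = n1" "?s0 0 2 = n2"
    by (auto simp: load_def complex_input_def n1_def n2_def)
  have uv: "?s0 1 e = ?u e \<and> ?s0 2 e = ?v e \<and> ?u e < n0 \<and> ?v e < n0" if "e < n1" for e
    using that E[of "?u e" "?v e"] by (auto simp: load_def complex_input_def n1_def)
  have xyz: "?s0 3 f = ?x f \<and> ?s0 4 f = ?y f \<and> ?s0 5 f = ?z f \<and> ?x f < n0 \<and> ?y f < n0 \<and> ?z f < n0"
    and dist: "?x f \<noteq> ?y f \<and> ?x f \<noteq> ?z f \<and> ?y f \<noteq> ?z f" if "f < n2" for f
    using that F[of "?x f" "?y f" "?z f"] by (auto simp: load_def complex_input_def n2_def numeral_eq_Suc)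
  have z0: "?s0 a i = 0" if "6 \<le> a" for a i using that by (auto simp: load_def complex_input_def)
  have W0: "2 * (n1 + n2) + 2 \<le> W" "n0 + n1 + 2 \<le> W" using W[of "2 * (n1 + n2) + 1"] by auto
  have rest: "runs W (Seq tree_prog (Seq padrow_prog (Seq incidence_prog (Seq (stride_prog c)
     (Seq (Loop (Var aB <e Var aN) (step_prog P)) (Seq rows_prog (Seq inverse_prog out_prog))))))) (set_var ?s0 aN (2 ^ q))
     (T - ((n1 + n2) * 20 + 20)) ?Q"
    if q: "n1 + n2 \<le> 2 ^ q" "2 ^ q \<le> 2 * (n1 + n2) + 1" for q
  proof -
    define N :: nat where "N = 2 ^ q"
    have N1: "1 \<le> N" by (simp add: N_def)
    have Nn: "n1 + n2 \<le> N" "N \<le> 2 * (n1 + n2) + 1" using q by (auto simp: N_def)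
    define stride where "stride = (N + 2) ^ (c + 2) + 1"
    have WN: "n0 + n1 + 4 * (N * N) + 4 * N + 10 + (2 * N * N + 1) * stride \<le> W"
      using W[OF Nn(2)] by (simp add: stride_def)
    have WS: "2 * N * (N * stride) + stride + (n0 + n1 + 4 * (N * N) + 4 * N + 10) \<le> W"
      using WN by (simp add: algebra_simps)
    define TE where "TE = tree_edges E"
    define U0 where "U0 = TE \<union> {n1..<N}"
    interpret solver P c time N W stride "incidence E F" U0
      by unfold_locales (use P N1 WS in \<open>auto simp: stride_def\<close>)
    let ?s1 = "set_var ?s0 aN N"
    have r1: "runs W tree_prog ?s1 (n1 * (n0 * 40 + 92) + n0 * 20 + 50) (\<lambda>s'. agree_off {aI, aJ, aL, aP, aQ, aU} s' ?s1 \<and>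
       (\<forall>e. s' aU e = of_bool (e \<in> TE)))"
      unfolding TE_def tree_edges_def n1_def[symmetric]
      by (rule run_tree) (use s0 uv W0 z0 in auto)
    have r2: "runs W padrow_prog s1 (N * 40 + 20) (\<lambda>s'. agree_off {aI, aJ, aL, aP, aQ, aU} s' ?s1 \<and>
       (\<forall>e<N. s' aU e = of_bool (e \<in> U0)))"
      if h: "agree_off {aI, aJ, aL, aP, aQ, aU} s1 ?s1 \<and> (\<forall>e. s1 aU e = of_bool (e \<in> TE))" for s1
    proof (rule runs_mono, rule run_padrow[where N = N and ?n1.0 = n1])
      have sub: "TE \<subseteq> {..<n1}" unfolding TE_def tree_edges_def n1_def by (rule kruskal_subset)
      fix s' assume "agree_off {aI, aU} s' s1 \<and> (\<forall>e<N. s' aU e = (if e < n1 then s1 aU e else 1))"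
      then show "agree_off {aI, aJ, aL, aP, aQ, aU} s' ?s1 \<and> (\<forall>e<N. s' aU e = of_bool (e \<in> U0))"
        using h sub by (auto simp: agree_off_def U0_def)
    qed (use h s0 WN Nn in \<open>auto simp: agree_off_def\<close>)
    have r3: "runs W incidence_prog s1 (n1 * (n2 * 90 + 40) + 20) (\<lambda>s'. agree_off {aI, aJ, aL, aP, aQ, aU, aM} s' ?s1 \<and>
       (\<forall>e<N. s' aU e = of_bool (e \<in> U0)) \<and> holds_matrix N s' (incidence E F))"
      if h: "agree_off {aI, aJ, aL, aP, aQ, aU} s1 ?s1 \<and> (\<forall>e<N. s1 aU e = of_bool (e \<in> U0))" for s1
    proof (rule runs_mono, rule run_incidence[where N = N and ?n0.0 = n0 and ?n1.0 = n1 and ?n2.0 = n2 and u = ?u and v = ?v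
          and x = ?x and y = ?y and z = ?z and U = TE])
      have a: "s1 b = ?s1 b" if "b \<notin> {aI, aJ, aL, aP, aQ, aU}" for b using h that by (auto simp: agree_off_def)
      show "s1 aN 0 = N" "s1 0 1 = n1" "s1 0 2 = n2" "\<And>i. s1 aM i = 0" using a s0 z0 by auto
      show "s1 1 e = ?u e \<and> s1 2 e = ?v e \<and> ?u e < n0 \<and> ?v e < n0" if "e < n1" for e using a uv[OF that] by simp
      show "s1 3 f = ?x f \<and> s1 4 f = ?y f \<and> s1 5 f = ?z f \<and> ?x f < n0 \<and> ?y f < n0 \<and> ?z f < n0" if "f < n2" for f
        using a xyz[OF that] by simp
      show "s1 aU e = of_bool (e \<in> TE)" if "e < n1" for e using h that Nn by (auto simp: U0_def)
      fix s' assume h2: "agree_off {aI, aJ, aM} s' s1 \<and> holds_matrix N s' (\<lambda>i j. of_bool (i < n1 \<and> j < n2 \<and> i \<notin> TE \<and>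
         {?u i, ?v i} \<subseteq> {?x j, ?y j, ?z j}))"
      have "incidence E F i j = of_bool (i < n1 \<and> j < n2 \<and> i \<notin> TE \<and> {?u i, ?v i} \<subseteq> {?x j, ?y j, ?z j})" for i j
        by (auto simp: incidence_def n1_def n2_def TE_def pair_edges_def triple_triangles_def case_prod_beta)
      then have "holds_matrix N s' (incidence E F)" using h2 by (simp add: holds_matrix_def)
      then show "agree_off {aI, aJ, aL, aP, aQ, aU, aM} s' ?s1 \<and>
         (\<forall>e<N. s' aU e = of_bool (e \<in> U0)) \<and> holds_matrix N s' (incidence E F)"
        using h h2 by (auto simp: agree_off_def)
    qed (use dist Nn WN in auto)
    have r4: "runs W (stride_prog c) s1 (c * 10 + 50) (\<lambda>s'. agree_off {aI, aJ, aL, aP, aQ, aU, aM, aD} s' ?s1 \<and>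
       (\<forall>e<N. s' aU e = of_bool (e \<in> U0)) \<and> holds_matrix N s' (incidence E F) \<and> s' aD 0 = stride)"
      if h: "agree_off {aI, aJ, aL, aP, aQ, aU, aM} s1 ?s1 \<and>
         (\<forall>e<N. s1 aU e = of_bool (e \<in> U0)) \<and> holds_matrix N s1 (incidence E F)" for s1
    proof (rule runs_mono, rule run_stride[where N = N])
      show "(N + 2) ^ (c + 2) + N + 2 \<le> W" using WS unfolding stride_def by linarith
      fix s' assume "agree_off {aD} s' s1 \<and> s' aD 0 = (N + 2) ^ (c + 2) + 1"
      then show "agree_off {aI, aJ, aL, aP, aQ, aU, aM, aD} s' ?s1 \<and>
       (\<forall>e<N. s' aU e = of_bool (e \<in> U0)) \<and> holds_matrix N s' (incidence E F) \<and> s' aD 0 = stride"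
        using h by (auto simp: agree_off_def holds_matrix_def stride_def)
    qed (use h in \<open>auto simp: agree_off_def\<close>)
    have r5: "runs W (Seq (Loop (Var aB <e Var aN) (step_prog P)) (Seq rows_prog (Seq inverse_prog out_prog))) s1
       (block_time q + n1 * (n1 * 60 + 90) + N * 50 + 70) ?Q"
      if h: "agree_off {aI, aJ, aL, aP, aQ, aU, aM, aD} s1 ?s1 \<and>
       (\<forall>e<N. s1 aU e = of_bool (e \<in> U0)) \<and> holds_matrix N s1 (incidence E F) \<and> s1 aD 0 = stride" for s1
    proof (rule runs_mono, rule run_eliminate_and_output[where ?n1.0 = n1])
      have a: "s1 b = ?s1 b" if "b \<notin> {aI, aJ, aL, aP, aQ, aU, aM, aD}" for b using h that by (auto simp: agree_off_def)
      show "s1 aN 0 = N" "s1 0 1 = n1" using a s0 by auto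
      show "s1 b x = 0" if "b \<in> {6, aB, aO, aT, aV, aW} \<union> {dM..}" for b x
        using a[of b] z0[of b x] that by auto
      show "2 * N * (N * stride) \<le> W" using WS by linarith
      show "N = 2 ^ q" by (simp add: N_def)
      fix s' assume "let hs = filter (\<lambda>i. i \<notin> Ut N) [0..<n1] in s' 6 0 = length hs \<and>
       (\<forall>i<n1. \<forall>j<length hs. s' 7 (i * length hs + j) = bit_nat (annotation_bit (At N) pv N (hs ! j) i))"
      then show "?Q s'" using Nn unfolding U0_def TE_def Let_def by blast
    qed (use h Nn U0_def in auto)
    have "runs W (Seq tree_prog (Seq padrow_prog (Seq incidence_prog (Seq (stride_prog c)
     (Seq (Loop (Var aB <e Var aN) (step_prog P)) (Seq rows_prog (Seq inverse_prog out_prog))))))) ?s1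
      ((n1 * (n0 * 40 + 92) + n0 * 20 + 50) + ((N * 40 + 20) + ((n1 * (n2 * 90 + 40) + 20) +
        ((c * 10 + 50) + (block_time q + n1 * (n1 * 60 + 90) + N * 50 + 70))))) ?Q"
      by (rule runs_Seq[OF r1], rule runs_Seq[OF r2], assumption, rule runs_Seq[OF r3], assumption,
          rule runs_Seq[OF r4], assumption, rule r5, assumption)
    then show ?thesis unfolding N_def[symmetric]
      by (rule runs_le) (use T[OF q] in \<open>simp add: N_def[symmetric] algebra_simps\<close>)
  qed
  \<comment> \<open>An actual \<open>q\<close> is needed to see that the truncated difference in
    \<open>rest\<close> loses nothing. It is extracted from the terminating run of
    \<open>pad_prog\<close>.\<close>
  have "\<exists>q. n1 + n2 \<le> 2 ^ q \<and> 2 ^ q \<le> 2 * (n1 + n2) + (1::nat)"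
  proof -
    have "runs W pad_prog ?s0 ((n1 + n2) * 20 + 20)
     (\<lambda>s'. \<exists>k. s' = set_var ?s0 aN (2 ^ k) \<and> n1 + n2 \<le> 2 ^ k \<and> 2 ^ k \<le> 2 * (n1 + n2) + 1)"
      by (rule run_pad) (use s0 W0 in auto)
    then show ?thesis unfolding run_def by blast
  qed
  then obtain q where "n1 + n2 \<le> 2 ^ q" "2 ^ q \<le> 2 * (n1 + n2) + (1::nat)" by blast
  from T[OF this] have TT: "(n1 + n2) * 20 + 20 \<le> T" by (simp add: algebra_simps)
  have "runs W (full_prog P c) ?s0 ((n1 + n2) * 20 + 20 + (T - ((n1 + n2) * 20 + 20))) ?Q"
    unfolding full_prog_def
    by (rule runs_Seq[OF run_pad[where s = ?s0, OF s0(2,3) W0(1)]]) (elim exE conjE, hypsubst, rule rest)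
  then show ?thesis using TT by simp
qed

section \<open>The time bound\<close>

lemma powr_bounds:
  fixes b \<omega> :: real
  assumes "1 \<le> b" "2 < \<omega>"
  shows "b ^ 2 \<le> b powr \<omega>" "b \<le> b powr (\<omega> - 1)" "1 \<le> b powr (\<omega> - 1)" "b powr \<omega> = b * b powr (\<omega> - 1)"
proof -
  show "b ^ 2 \<le> b powr \<omega>" using assms powr_mono[of 2 \<omega> b] by simp
  show "b \<le> b powr (\<omega> - 1)" using assms powr_mono[of 1 "\<omega> - 1" b] by simp
  then show "1 \<le> b powr (\<omega> - 1)" using assms by simp
  show "b powr \<omega> = b * b powr (\<omega> - 1)" using assms powr_add[of b 1 "\<omega> - 1"] by simp
qed

context solver begin

text \<open>There are \<open>N div b\<close> products at cost \<open>b powr \<omega>\<close>. The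
  constants accumulate as 136 = 100 + 24 + 12 from \<open>fill_time\<close>, 448 = 3 * 136 + 40 per
  band, 604 = 448 + 136 + 20 and 684 = 604 + 80.\<close>

lemma update_time_bound:
  fixes \<omega> C :: real
  assumes \<omega>: "2 < \<omega>" and C: "\<And>m. 1 \<le> m \<Longrightarrow> real (time m) \<le> C * real m powr \<omega>"
    and b: "1 \<le> b" "b \<le> N"
  shows "real (update_time b + 80) \<le> (684 + 4 * C) * (real N * real b powr (\<omega> - 1))"
proof -
  define x where "x = real b"
  have x: "1 \<le> x" "x \<le> real N" using b by (auto simp: x_def)
  note pb = powr_bounds[OF x(1) \<omega>]
  let ?p = "x powr (\<omega> - 1)"
  have xx: "x * x \<le> x * ?p" using pb(2) x by (intro mult_left_mono) auto
  have one: "1 \<le> x * x" using x mult_mono[of 1 x 1 x] by simp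
  have xle: "x \<le> x * x" using x mult_left_mono[of 1 x x] by simp
  have fill: "real (fill_time b) \<le> 136 * (x * x)"
    using one xle by (simp add: fill_time_def x_def algebra_simps)
  have t: "real (time b) \<le> C * (x * ?p)" using C[OF b(1)] pb(4) by (simp add: x_def)
  have C0: "0 \<le> C" using C[of 1] by (simp add: order_trans[OF of_nat_0_le_iff])
  have dv: "real (N div b) \<le> real N / x" by (simp add: x_def of_nat_div_le_of_nat)
  have Np: "x * x \<le> real N * ?p" using pb(2) x by (intro mult_mono) auto
  have inner: "3 * real (fill_time b) + 4 * real (time b) + 40 \<le> (448 + 4 * C) * (x * ?p)"
    using fill xx t one by (simp add: algebra_simps)
  have "real (N div b) * (3 * real (fill_time b) + 4 * real (time b) + 40)
      \<le> real N / x * ((448 + 4 * C) * (x * ?p))"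
    using x by (intro mult_mono dv inner) auto
  also have "\<dots> = (448 + 4 * C) * (real N * ?p)" using x by simp
  finally have "real (update_time b) \<le> (448 + 4 * C) * (real N * ?p) + real (fill_time b) + 20"
    by (simp add: update_time_def)
  also have "\<dots> \<le> (448 + 4 * C) * (real N * ?p) + 136 * (real N * ?p) + 20 * (real N * ?p)"
    using fill Np one by simp
  finally have "real (update_time b) \<le> (604 + 4 * C) * (real N * ?p)" by (simp add: algebra_simps)
  moreover have "80 \<le> 80 * (real N * ?p)" using one Np by simp
  ultimately show ?thesis unfolding x_def by (simp add: algebra_simps)
qed

text \<open>Doubling the block multiplies the bound by \<open>2 powr (\<omega> - 1)\<close>, whereas
  the recursion only doubles the time. The gap is positive as \<omega> > 2, and \<open>D\<close> is
  large enough for it to absorb both updates. The constant 130 = 50 + 80 handles a single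
  column.\<close>

lemma block_time_bound:
  fixes \<omega> C D :: real
  assumes \<omega>: "2 < \<omega>" and C: "\<And>m. 1 \<le> m \<Longrightarrow> real (time m) \<le> C * real m powr \<omega>"
    and D: "130 \<le> D" "2 * (684 + 4 * C) \<le> D * (2 powr (\<omega> - 1) - 2)"
    and j: "2 ^ j \<le> N"
  shows "real (block_time j) \<le> D * (real N * (2 ^ j) powr (\<omega> - 1))"
  using j
proof (induction j)
  case 0
  have "real (N * 50 + 80) \<le> 130 * real N" using N1 by simp
  also have "\<dots> \<le> D * real N" using D by (intro mult_right_mono) auto
  finally show ?case by simp
next
  case (Suc j)
  let ?y = "real N * (2 ^ j) powr (\<omega> - 1)"
  have U: "real (update_time (2 ^ j) + 80) \<le> (684 + 4 * C) * ?y"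
    using update_time_bound[OF \<omega> C, of "2 ^ j"] Suc.prems by simp
  have B: "real (block_time j) \<le> D * ?y" using Suc by simp
  have "real (block_time (Suc j)) = 2 * real (block_time j) + 2 * real (update_time (2 ^ j) + 80)" by simp
  also have "\<dots> \<le> (2 * D + 2 * (684 + 4 * C)) * ?y" using U B by (simp add: algebra_simps)
  also have "\<dots> \<le> (D * 2 powr (\<omega> - 1)) * ?y" using D by (intro mult_right_mono) (auto simp: algebra_simps)
  also have "\<dots> = D * (real N * (2 ^ Suc j) powr (\<omega> - 1))" by (simp add: powr_mult)
  finally show ?case .
qed

end

text \<open>The finitely many arguments below the threshold of the O-bound are covered by a maximum
  of quotients; starting at 1 avoids division by zero.\<close>

lemma powr_dominates:
  assumes "(\<lambda>m. real (f m)) \<in> O(\<lambda>m. real m powr \<omega>)"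
  shows "\<exists>C. \<forall>m\<ge>1. real (f m) \<le> C * real m powr \<omega>"
proof -
  obtain C n where C: "\<And>m. n \<le> m \<Longrightarrow> norm (real (f m)) \<le> C * norm (real m powr \<omega>)"
    using landau_o.bigE[OF assms] unfolding eventually_sequentially by metis
  define C' where "C' = max C (Max ((\<lambda>m. real (f m) / real m powr \<omega>) ` {1..max 1 n}))"
  have "real (f m) \<le> C' * real m powr \<omega>" if m: "1 \<le> m" for m
  proof (cases "n \<le> m")
    case True
    then have "real (f m) \<le> C * real m powr \<omega>" using C[of m] by simp
    also have "\<dots> \<le> C' * real m powr \<omega>" by (intro mult_right_mono) (auto simp: C'_def)
    finally show ?thesis .
  next
    case False
    then have "real (f m) / real m powr \<omega> \<le> C'" unfolding C'_def using m
      by (intro max.coboundedI2 Max_ge) auto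
    then show ?thesis using m by (simp add: field_simps)
  qed
  then show ?thesis by blast
qed

text \<open>With \<open>m = n + 2\<close>, the estimate \<open>N + 2 \<le> 2 * m \<le> m ^ 2\<close>
  bounds each factor by a power of \<open>m\<close>; numerical constants are absorbed as powers of
  2.\<close>

lemma word_bound:
  fixes n :: nat
  assumes "n0 \<le> n" "n1 \<le> n" "N \<le> 2 * n + 1"
  shows "n0 + n1 + 4 * (N * N) + 4 * N + 10 + (2 * N * N + 1) * ((N + 2) ^ (c + 2) + 1) \<le> (n + 2) ^ (2 * c + 12)"
proof -
  define m where "m = n + 2"
  have m: "2 \<le> m" by (simp add: m_def)
  have N: "N + 2 \<le> 2 * m" using assms by (simp add: m_def)
  also have "2 * m \<le> m ^ 2" using m by (simp add: power2_eq_square)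
  finally have Nm: "N + 2 \<le> m ^ 2" .
  have p: "(N + 2) ^ (c + 2) \<le> m ^ (2 * c + 4)"
  proof -
    have "(N + 2) ^ (c + 2) \<le> (m ^ 2) ^ (c + 2)" by (rule power_mono[OF Nm]) simp
    also have "\<dots> = m ^ (2 * (c + 2))" by (rule power_mult[symmetric])
    also have "2 * (c + 2) = 2 * c + 4" by simp
    finally show ?thesis .
  qed
  have NN: "N * N \<le> 4 * m ^ 2" using mult_le_mono[of N "2 * m" N "2 * m"] N by (simp add: power2_eq_square)
  have m2: "m \<le> m ^ 2" "4 \<le> m ^ 2" using m mult_le_mono[of 2 m 2 m] by (auto simp: power2_eq_square)
  have A: "n0 + n1 + 4 * (N * N) + 4 * N + 10 \<le> m ^ 7"
  proof -
    have "n0 + n1 + 4 * (N * N) + 4 * N + 10 \<le> 32 * m ^ 2"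
      using assms NN N m2 unfolding m_def by simp
    also have "\<dots> \<le> m ^ 5 * m ^ 2" using power_mono[of 2 m 5] m by (intro mult_le_mono1) simp
    finally show ?thesis by (simp add: power_add[symmetric])
  qed
  have B: "2 * N * N + 1 \<le> m ^ 6"
  proof -
    have "2 * N * N + 1 \<le> 16 * m ^ 2" using NN m2 by simp
    also have "\<dots> \<le> m ^ 4 * m ^ 2" using power_mono[of 2 m 4] m by (intro mult_le_mono1) simp
    finally show ?thesis by (simp add: power_add[symmetric])
  qed
  have D: "(N + 2) ^ (c + 2) + 1 \<le> m ^ (2 * c + 5)"
  proof -
    have "(N + 2) ^ (c + 2) + 1 \<le> m ^ (2 * c + 4) + m ^ (2 * c + 4)" using p m by (intro add_mono) auto
    also have "\<dots> \<le> m * m ^ (2 * c + 4)" using mult_le_mono1[OF m, of "m ^ (2 * c + 4)"] by linarith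
    also have "\<dots> = m ^ Suc (2 * c + 4)" by (rule power_Suc[symmetric])
    also have "Suc (2 * c + 4) = 2 * c + 5" by simp
    finally show ?thesis .
  qed
  have "(2 * N * N + 1) * ((N + 2) ^ (c + 2) + 1) \<le> m ^ 6 * m ^ (2 * c + 5)" by (rule mult_le_mono[OF B D])
  also have "\<dots> = m ^ (2 * c + 11)" by (simp add: power_add[symmetric] algebra_simps)
  finally have E: "(2 * N * N + 1) * ((N + 2) ^ (c + 2) + 1) \<le> m ^ (2 * c + 11)" .
  have F: "m ^ 7 \<le> m ^ (2 * c + 11)" using m by (intro power_increasing) auto
  have "m ^ (2 * c + 11) + m ^ (2 * c + 11) \<le> m * m ^ (2 * c + 11)"
    using mult_le_mono1[OF m, of "m ^ (2 * c + 11)"] by linarith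
  also have "\<dots> = m ^ Suc (2 * c + 11)" by (rule power_Suc[symmetric])
  also have "Suc (2 * c + 11) = 2 * c + 12" by simp
  finally have G: "m ^ (2 * c + 11) + m ^ (2 * c + 11) \<le> m ^ (2 * c + 12)" .
  show ?thesis unfolding m_def[symmetric] using A E F G by linarith
qed

definition computed :: "nat \<Rightarrow> (nat \<times> nat) list \<Rightarrow> (nat \<times> nat \<times> nat) list \<Rightarrow> nat \<Rightarrow> memory \<Rightarrow> bool" where
  "computed n0 E F N s \<longleftrightarrow> (let M = incidence E F; U0 = tree_edges E \<union> {length E..<N};
     hs = filter (\<lambda>i. i \<notin> elimination.Ut N M U0 N) [0..<length E] in s 6 0 = length hs \<and>
       (\<forall>i<length E. \<forall>j<length hs. s 7 (i * length hs + j) =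
          bit_nat (annotation_bit (elimination.At N M U0 N) (elimination.pv N M U0) N (hs ! j) i)))"

lemma fast_program:
  fixes \<omega> :: real
  assumes \<omega>: "2 < \<omega>" and mult: "matrix_mult_exponent \<omega>"
  shows "\<exists>P c (time :: nat \<Rightarrow> nat). (\<lambda>n. real (time n)) \<in> O(\<lambda>n. real n powr \<omega>) \<and>
    (\<forall>n n0 E F. 1 \<le> n \<longrightarrow> n0 \<le> n \<longrightarrow> length E + length F \<le> n \<longrightarrow>
       (\<forall>(u, v)\<in>set E. u < n0 \<and> v < n0) \<longrightarrow>
       (\<forall>(x, y, z)\<in>set F. x < n0 \<and> y < n0 \<and> z < n0 \<and> x \<noteq> y \<and> x \<noteq> z \<and> y \<noteq> z) \<longrightarrow>
       halts_within ((n + 2) ^ c) P (complex_input n0 E F) (time n)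
         (\<lambda>s. \<exists>N. length E + length F \<le> N \<and> computed n0 E F N s))"
proof -
  obtain P c f where f: "(\<lambda>m. real (f m)) \<in> O(\<lambda>m. real m powr \<omega>)" and P: "multiplies P c f"
    using mult unfolding matrix_mult_exponent_def multiplies_def by blast
  obtain C where C: "\<And>m. 1 \<le> m \<Longrightarrow> real (f m) \<le> C * real m powr \<omega>" using powr_dominates[OF f] by blast
  have C0: "0 \<le> C" using C[of 1] by (simp add: order_trans[OF of_nat_0_le_iff])
  define d where "d = 2 powr (\<omega> - 1) - (2 :: real)"
  have "2 powr 1 < 2 powr (\<omega> - 1)" using \<omega> by (intro powr_less_mono) auto
  then have d: "0 < d" by (simp add: d_def)
  \<comment> \<open>Chosen to meet both requirements of \<open>block_time_bound\<close>: multiplied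
    by the gap \<open>d\<close> it exceeds \<open>2 * (684 + 4 * C)\<close>.\<close>
  define D where "D = 130 + 2 * (684 + 4 * C) / d"
  have D: "130 \<le> D" "2 * (684 + 4 * C) \<le> D * (2 powr (\<omega> - 1) - 2)"
    using d C0 unfolding d_def[symmetric] by (auto simp: D_def field_simps)
  \<comment> \<open>The factor \<open>3 powr \<omega>\<close> stems from
    \<open>N \<le> 3 * n\<close>; the second summand collects all work outside the elimination,
    which is quadratic in \<open>n\<close>.\<close>
  define K where "K = D * 3 powr \<omega> + (1200 + 10 * real c)"
  define time where "time n = nat \<lceil>K * real n powr \<omega>\<rceil>" for n :: nat
  have K0: "0 \<le> K" using D by (simp add: K_def)
  have "(\<lambda>n. real (time n)) \<in> O(\<lambda>n. real n powr \<omega>)"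
  proof (rule bigoI[where c = "K + 1"], rule eventually_sequentiallyI[of 1])
    fix n :: nat assume n: "1 \<le> n"
    then have "1 \<le> real n powr \<omega>" using \<omega> by (intro ge_one_powr_ge_zero) auto
    moreover have "real (time n) \<le> K * real n powr \<omega> + 1"
      using K0 unfolding time_def by (simp add: of_nat_ceiling)
    ultimately show "norm (real (time n)) \<le> (K + 1) * norm (real n powr \<omega>)" by (simp add: algebra_simps)
  qed
  moreover have "halts_within ((n + 2) ^ (2 * c + 12)) (full_prog P c) (complex_input n0 E F) (time n)
         (\<lambda>s. \<exists>N. length E + length F \<le> N \<and> computed n0 E F N s)"
    if n: "1 \<le> n" "n0 \<le> n" "length E + length F \<le> n"
      and E: "\<forall>(u, v)\<in>set E. u < n0 \<and> v < n0"
      and F: "\<forall>(x, y, z)\<in>set F. x < n0 \<and> y < n0 \<and> z < n0 \<and> x \<noteq> y \<and> x \<noteq> z \<and> y \<noteq> z"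
    for n n0 and E :: "(nat \<times> nat) list" and F :: "(nat \<times> nat \<times> nat) list"
  proof -
    let ?n1 = "length E" and ?n2 = "length F"
    have W: "n0 + ?n1 + 4 * (N * N) + 4 * N + 10 + (2 * N * N + 1) * ((N + 2) ^ (c + 2) + 1) \<le> (n + 2) ^ (2 * c + 12)"
      if "N \<le> 2 * (?n1 + ?n2) + 1" for N
      by (rule word_bound) (use that n in auto)
    have T: "solver.block_time f (2 ^ q) q + ?n1 * (?n1 * 60 + n0 * 40 + ?n2 * 90 + 300) + n0 * 20 + ?n2 * 20 + 2 ^ q * 90
        + c * 10 + 300 \<le> time n" if q: "2 ^ q \<le> 2 * (?n1 + ?n2) + 1" for q
    proof -
      define N :: nat where "N = 2 ^ q"
      have N: "1 \<le> N" "N \<le> 3 * n" using q n by (auto simp: N_def)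
      let ?W = "4 * (N * N) + 10"
      \<comment> \<open>The interpretation gives access to \<open>block_time\<close>, whose value is
        determined by \<open>f\<close> and \<open>N\<close>.\<close>
      interpret solver P c f N ?W "(N + 2) ^ (c + 2) + 1" "incidence E F" "{}"
        by unfold_locales (use P N in auto)
      have "real (block_time q) \<le> D * (real N * (2 ^ q) powr (\<omega> - 1))"
        by (rule block_time_bound[OF \<omega> C D]) (simp_all add: N_def)
      also have "\<dots> = D * real N powr \<omega>" using powr_bounds(4)[of "real N" \<omega>] N \<omega> by (simp add: N_def)
      also have "\<dots> \<le> D * (3 * real n) powr \<omega>" using N D \<omega> by (intro mult_left_mono powr_mono2) auto
      also have "\<dots> = D * 3 powr \<omega> * real n powr \<omega>" by (simp add: powr_mult)
      finally have 1: "real (block_time q) \<le> D * 3 powr \<omega> * real n powr \<omega>" .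
      have nn: "n \<le> n * n" "1 \<le> n * n" using n by auto
      have "?n1 * (?n1 * 60 + n0 * 40 + ?n2 * 90 + 300) \<le> n * (n * 60 + n * 40 + n * 90 + 300)"
        using n by (intro mult_le_mono add_mono) auto
      also have "\<dots> = n * n * 190 + n * 300" by (simp add: algebra_simps)
      also have "\<dots> \<le> n * n * 490" using nn by linarith
      finally have "?n1 * (?n1 * 60 + n0 * 40 + ?n2 * 90 + 300) \<le> n * n * 490" .
      moreover have "n0 * 20 + ?n2 * 20 + N * 90 \<le> n * n * 310" using nn n N by linarith
      moreover have "c * 10 + 300 \<le> n * n * (c * 10 + 300)" using nn by (metis mult_1 mult_le_mono1)
      ultimately have "?n1 * (?n1 * 60 + n0 * 40 + ?n2 * 90 + 300) + n0 * 20 + ?n2 * 20 + N * 90 + c * 10 + 300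
          \<le> n * n * (1200 + 10 * c)" by (simp add: algebra_simps)
      then have "real (?n1 * (?n1 * 60 + n0 * 40 + ?n2 * 90 + 300) + n0 * 20 + ?n2 * 20 + N * 90 + c * 10 + 300)
          \<le> real (n * n * (1200 + 10 * c))" by (simp only: of_nat_le_iff)
      also have "\<dots> = (1200 + 10 * real c) * real n ^ 2" by (simp add: power2_eq_square algebra_simps)
      also have "\<dots> \<le> (1200 + 10 * real c) * real n powr \<omega>"
        using powr_bounds(1)[of "real n" \<omega>] n \<omega> by (intro mult_left_mono) auto
      finally have "real (block_time q + (?n1 * (?n1 * 60 + n0 * 40 + ?n2 * 90 + 300) + n0 * 20 + ?n2 * 20 + N * 90 + c * 10 + 300))
         \<le> K * real n powr \<omega>" using 1 by (simp add: K_def algebra_simps)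
      also have "\<dots> \<le> real (time n)" unfolding time_def by (rule real_nat_ceiling_ge)
      finally have "block_time q + (?n1 * (?n1 * 60 + n0 * 40 + ?n2 * 90 + 300) + n0 * 20 + ?n2 * 20 + N * 90 + c * 10 + 300)
         \<le> time n" by (simp only: of_nat_le_iff)
      then show ?thesis unfolding N_def by (simp only: add.assoc)
    qed
    have "runs ((n + 2) ^ (2 * c + 12)) (full_prog P c) (load (complex_input n0 E F)) (time n)
      (\<lambda>s. \<exists>N. length E + length F \<le> N \<and>
     (let M = incidence E F; U0 = tree_edges E \<union> {length E..<N};
          hs = filter (\<lambda>i. i \<notin> elimination.Ut N M U0 N) [0..<length E] in s 6 0 = length hs \<and>
       (\<forall>i<length E. \<forall>j<length hs. s 7 (i * length hs + j) =
          bit_nat (annotation_bit (elimination.At N M U0 N) (elimination.pv N M U0) N (hs ! j) i))))"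
      by (rule run_full[OF P]) (use E F W T in auto)
    then show ?thesis unfolding run_def halts_within_def computed_def by blast
  qed
  ultimately show ?thesis by blast
qed

section \<open>The spanning tree\<close>

lemma kruskal_labels: "e < m \<Longrightarrow> fst (kruskal u v m) (u e) = fst (kruskal u v m) (v e)"
proof (induction m)
  case (Suc m)
  show ?case
  proof (cases "e = m")
    case False
    then have "fst (kruskal u v m) (u e) = fst (kruskal u v m) (v e)" using Suc by simp
    then show ?thesis by (simp add: Let_def)
  qed (simp add: Let_def)
qed simp

lemma kruskal_tree_edge: "e \<in> snd (kruskal u v m) \<Longrightarrow> u e \<noteq> v e"
  by (induction m) (auto simp: Let_def split: if_splits)

text \<open>Merging two labels is accompanied by accepting an edge between the two components. The
  relation is symmetric because it compares unordered pairs.\<close>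

lemma kruskal_connected:
  "fst (kruskal u v m) x = fst (kruskal u v m) y \<Longrightarrow>
     (x, y) \<in> {(x, y). \<exists>e\<in>snd (kruskal u v m). {x, y} = {u e, v e}}\<^sup>*"
proof (induction m arbitrary: x y)
  case (Suc m)
  let ?L = "fst (kruskal u v m)" and ?S = "snd (kruskal u v m)"
  let ?R = "\<lambda>S. {(x, y). \<exists>e\<in>S. {x, y} = {u e, v e}}"
  show ?case
  proof (cases "?L (u m) = ?L (v m)")
    case True
    then show ?thesis using Suc by (simp add: Let_def)
  next
    case False
    let ?R' = "(?R (insert m ?S))\<^sup>*"
    have S: "snd (kruskal u v (Suc m)) = insert m ?S"
      and L: "fst (kruskal u v (Suc m)) = (\<lambda>x. if ?L x = ?L (u m) then ?L (v m) else ?L x)"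
      using False by (simp_all add: Let_def)
    have IH: "(x, y) \<in> ?R'" if "?L x = ?L y" for x y
    proof (rule subsetD[OF rtrancl_mono])
      show "?R ?S \<subseteq> ?R (insert m ?S)" by blast
      show "(x, y) \<in> (?R ?S)\<^sup>*" by (rule Suc.IH[OF that])
    qed
    have uv: "(u m, v m) \<in> ?R'" "(v m, u m) \<in> ?R'" by (auto simp: insert_commute)
    have "?L x = ?L y \<or> ?L x = ?L (u m) \<and> ?L y = ?L (v m) \<or> ?L x = ?L (v m) \<and> ?L y = ?L (u m)"
      using Suc.prems unfolding L by (simp split: if_splits)
    then show ?thesis unfolding S using IH uv by (metis (no_types, lifting) rtrancl_trans)
  qed
qed simp

text \<open>Double counting of the incidences between vertices and edges.\<close>

lemma sum_degrees:
  assumes "finite X" "finite c"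
  shows "(\<Sum>x\<in>X. card {f \<in> c. x \<in> f}) = (\<Sum>f\<in>c. card {x \<in> X. x \<in> f})"
  using sum.swap[of "\<lambda>x f. of_bool (x \<in> f) :: nat" c X] assms by (simp add: sum_of_bool_eq Int_def)

text \<open>An even edge set through the newest edge \<open>{u m, v m}\<close> would have odd total degree on the
  component of \<open>u m\<close>, because every older edge meets that component in zero or two vertices.\<close>

lemma kruskal_forest:
  "c \<subseteq> (\<lambda>e. {u e, v e}) ` snd (kruskal u v m) \<Longrightarrow> finite c \<Longrightarrow> even_set c \<Longrightarrow> c = {}"
proof (induction m)
  case (Suc m)
  let ?L = "fst (kruskal u v m)" and ?T = "(\<lambda>e. {u e, v e}) ` snd (kruskal u v m)"
  show ?case
  proof (cases "?L (u m) = ?L (v m)")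
    case True
    then show ?thesis using Suc by (simp add: Let_def)
  next
    case False
    then have sub: "c \<subseteq> insert {u m, v m} ?T" using Suc.prems(1) by (simp add: Let_def)
    show ?thesis
    proof (cases "{u m, v m} \<in> c")
      case True
      let ?X = "{x \<in> \<Union>c. ?L x = ?L (u m)}"
      have "finite f" if "f \<in> c" for f using sub that by auto
      then have "finite (\<Union>c)" by (rule finite_Union[OF Suc.prems(2)])
      then have X: "finite ?X" by (rule rev_finite_subset) blast
      have old: "even (card {x \<in> ?X. x \<in> f})" if f: "f \<in> c - {{u m, v m}}" for f
      proof -
        obtain e where e: "e \<in> snd (kruskal u v m)" "f = {u e, v e}" using f sub by auto
        have eq: "?L (u e) = ?L (v e)" using kruskal_subset[of u v m] e(1) by (intro kruskal_labels) auto
        have "{x \<in> ?X. x \<in> f} = (if ?L (u e) = ?L (u m) then {u e, v e} else {})"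
          using f e eq by auto
        then show ?thesis using kruskal_tree_edge[OF e(1)] by simp
      qed
      have "{x \<in> ?X. x \<in> {u m, v m}} = {u m}" using True False by auto
      then have new: "odd (card {x \<in> ?X. x \<in> {u m, v m}})" by simp
      let ?B = "\<Sum>f\<in>c - {{u m, v m}}. card {x \<in> ?X. x \<in> f}"
      have eq: "(\<Sum>x\<in>?X. card {f \<in> c. x \<in> f}) = card {x \<in> ?X. x \<in> {u m, v m}} + ?B"
        unfolding sum_degrees[OF X Suc.prems(2)] using True Suc.prems(2) by (rule sum.remove[rotated])
      have "even (\<Sum>x\<in>?X. card {f \<in> c. x \<in> f})"
        using Suc.prems(3) by (intro dvd_sum) (simp add: even_set_def)
      then have "even (card {x \<in> ?X. x \<in> {u m, v m}} + ?B)" unfolding eq .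
      moreover have "even ?B" using old by (rule dvd_sum)
      ultimately have False using new unfolding even_add by blast
      then show ?thesis ..
    next
      case False
      then show ?thesis using sub Suc by blast
    qed
  qed
qed simp

lemma walk_if_rtrancl:
  assumes "(a, b) \<in> {(x, y). {x, y} \<in> T}\<^sup>*" "a \<in> V" "\<Union>T \<subseteq> V"
  shows "\<exists>p. walk V T a b p"
  using assms(1)
proof induction
  case base
  have "walk V T a a [a]" using assms(2) by (simp add: walk_def)
  then show ?case ..
next
  case (step b c)
  then obtain p where p: "walk V T a b p" by blast
  have "{b, c} \<in> T" using step.hyps(2) by simp
  then have "walk V T a c (p @ [c])"
    using p assms(3) by (auto simp: walk_def path_edges_snoc)
  then show ?case ..
qed

lemma walk_invariant:
  assumes "walk V F a b p" "\<And>x y. {x, y} \<in> F \<Longrightarrow> L x = L y"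
  shows "L a = L b"
proof -
  have inv: "i < length p \<Longrightarrow> L (p ! i) = L (p ! 0)" for i
  proof (induction i)
    case (Suc i)
    have "{p ! i, p ! Suc i} \<in> F" using assms(1) Suc.prems by (auto simp: walk_def path_edges_def)
    then show ?case using assms(2) Suc by fastforce
  qed simp
  have p: "p \<noteq> []" "hd p = a" "last p = b" using assms(1) by (auto simp: walk_def)
  have "L (last p) = L (hd p)" using inv[of "length p - 1"] p(1) by (simp add: hd_conv_nth last_conv_nth)
  then show ?thesis unfolding p ..
qed

text \<open>After the last edge both ends of every edge have the same label. As the complex is
  connected, all labels coincide, and equal labels are joined by accepted edges.\<close>

lemma spanning_tree_edges:
  assumes K: "connected_2_complex K" and rp: "represents n0 E F K"
  shows "spanning_tree (vertices K) (edges K) ((!) (pair_edges E) ` tree_edges E)" (is "spanning_tree ?V ?E ?T")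
proof -
  let ?u = "\<lambda>e. fst (E ! e)" and ?v = "\<lambda>e. snd (E ! e)"
  have te: "tree_edges E \<subseteq> {..<length E}" unfolding tree_edges_def by (rule kruskal_subset)
  have nth: "pair_edges E ! e = {?u e, ?v e}" if "e < length E" for e
    using that by (simp add: pair_edges_def case_prod_beta)
  have T: "?T = (\<lambda>e. {?u e, ?v e}) ` tree_edges E" using te nth by (intro image_cong) auto
  have es: "set (pair_edges E) = ?E" using rp by (simp add: represents_def enumerates_def)
  have len: "length (pair_edges E) = length E" by (simp add: pair_edges_def)
  have TE: "?T \<subseteq> ?E" using te unfolding es[symmetric] by (auto simp: len)
  have "acyclic_graph ?T" unfolding T unfolding tree_edges_def
    by (rule no_even_set_acyclic) (rule kruskal_forest)
  moreover have "connected_graph ?V ?T" unfolding connected_graph_def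
  proof (intro conjI ballI)
    show "?V \<noteq> {}" using K by (simp add: connected_2_complex_def connected_graph_def)
    fix a b assume ab: "a \<in> ?V" "b \<in> ?V"
    then obtain p where p: "walk ?V ?E a b p"
      using K unfolding connected_2_complex_def connected_graph_def by blast
    let ?L = "fst (kruskal ?u ?v (length E))"
    have "?L a = ?L b" using p
    proof (rule walk_invariant)
      fix x y assume "{x, y} \<in> ?E"
      then obtain e where e: "e < length E" "{x, y} = {?u e, ?v e}"
        unfolding es[symmetric] in_set_conv_nth len using nth by metis
      then show "?L x = ?L y" using kruskal_labels[OF e(1), of ?u ?v] by (auto simp: doubleton_eq_iff)
    qed
    then have "(a, b) \<in> {(x, y). {x, y} \<in> ?T}\<^sup>*"
      using kruskal_connected[of ?u ?v "length E" a b] unfolding T unfolding image_iff tree_edges_def by simp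
    then show "\<exists>p. walk ?V ?T a b p"
      by (rule walk_if_rtrancl) (use ab TE in \<open>auto simp: simplices_def\<close>)
  qed
  ultimately show ?thesis using TE by (simp add: spanning_tree_def)
qed

section \<open>Correctness of the program\<close>

text \<open>Padding columns stay zero and therefore receive no pivot.\<close>

lemma (in elimination) zero_columns: "(\<And>i. M i x = 0) \<Longrightarrow> At t i x = 0"
  by (induction t arbitrary: i) (auto simp: At_0 At_Suc)

lemma (in elimination) annotation_bit_pivot:
  assumes c: "c < N" "pv c = Some r" and h: "h \<notin> Ut N"
  shows "annotation_bit (At N) pv N h r = At N h c"
proof -
  have "(THE x. x < N \<and> pv x = Some r) = c"
    using c by (intro the_equality) (auto intro: pv_inj)
  moreover have "r \<noteq> h" using c h by (auto simp: Ut_eq)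
  ultimately show ?thesis using c unfolding annotation_bit_def by auto
qed

lemma (in elimination) annotation_bit_other:
  assumes "\<And>c. c < N \<Longrightarrow> pv c \<noteq> Some i"
  shows "annotation_bit (At N) pv N h i = of_bool (i = h)"
  using assms by (auto simp: annotation_bit_def)

text \<open>A rewriting of \<open>unused_row\<close>: row \<open>h\<close> equals the combination of
  pivot rows, so the sum of both sides is zero. For a triangle column this is the cocycle
  condition.\<close>

lemma (in elimination) annotation_bit_sum:
  assumes h: "h < m" "h \<notin> Ut N" and m: "m \<le> N" "{m..<N} \<subseteq> U0" and x: "x < N"
  shows "(\<Sum>i<m. annotation_bit (At N) pv N h i * M i x) = 0"
proof -
  let ?P = "{c. c < N \<and> pv c \<noteq> None}" and ?f = "\<lambda>i. annotation_bit (At N) pv N h i * M i x"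
  have piv: "pv c = Some (prow c)" if "c \<in> ?P" for c using that by (auto simp: prow_def)
  have prow: "prow c < m" "prow c \<noteq> h" if "c \<in> ?P" for c
  proof -
    have r: "prow c < N" "prow c \<notin> Ut c" "prow c \<in> Ut N" using pv_Some[OF piv[OF that]] piv[OF that] that by (auto simp: Ut_eq)
    then show "prow c < m" "prow c \<noteq> h" using m h(2) by (auto simp: Ut_eq not_less[symmetric])
  qed
  have inj: "inj_on prow ?P" using piv by (intro inj_onI) (metis pv_inj)
  have "(\<Sum>i<m. ?f i) = (\<Sum>i\<in>insert h (prow ` ?P). ?f i)"
  proof (rule sum.mono_neutral_right)
    show "insert h (prow ` ?P) \<subseteq> {..<m}" using h(1) prow(1) by auto
    show "\<forall>i\<in>{..<m} - insert h (prow ` ?P). ?f i = 0"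
    proof
      fix i assume i: "i \<in> {..<m} - insert h (prow ` ?P)"
      have "pv c \<noteq> Some i" if "c < N" for c
      proof
        assume "pv c = Some i"
        then have "c \<in> ?P" "prow c = i" using that by (auto simp: prow_def)
        then show False using i by blast
      qed
      then have "annotation_bit (At N) pv N h i = of_bool (i = h)" by (rule annotation_bit_other)
      then show "?f i = 0" using i by simp
    qed
  qed simp
  also have "\<dots> = ?f h + (\<Sum>i\<in>prow ` ?P. ?f i)" using prow(2) by (subst sum.insert) auto
  also have "(\<Sum>i\<in>prow ` ?P. ?f i) = (\<Sum>c\<in>?P. ?f (prow c))" unfolding sum.reindex[OF inj] o_def ..
  also have "\<dots> = (\<Sum>c\<in>?P. At N h c * M (prow c) x)"
    using piv h(2) by (intro sum.cong) (auto simp: annotation_bit_pivot)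
  also have "\<dots> = M h x" using unused_row[OF _ h(2) x] h(1) m(1) by simp
  also have "?f h = M h x"
  proof -
    have "pv c \<noteq> Some h" if "c < N" for c using h(2) that by (auto simp: Ut_eq)
    then show ?thesis using annotation_bit_other[of h h] by simp
  qed
  finally show ?thesis by simp
qed

text \<open>The sentinel edges are ordered after the fact: first the rows \<open>hs\<close> without
  pivot, then the pivot rows \<open>rs\<close>. In this order the computed bits satisfy the
  hypotheses of \<open>output_if_functionals\<close>.\<close>

lemma computed_annotation:
  assumes K: "connected_2_complex K" and rp: "represents n0 E F K"
    and N: "length E + length F \<le> N" and s: "computed n0 E F N s"
  shows "\<exists>T ss a. spanning_tree (vertices K) (edges K) T \<and> enumerates ss (edges K - T) \<and>
    edge_annotation_output K (pair_edges E) (triple_triangles F) T ss a \<and> is_annotation K 1 a \<and>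
    holds_annotation (homology_dim K 1) (pair_edges E) a s"
proof -
  define es where "es = pair_edges E"
  define ts where "ts = triple_triangles F"
  define m where "m = length E"
  define T where "T = (!) es ` tree_edges E"
  define M where "M = incidence E F"
  define U0 where "U0 = tree_edges E \<union> {m..<N}"
  interpret elimination N M U0 .
  define hs where "hs = filter (\<lambda>i. i \<notin> Ut N) [0..<m]"
  \<comment> \<open>Excluding \<open>U0\<close> removes the tree edges, so exactly the rows that
    became pivot rows remain.\<close>
  define rs where "rs = filter (\<lambda>i. i \<notin> U0 \<and> i \<in> Ut N) [0..<m]"
  define g where "g = length hs"
  define ss where "ss = map ((!) es) (hs @ rs)"
  let ?b = "\<lambda>h i. annotation_bit (At N) pv N h i"
  have len: "length es = m" "length ts = length F"
    by (simp_all add: es_def ts_def m_def pair_edges_def triple_triangles_def)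
  have es: "enumerates es (edges K)" and ts: "enumerates ts (simplices K 2)"
    using rp by (simp_all add: represents_def es_def ts_def)
  have inj: "es ! i = es ! j \<longleftrightarrow> i = j" if "i < m" "j < m" for i j
    using es that by (simp add: enumerates_def nth_eq_iff_index_eq len)
  have tree: "tree_edges E \<subseteq> {..<m}" unfolding tree_edges_def m_def by (rule kruskal_subset)
  have T: "spanning_tree (vertices K) (edges K) T"
    unfolding T_def es_def by (rule spanning_tree_edges[OF K rp])
  have U0: "U0 \<subseteq> Ut N" unfolding Ut_eq by (rule Un_upper1)
  have hr: "set (hs @ rs) = {i. i < m \<and> i \<notin> tree_edges E}" "distinct (hs @ rs)"
    using U0 by (auto simp: hs_def rs_def U0_def)
  have ss: "enumerates ss (edges K - T)" unfolding enumerates_def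
  proof
    have io: "inj_on ((!) es) {..<m}" by (rule inj_onI) (simp add: inj)
    have d: "{i. i < m \<and> i \<notin> tree_edges E} = {..<m} - tree_edges E" by auto
    show "distinct ss" unfolding ss_def distinct_map hr(1) d
      using hr(2) inj_on_diff[OF io] by (rule conjI)
    have "edges K = (!) es ` {..<m}"
      using es len(1) by (auto simp: enumerates_def set_conv_nth)
    then show "set ss = edges K - T" unfolding ss_def set_map hr(1) T_def d
      using inj_on_image_set_diff[OF io Diff_subset tree] by simp
  qed
  interpret ec: edge_complex K es ts T ss
    using K es ts T ss by unfold_locales
  have dims: "ec.n = m" "ec.d = length F" "ec.k = g + length rs"
    unfolding ec.n_def ec.d_def ec.k_def len unfolding ss_def g_def by simp_all
  define a where "a e = vec g (\<lambda>j. ?b (hs ! j) (THE i. i < m \<and> es ! i = e))" for e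
  have a: "a (es ! i) = vec g (\<lambda>j. ?b (hs ! j) i)" if "i < m" for i
  proof -
    have "(THE i'. i' < m \<and> es ! i' = es ! i) = i" using that inj by (intro the_equality) auto
    then show ?thesis by (simp add: a_def)
  qed
  have hsj: "hs ! j < m" "hs ! j \<notin> Ut N" if "j < g" for j
    using nth_mem[of j hs] that by (auto simp: hs_def g_def)
  have tree_bit: "?b (hs ! j) i = 0" if "i \<in> tree_edges E" "j < g" for i j
  proof -
    have i: "i \<in> U0" using that(1) by (simp add: U0_def)
    have "pv c \<noteq> Some i" if "c < N" for c using pv_Some[of c i] i by (auto simp: Ut_eq)
    moreover have "i \<noteq> hs ! j" using hsj[OF that(2)] i U0 by blast
    ultimately show ?thesis using annotation_bit_other[of i] by simp
  qed
  have M: "M i x = of_bool (i \<notin> tree_edges E) * of_bool (es ! i \<subseteq> ts ! x)" if "i < m" "x < length F" for i x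
    using that by (auto simp: M_def incidence_def es_def ts_def m_def)
  have mN: "m \<le> N" "{m..<N} \<subseteq> U0" "length F \<le> N" using N by (auto simp: m_def U0_def)
  let ?P = "{c. c < N \<and> pv c \<noteq> None}"
  have P: "?P \<subseteq> {..<length F}"
  proof
    fix c assume "c \<in> ?P"
    then obtain r where "pv c = Some r" by auto
    then have "At c r c = 1" using pv_Some by blast
    then have "\<exists>i. M i c \<noteq> 0" using zero_columns[of c c r] by (metis zero_neq_one)
    then show "c \<in> {..<length F}" by (auto simp: M_def incidence_def)
  qed
  \<comment> \<open>Every row in \<open>rs\<close> has a pivot column, and the pivot columns are
    independent in the boundary matrix already by their sentinel rows.\<close>
  have rank: "length rs \<le> card (ec.G \<inter> {..<ec.d})"
  proof -
    have "set rs \<subseteq> prow ` ?P" by (fastforce simp: rs_def Ut_eq prow_def image_iff)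
    then have "card (set rs) \<le> card ?P" by (rule surj_card_le[rotated]) simp
    then have "length rs \<le> card ?P" using hr(2) by (simp add: distinct_card)
    also have "\<dots> \<le> vec_space.rank ec.n ec.D"
    proof (rule rank_ge_card[OF ec.D_carrier])
      show "?P \<subseteq> {..<ec.d}" using P by (simp only: dims)
      show "indep ec.D ?P" unfolding indep_def
      proof (intro allI impI)
        fix S assume S: "S \<subseteq> ?P" "\<forall>i<dim_row ec.D. colsum ec.D S i = 0"
        show "S = {}"
        proof (rule pivots_independent[OF S(1)])
          fix i assume "i < N"
          show "(\<Sum>x\<in>S. M i x) = 0"
          proof (cases "i < m \<and> i \<notin> tree_edges E")
            case True
            have "M i x = ec.D $$ (i, x)" if "x \<in> S" for x
              using M[of i x] ec.D_entry[of i x] True subsetD[OF P subsetD[OF S(1) that]] by (simp add: dims)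
            then have "(\<Sum>x\<in>S. M i x) = colsum ec.D S i" unfolding colsum_def by (rule sum.cong[OF HOL.refl])
            also have "\<dots> = 0" using S(2) True by (simp add: dims)
            finally show ?thesis .
          next
            case False
            then show ?thesis by (intro sum.neutral) (auto simp: M_def incidence_def m_def)
          qed
        qed
      qed
    qed
    finally show ?thesis by (simp only: ec.rank_D)
  qed
  have ss_nth: "ss ! i = es ! ((hs @ rs) ! i)" "(hs @ rs) ! i < m" if "i < ec.k" for i
  proof -
    have i: "i < length (hs @ rs)" using that by (simp add: dims(3) g_def)
    show "ss ! i = es ! ((hs @ rs) ! i)" unfolding ss_def using i by (rule nth_map)
    show "(hs @ rs) ! i < m" using nth_mem[OF i] unfolding hr(1) by blast
  qed
  have gk: "g \<le> ec.k" "ec.k \<le> g + card (ec.G \<inter> {..<ec.d})" using rank by (simp_all add: dims(3))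
  have aT: "a e = 0\<^sub>v g" if e: "e \<in> T" for e
  proof -
    obtain i where i: "i \<in> tree_edges E" "e = es ! i" using e by (auto simp: T_def)
    have im: "i < m" using i(1) tree by blast
    show ?thesis unfolding i(2) a[OF im] using tree_bit[OF i(1)] by (intro eq_vecI) simp_all
  qed
  have unit: "a (ss ! i) = unit_vec g i" if i: "i < g" for i
  proof -
    have nth: "(hs @ rs) ! i = hs ! i" using i by (simp add: nth_append g_def)
    have e: "ss ! i = es ! (hs ! i)" using ss_nth(1)[of i] gk(1) i unfolding nth by simp
    have "pv c \<noteq> Some (hs ! i)" if "c < N" for c using hsj(2)[OF i] that by (auto simp: Ut_eq)
    note other = annotation_bit_other[OF this]
    have "hs ! i = hs ! j \<longleftrightarrow> i = j" if "j < g" for j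
      using hr(2) i that unfolding g_def by (simp add: nth_eq_iff_index_eq)
    then show ?thesis unfolding e a[OF hsj(1)[OF i]] using other i by (intro eq_vecI) auto
  qed
  have carrier: "a (ss ! i) \<in> carrier_vec g" for i by (simp add: a_def)
  have triangle: "(\<Sum>e | e \<in> edges K \<and> e \<subseteq> t. a e $ l) = 0" if t: "t \<in> simplices K 2" and l: "l < g" for t l
  proof -
    obtain x where x: "x < length F" "t = ts ! x" using ec.ts_ex[OF t] unfolding dims by blast
    have "(\<Sum>e | e \<in> edges K \<and> e \<subseteq> t. a e $ l) = (\<Sum>e\<in>edges K. a e $ l * of_bool (e \<subseteq> t))"
      using ec.finE by (intro sum.mono_neutral_cong_left) auto
    also have "\<dots> = (\<Sum>i<m. a (es ! i) $ l * of_bool (es ! i \<subseteq> t))"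
      by (rule ec.sum_edges[symmetric, unfolded dims])
    also have "\<dots> = (\<Sum>i<m. ?b (hs ! l) i * M i x)"
    proof (rule sum.cong[OF HOL.refl])
      fix i assume "i \<in> {..<m}"
      then have i: "i < m" by simp
      show "a (es ! i) $ l * of_bool (es ! i \<subseteq> t) = ?b (hs ! l) i * M i x"
      proof (cases "i \<in> tree_edges E")
        case True
        then show ?thesis using tree_bit[OF True l] l by (simp add: a[OF i])
      next
        case False
        then show ?thesis using l by (simp add: a[OF i] M[OF i x(1)] x(2))
      qed
    qed
    also have "\<dots> = 0" using hsj[OF l] mN x(1) by (intro annotation_bit_sum) auto
    finally show ?thesis .
  qed
  note out = ec.output_if_functionals[of g a, OF gk aT unit carrier triangle]
  have "homology_dim K 1 = g" using ec.homology_dim out(2) by simp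
  moreover have "holds_annotation g es a s"
    unfolding holds_annotation_def len
  proof (intro conjI allI impI)
    have c: "s 6 0 = length hs" "\<forall>i<m. \<forall>j<length hs. s 7 (i * length hs + j) = bit_nat (?b (hs ! j) i)"
      using s unfolding computed_def Let_def M_def[symmetric] m_def[symmetric] U0_def[symmetric] hs_def[symmetric]
      by blast+
    then show "s 6 0 = g" by (simp add: g_def)
    fix i j assume ij: "i < m" "j < g"
    show "s 7 (i * g + j) = bit_nat (a (es ! i) $ j)"
      using c(2) ij unfolding a[OF ij(1)] by (simp add: g_def)
  qed
  ultimately have "holds_annotation (homology_dim K 1) es a s" by simp
  with T ss out(1) ec.output_annotation[OF out(1)] show ?thesis
    unfolding es_def[symmetric] ts_def[symmetric] by (intro exI conjI)
qed

theorem theorem4p3: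
  fixes \<omega> :: real
  assumes "\<omega> > 2" and "matrix_mult_exponent \<omega>"
  shows
    "(\<forall>(K :: 'v set set) es ts T ss.
        connected_2_complex K \<and>
        enumerates es (simplices K 1) \<and> enumerates ts (simplices K 2) \<and>
        spanning_tree (vertices K) (edges K) T \<and> enumerates ss (edges K - T) \<longrightarrow>
          (\<exists>a. edge_annotation_output K es ts T ss a) \<and>
          (\<forall>a. edge_annotation_output K es ts T ss a \<longrightarrow> is_annotation K 1 a)) \<and>
     (\<exists>P c (time :: nat \<Rightarrow> nat).
        (\<lambda>n. real (time n)) \<in> O(\<lambda>n. real n powr \<omega>) \<and>
        (\<forall>K n0 E F.
           connected_2_complex K \<and> represents n0 E F K \<longrightarrow>
             halts_within ((card K + 2) ^ c) P (complex_input n0 E F) (time (card K))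
               (\<lambda>s. \<exists>T ss a.
                  spanning_tree (vertices K) (edges K) T \<and> enumerates ss (edges K - T) \<and>
                  edge_annotation_output K (pair_edges E) (triple_triangles F) T ss a \<and>
                  is_annotation K 1 a \<and>
                  holds_annotation (homology_dim K 1) (pair_edges E) a s)))"
proof (intro conjI allI impI)
  fix K :: "'v set set" and es ts T ss
  assume "connected_2_complex K \<and>
        enumerates es (simplices K 1) \<and> enumerates ts (simplices K 2) \<and>
        spanning_tree (vertices K) (edges K) T \<and> enumerates ss (edges K - T)"
  then interpret edge_complex K es ts T ss by unfold_locales auto
  show "\<exists>a. edge_annotation_output K es ts T ss a" by (rule output_exists)
  show "\<And>a. edge_annotation_output K es ts T ss a \<Longrightarrow> is_annotation K 1 a" by (rule output_annotation)
next
  obtain P c and f :: "nat \<Rightarrow> nat" where f: "(\<lambda>n. real (f n)) \<in> O(\<lambda>n. real n powr \<omega>)"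
    and run: "\<And>n n0 E F. 1 \<le> n \<Longrightarrow> n0 \<le> n \<Longrightarrow> length E + length F \<le> n \<Longrightarrow>
       (\<forall>(u, v)\<in>set E. u < n0 \<and> v < n0) \<Longrightarrow>
       (\<forall>(x, y, z)\<in>set F. x < n0 \<and> y < n0 \<and> z < n0 \<and> x \<noteq> y \<and> x \<noteq> z \<and> y \<noteq> z) \<Longrightarrow>
       halts_within ((n + 2) ^ c) P (complex_input n0 E F) (f n)
         (\<lambda>s. \<exists>N. length E + length F \<le> N \<and> computed n0 E F N s)"
    using fast_program[OF assms] by blast
  have "halts_within ((card K + 2) ^ c) P (complex_input n0 E F) (f (card K))
     (\<lambda>s. \<exists>T ss a. spanning_tree (vertices K) (edges K) T \<and> enumerates ss (edges K - T) \<and>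
        edge_annotation_output K (pair_edges E) (triple_triangles F) T ss a \<and> is_annotation K 1 a \<and>
        holds_annotation (homology_dim K 1) (pair_edges E) a s)"
    if K: "connected_2_complex K" and rp: "represents n0 E F K" for K n0 E F
  proof -
    have sc: "finite K" "\<And>v. v \<in> vertices K \<Longrightarrow> {v} \<in> K"
      using K unfolding connected_2_complex_def simplicial_complex_def by blast+
    have V: "vertices K = {..<n0}" "vertices K \<noteq> {}"
      using K rp unfolding represents_def connected_2_complex_def connected_graph_def by blast+
    have "(\<lambda>v. {v}) ` {..<n0} \<subseteq> K" using sc(2) unfolding V(1) by blast
    \<comment> \<open>Vertices count as simplices through their singletons, which bounds
      \<open>n0\<close> by the number of simplices.\<close>
    then have "card ((\<lambda>v. {v}) ` {..<n0}) \<le> card K" using sc(1) by (intro card_mono)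
    then have n0: "n0 \<le> card K" by (simp add: card_image)
    have e: "distinct (pair_edges E)" "set (pair_edges E) = simplices K 1"
      and t: "distinct (triple_triangles F)" "set (triple_triangles F) = simplices K 2"
      using rp by (simp_all add: represents_def enumerates_def)
    have "length E + length F = card (simplices K 1) + card (simplices K 2)"
      unfolding e(2)[symmetric] t(2)[symmetric] distinct_card[OF e(1)] distinct_card[OF t(1)]
      by (simp add: pair_edges_def triple_triangles_def)
    also have "\<dots> = card (simplices K 1 \<union> simplices K 2)"
      using sc(1) by (intro card_Un_disjoint[symmetric]) (auto simp: simplices_def)
    also have "\<dots> \<le> card K" using sc(1) by (intro card_mono) (auto simp: simplices_def)
    finally have len: "length E + length F \<le> card K" .
    have E: "\<forall>(u, v)\<in>set E. u < n0 \<and> v < n0"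
    proof (rule ballI, clarify)
      fix u v assume "(u, v) \<in> set E"
      then have "{u, v} \<in> simplices K 1" unfolding e(2)[symmetric] by (force simp: pair_edges_def)
      then have "{u, v} \<subseteq> vertices K" by (auto simp: simplices_def)
      then show "u < n0 \<and> v < n0" unfolding V(1) by simp
    qed
    have F: "\<forall>(x, y, z)\<in>set F. x < n0 \<and> y < n0 \<and> z < n0 \<and> x \<noteq> y \<and> x \<noteq> z \<and> y \<noteq> z"
    proof (rule ballI, clarify)
      fix x y z assume "(x, y, z) \<in> set F"
      then have "{x, y, z} \<in> simplices K 2" unfolding t(2)[symmetric] by (force simp: triple_triangles_def)
      then have "{x, y, z} \<in> K" and s: "card {x, y, z} = 3" by (simp_all add: simplices_def)
      from this(1) have s1: "{x, y, z} \<subseteq> vertices K" by (rule Union_upper)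
      from s1 have "x < n0 \<and> y < n0 \<and> z < n0" unfolding V(1) by simp
      moreover have "x \<noteq> y \<and> x \<noteq> z \<and> y \<noteq> z" using s by (auto simp: card_insert_if split: if_splits)
      ultimately show "x < n0 \<and> y < n0 \<and> z < n0 \<and> x \<noteq> y \<and> x \<noteq> z \<and> y \<noteq> z" by blast
    qed
    have "1 \<le> card K" using V n0 by (cases n0) auto
    from run[OF this n0 len E F] show ?thesis
      unfolding halts_within_def using computed_annotation[OF K rp] by blast
  qed
  then show "\<exists>P c (time :: nat \<Rightarrow> nat).
        (\<lambda>n. real (time n)) \<in> O(\<lambda>n. real n powr \<omega>) \<and>
        (\<forall>K n0 E F.
           connected_2_complex K \<and> represents n0 E F K \<longrightarrow>
             halts_within ((card K + 2) ^ c) P (complex_input n0 E F) (time (card K))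
               (\<lambda>s. \<exists>T ss a.
                  spanning_tree (vertices K) (edges K) T \<and> enumerates ss (edges K - T) \<and>
                  edge_annotation_output K (pair_edges E) (triple_triangles F) T ss a \<and>
                  is_annotation K 1 a \<and>
                  holds_annotation (homology_dim K 1) (pair_edges E) a s))"
    using f by blast
qed

end
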